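(* Let $p$ be an odd prime and $n$ a positive integer such that $p\nmid n$, every group of order $np$ has a normal subgroup of order $p$, and $p\nmid\theta(n)$. Let $B_n$ be a skew brace of size $n$ with additive group $(E,\cdot)$ and let $F=\{(a,\lambda_a): a\in E\}$ be the corresponding regular subgroup of $\mathrm{Hol}(E)$. For every skew brace homomorphism $\sigma: B_n\to\mathbf{Z}_p^*$ and every group homomorphism $\tau:F\to\mathbf{Z}_p^*$, put $$G_{(\sigma,\tau)}=\left\{\left[\begin{pmatrix} m \\ a \end{pmatrix},\begin{pmatrix}\sigma(a)^{-1}\tau(a,\lambda_a) & 0 \\ 0 & \lambda_a\end{pmatrix}\right]: m\in\mathbf{Z}_p,\ a\in E\right\},$$ $$G'_{(\sigma,\tau)}=\left\{\left[\begin{pmatrix} m \\ a \end{pmatrix},\begin{pmatrix}\tau(a,\lambda_a) & \gamma_{-\sigma(a^{-1})m} \\ 0 & \lambda_a\end{pmatrix}\right]: m\in\mathbf{Z}_p,\ a\in E\right\}.$$ Then: (1) $G_{(\sigma,\tau)}$ and $G'_{(\sigma,\tau)}$ are regular subgroups of $\mathrm{Hol}(\mathbf{Z}_p\rtimes_\sigma E)$ isomorphic to $\mathbf{Z}_p\rtimes_\tau F$. (2) $G_{(1,\tau)}=G'_{(1,\tau)}$ for any $\tau$, where $1$ denotes the trivial homomorphism. (3) For a non-trivial $\sigma$, $G_{(\sigma,\tau)}$ and $G'_{(\sigma,\tau)}$ are not conjugate in $\mathrm{Hol}(\mathbf{Z}_p\rtimes_\sigma E)$. (4) Moreover, $G_{(\sigma,\tau)}$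 and $G'_{(\sigma,\tau)}$ represent the unique conjugacy classes of regular subgroups of $\mathrm{Hol}(\mathbf{Z}_p\rtimes_\sigma E)$ among the isomorphism class of $\mathbf{Z}_p\rtimes_\tau F$ (that is, among the regular subgroups isomorphic as groups to $\mathbf{Z}_p\rtimes_\tau F$) such that the quotient of the corresponding skew brace of size $np$ by the trivial brace $\mathbf{Z}_p$ is isomorphic, as a skew brace, to $B_n$.
   Context: A skew brace is a triple $(B,\cdot,\circ)$ where $(B,\cdot)$ (additive group) and $(B,\circ)$ (multiplicative group) are groups on the same set and $a\circ(b\cdot c)=(a\circ b)\cdot a^{-1}\cdot(a\circ c)$ for all $a,b,c$, with $a^{-1}$ the inverse in $(B,\cdot)$; its size is the cardinality of $B$. It is trivial if the two operations coincide. Put $\lambda_a(b)=a^{-1}\cdot(a\circ b)$; each $\lambda_a$ is an automorphism of $(B,\cdot)$. An isomorphism of skew braces is a bijection respecting both operations. An ideal is a subset $I$ that is a normal subgroup for both operations and satisfies $\lambda_a(I)\subseteq I$ for all $a$; then $B/I$ is a skew brace with the induced operations. The holomorph of a group $A$ is $\mathrm{Hol}(A)=A\rtimes\mathrm{Aut}(A)$ with $(a,f)(b,g)=(a\,f(b),fg)$, acting on $A$ by sending $b$ to $a\,f(b)$; a subgroup is regular if it acts simply transitively on $A$. For a skew brace with additive group $A$, $\{(a,\lambda_a):a\in A\}$ is a regular subgroup of $\mathrm{Hol}(A)$ isomorphic to the multiplicative group. Conversely, a regular subgroup $G$ of $\mathrm{Hol}(A)$ contains for each $a\in A$ a unique element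 $(a,f)$ with first component $a$, and the corresponding skew brace is $A$ with $a\circ b=a\cdot f(b)$. A skew brace homomorphism $B_n\to\mathbf{Z}_p^*$ is a map that is a group homomorphism from both $(B_n,\cdot)$ and $(B_n,\circ)$ to the multiplicative group $\mathbf{Z}_p^*$. $\mathbf{Z}_p$ is the additive cyclic group of order $p$, and for a homomorphism $\rho:H\to\mathbf{Z}_p^*$ the group $\mathbf{Z}_p\rtimes_\rho H$ has operation $(m,a)(m',b)=(m+\rho(a)m',ab)$. Under the stated hypotheses, the subgroup $\mathbf{Z}_p$ of $\mathbf{Z}_p\rtimes_\sigma E$ is an ideal, and a trivial brace of size $p$, in every skew brace with additive group $\mathbf{Z}_p\rtimes_\sigma E$, and the quotient by it is a skew brace of size $n$ with additive group $E$. The function $\theta:\mathbf{Z}_{>0}\to\mathbf{Z}_{>0}$ is defined on prime powers by $\theta(q^m)=|\mathrm{GL}_m(\mathbf{F}_q)|=(q^m-1)(q^m-q)\cdots(q^m-q^{m-1})$ and extended multiplicatively (to products of powers of distinct primes). For $i\in\mathbf{Z}_p$ let $\gamma_i:E\to\mathbf{Z}_p$, $\gamma_i(a)=i-\sigma(a)i$. For $\alpha\in\mathbf{Z}_p^*$, $i\in\mathbf{Z}_p$ and $\lambda\in\mathrm{Aut}(E)$ with $\sigma\lambda=\sigma$, the matrix $\begin{pmatrix}\alpha & \gamma_i \\ 0 & \lambda\end{pmatrix}$ denotes the automorphism $(m,a)\mapsto(\alpha m+\gamma_i(a),\lambda(a))$ of $\mathbf{Z}_p\rtimes_\sigma E$;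 under the stated hypotheses all automorphisms of $\mathbf{Z}_p\rtimes_\sigma E$ are of this form. Elements of $\mathrm{Hol}(\mathbf{Z}_p\rtimes_\sigma E)$ are written $\left[\begin{pmatrix} m \\ a \end{pmatrix},M\right]$ with $(m,a)\in\mathbf{Z}_p\rtimes_\sigma E$ and $M$ an automorphism.
   Formalization: Part (4) is false for unrelated isomorphisms (p=5, B trivial on Z_2^2); it is proved for isomorphisms compatible with σ and with the projections to E and F; for arbitrary ones, the skew brace is shown isomorphic to that of G or G' for some pair (σ',τ') with the same multiplicative group. *)

theory Defs
  imports "HOL-Number_Theory.Residues" "HOL-Algebra.Bij"
begin

section \<open>Holomorph and regular subgroups\<close>

definition holomorph :: "('a, 'm) monoid_scheme \<Rightarrow> ('a \<times> ('a \<Rightarrow> 'a)) monoid" where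
  "holomorph A = \<lparr>carrier = carrier A \<times> auto A,
     monoid.mult = (\<lambda>(a, f) (b, g). (a \<otimes>\<^bsub>A\<^esub> f b, f \<otimes>\<^bsub>AutoGroup A\<^esub> g)),
     one = (\<one>\<^bsub>A\<^esub>, \<one>\<^bsub>AutoGroup A\<^esub>)\<rparr>"

definition hol_act :: "('a, 'm) monoid_scheme \<Rightarrow> 'a \<times> ('a \<Rightarrow> 'a) \<Rightarrow> 'a \<Rightarrow> 'a" where
  "hol_act A = (\<lambda>(a, f) b. a \<otimes>\<^bsub>A\<^esub> f b)"

definition regular_subgroup ::
  "('a, 'm) monoid_scheme \<Rightarrow> ('a \<times> ('a \<Rightarrow> 'a)) set \<Rightarrow> bool" where
  "regular_subgroup A G \<longleftrightarrow> subgroup G (holomorph A) \<and>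
     (\<forall>x\<in>carrier A. \<forall>y\<in>carrier A. \<exists>!g. g \<in> G \<and> hol_act A g x = y)"

definition conjugate_in :: "('a, 'm) monoid_scheme \<Rightarrow> 'a set \<Rightarrow> 'a set \<Rightarrow> bool" where
  "conjugate_in H X Y \<longleftrightarrow> (\<exists>h\<in>carrier H. Y = h <#\<^bsub>H\<^esub> X #>\<^bsub>H\<^esub> inv\<^bsub>H\<^esub> h)"

section \<open>Skew braces\<close>

text \<open>The inherited monoid structure is the group \<open>\<cdot>\<close> (called additive, though written
  with \<open>\<otimes>\<close>); \<open>circ\<close> is the second operation. The brace identity at \<open>b = c = \<one>\<close> gives
  \<open>a \<circ> \<one> = a\<close>, so the two groups of a skew brace have the same identity and
  one field \<open>one\<close> serves both.\<close>

record 'a skew_brace = "'a monoid" +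
  circ :: "'a \<Rightarrow> 'a \<Rightarrow> 'a"

definition circ_group :: "'a skew_brace \<Rightarrow> 'a monoid" where
  "circ_group B = \<lparr>carrier = carrier B, monoid.mult = circ B, one = \<one>\<^bsub>B\<^esub>\<rparr>"

definition skew_brace :: "'a skew_brace \<Rightarrow> bool" where
  "skew_brace B \<longleftrightarrow> group B \<and> group (circ_group B) \<and>
     (\<forall>a\<in>carrier B. \<forall>b\<in>carrier B. \<forall>c\<in>carrier B.
        circ B a (b \<otimes>\<^bsub>B\<^esub> c) = circ B a b \<otimes>\<^bsub>B\<^esub> inv\<^bsub>B\<^esub> a \<otimes>\<^bsub>B\<^esub> circ B a c)"

definition lam :: "'a skew_brace \<Rightarrow> 'a \<Rightarrow> 'a \<Rightarrow> 'a" where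
  "lam B a = (\<lambda>b\<in>carrier B. inv\<^bsub>B\<^esub> a \<otimes>\<^bsub>B\<^esub> circ B a b)"

definition brace_iso :: "'a skew_brace \<Rightarrow> 'b skew_brace \<Rightarrow> ('a \<Rightarrow> 'b) set" where
  "brace_iso B C = iso B C \<inter> iso (circ_group B) (circ_group C)"

text \<open>Meant for ideals \<open>I\<close>, whose cosets for the two operations coincide.\<close>

definition brace_quotient :: "'a skew_brace \<Rightarrow> 'a set \<Rightarrow> 'a set skew_brace" where
  "brace_quotient B I = \<lparr>carrier = rcosets\<^bsub>B\<^esub> I, monoid.mult = set_mult B, one = I,
     circ = set_mult (circ_group B)\<rparr>"

definition regular_of_brace :: "'a skew_brace \<Rightarrow> ('a \<times> ('a \<Rightarrow> 'a)) set" where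
  "regular_of_brace B = {(a, lam B a) | a. a \<in> carrier B}"

definition brace_of_regular ::
  "('a, 'm) monoid_scheme \<Rightarrow> ('a \<times> ('a \<Rightarrow> 'a)) set \<Rightarrow> 'a skew_brace" where
  "brace_of_regular A G = \<lparr>carrier = carrier A, monoid.mult = monoid.mult A, one = \<one>\<^bsub>A\<^esub>,
     circ = (\<lambda>a b. a \<otimes>\<^bsub>A\<^esub> (THE f. (a, f) \<in> G) b)\<rparr>"

text \<open>The group \<open>F\<close>, with the operation of the holomorph.\<close>

definition regular_group :: "'a skew_brace \<Rightarrow> ('a \<times> ('a \<Rightarrow> 'a)) monoid" where
  "regular_group B = (holomorph B)\<lparr>carrier := regular_of_brace B\<rparr>"

section \<open>Semidirect products with a cyclic group of prime order\<close>

abbreviation Zp :: "nat \<Rightarrow> int ring" where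
  "Zp p \<equiv> residue_ring (int p)"

definition Zp_semidirect ::
  "nat \<Rightarrow> ('h \<Rightarrow> int) \<Rightarrow> ('h, 'm) monoid_scheme \<Rightarrow> (int \<times> 'h) monoid" where
  "Zp_semidirect p \<rho> H = \<lparr>carrier = carrier (Zp p) \<times> carrier H,
     monoid.mult = (\<lambda>(m, a) (m', b). (m \<oplus>\<^bsub>Zp p\<^esub> \<rho> a \<otimes>\<^bsub>Zp p\<^esub> m', a \<otimes>\<^bsub>H\<^esub> b)),
     one = (\<zero>\<^bsub>Zp p\<^esub>, \<one>\<^bsub>H\<^esub>)\<rparr>"

definition Zp_part :: "nat \<Rightarrow> ('h, 'm) monoid_scheme \<Rightarrow> (int \<times> 'h) set" where
  "Zp_part p H = carrier (Zp p) \<times> {\<one>\<^bsub>H\<^esub>}"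

text \<open>The upper triangular matrix with rows \<open>(\<alpha>, \<gamma>)\<close> and \<open>(0, f)\<close>, as an extensional
  map so that it can be an element of \<^const>\<open>auto\<close>.\<close>

definition tri_map :: "nat \<Rightarrow> ('h, 'm) monoid_scheme \<Rightarrow> int \<Rightarrow> ('h \<Rightarrow> int) \<Rightarrow> ('h \<Rightarrow> 'h)
    \<Rightarrow> int \<times> 'h \<Rightarrow> int \<times> 'h" where
  "tri_map p H \<alpha> \<gamma> f =
     restrict (\<lambda>(m, a). (\<alpha> \<otimes>\<^bsub>Zp p\<^esub> m \<oplus>\<^bsub>Zp p\<^esub> \<gamma> a, f a)) (carrier (Zp p) \<times> carrier H)"

definition gam :: "nat \<Rightarrow> ('h \<Rightarrow> int) \<Rightarrow> int \<Rightarrow> 'h \<Rightarrow> int" where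
  "gam p \<sigma> i a = i \<ominus>\<^bsub>Zp p\<^esub> \<sigma> a \<otimes>\<^bsub>Zp p\<^esub> i"

definition brace_chars :: "nat \<Rightarrow> 'a skew_brace \<Rightarrow> ('a \<Rightarrow> int) set" where
  "brace_chars p B = hom B (units_of (Zp p)) \<inter> hom (circ_group B) (units_of (Zp p))"

definition G_sub :: "nat \<Rightarrow> 'a skew_brace \<Rightarrow> ('a \<Rightarrow> int) \<Rightarrow> ('a \<times> ('a \<Rightarrow> 'a) \<Rightarrow> int)
    \<Rightarrow> ((int \<times> 'a) \<times> (int \<times> 'a \<Rightarrow> int \<times> 'a)) set" where
  "G_sub p B \<sigma> \<tau> =
     {((m, a), tri_map p B (inv\<^bsub>Zp p\<^esub> (\<sigma> a) \<otimes>\<^bsub>Zp p\<^esub> \<tau> (a, lam B a)) (\<lambda>_. \<zero>\<^bsub>Zp p\<^esub>) (lam B a))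
       | m a. m \<in> carrier (Zp p) \<and> a \<in> carrier B}"

definition G'_sub :: "nat \<Rightarrow> 'a skew_brace \<Rightarrow> ('a \<Rightarrow> int) \<Rightarrow> ('a \<times> ('a \<Rightarrow> 'a) \<Rightarrow> int)
    \<Rightarrow> ((int \<times> 'a) \<times> (int \<times> 'a \<Rightarrow> int \<times> 'a)) set" where
  "G'_sub p B \<sigma> \<tau> =
     {((m, a), tri_map p B (\<tau> (a, lam B a))
                 (gam p \<sigma> (\<ominus>\<^bsub>Zp p\<^esub> (\<sigma> (inv\<^bsub>B\<^esub> a) \<otimes>\<^bsub>Zp p\<^esub> m))) (lam B a))
       | m a. m \<in> carrier (Zp p) \<and> a \<in> carrier B}"

text \<open>The brace \<open>B\<^sub>G / Z\<^sub>p\<close>, for \<open>G\<close> regular in the holomorph of \<open>Z\<^sub>p \<rtimes>\<^sub>\<sigma> E\<close>.\<close>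

definition quotient_of_regular :: "nat \<Rightarrow> 'a skew_brace \<Rightarrow> ('a \<Rightarrow> int)
    \<Rightarrow> ((int \<times> 'a) \<times> (int \<times> 'a \<Rightarrow> int \<times> 'a)) set \<Rightarrow> (int \<times> 'a) set skew_brace" where
  "quotient_of_regular p B \<sigma> G =
     brace_quotient (brace_of_regular (Zp_semidirect p \<sigma> B) G) (Zp_part p B)"

text \<open>\<open>G \<cong> Z\<^sub>p \<rtimes>\<^sub>\<tau> F\<close> as groups and \<open>B\<^sub>G / Z\<^sub>p \<cong> B\<close> as skew braces, by isomorphisms \<open>\<Theta>\<close> and
  \<open>\<psi>\<close> compatible with the identifications \<open>(Z\<^sub>p \<rtimes>\<^sub>\<sigma> E) / Z\<^sub>p = E\<close> and
  \<open>(Z\<^sub>p \<rtimes>\<^sub>\<tau> F) / Z\<^sub>p = F\<close>: \<open>\<psi>\<close> preserves the action \<open>\<sigma>\<close> on \<open>Z\<^sub>p\<close>, and \<open>\<Theta>\<close> induces \<open>\<psi>\<close> modulo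
  \<open>Z\<^sub>p\<close>. With unrelated isomorphisms \<open>G\<close> would determine \<open>\<sigma>\<close> and \<open>\<tau>\<close> only up to
  automorphisms of \<open>E\<close> and of \<open>F\<close>, which need not be automorphisms of \<open>B\<close>: let \<open>p = 5\<close>, \<open>B\<close> the
  trivial brace on \<open>E = Z\<^sub>2 \<times> Z\<^sub>2\<close>, and \<open>\<sigma> \<noteq> \<sigma>'\<close> two non-trivial characters of \<open>E\<close>.
  The groups \<open>G\<close> for \<open>(\<sigma>, \<sigma>)\<close> and \<open>(\<sigma>, \<sigma>')\<close> are isomorphic with the same quotient brace, but
  are not conjugate: the former consists of the left translations.\<close>

definition in_class :: "nat \<Rightarrow> 'a skew_brace \<Rightarrow> ('a \<Rightarrow> int) \<Rightarrow> ('a \<times> ('a \<Rightarrow> 'a) \<Rightarrow> int)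
    \<Rightarrow> ((int \<times> 'a) \<times> (int \<times> 'a \<Rightarrow> int \<times> 'a)) set \<Rightarrow> bool" where
  "in_class p B \<sigma> \<tau> G \<longleftrightarrow>
     (\<exists>\<Theta> \<in> iso ((holomorph (Zp_semidirect p \<sigma> B))\<lparr>carrier := G\<rparr>)
               (Zp_semidirect p \<tau> (regular_group B)).
      \<exists>\<psi> \<in> brace_iso (quotient_of_regular p B \<sigma> G) B.
        (\<forall>m\<in>carrier (Zp p). \<forall>a\<in>carrier B.
           \<sigma> (\<psi> (Zp_part p B #>\<^bsub>Zp_semidirect p \<sigma> B\<^esub> (m, a))) = \<sigma> a) \<and>
        (\<forall>x f. (x, f) \<in> G \<longrightarrow>
           (let b = \<psi> (Zp_part p B #>\<^bsub>Zp_semidirect p \<sigma> B\<^esub> x)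
            in snd (\<Theta> (x, f)) = (b, lam B b))))"

section \<open>The function \<open>\<theta>\<close>\<close>

definition theta :: "nat \<Rightarrow> nat" where
  "theta n = (\<Prod>q\<in>prime_factors n. \<Prod>i<multiplicity q n. q ^ multiplicity q n - q ^ i)"

end

theory Submission
  imports Defs
begin

text \<open>
  Regular subgroups of \<open>Hol A\<close> correspond to skew braces with additive group \<open>A\<close>, and conjugacy to
  isomorphism of braces, because the holomorph is the product of \<open>Aut A\<close> and any regular subgroup.
  For \<open>A = Z\<^sub>p \<rtimes> E\<close> the groups \<open>G\<close> and \<open>G'\<close> belong to the two cases \<open>u = 1\<close>, \<open>u = \<sigma>\<close> of
  \<open>(m, a) \<circ> (m', b) = (u b m + u a \<tau> a m', a \<circ> b)\<close>.

  Conversely, let \<open>\<circ>\<close> be any brace operation on \<open>A\<close>. Groups of order \<open>n p\<close> having a normal subgroup of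
  order \<open>p\<close>, no automorphism of \<open>E\<close> has order \<open>p\<close>; hence the normal subgroup of order \<open>p\<close> of
  \<open>(A, \<circ>)\<close> is \<open>Z\<^sub>p\<close>, and \<open>(m, 1) \<circ> (l, b) = (u b m + l, b)\<close> with \<open>u b = 1 + k (1 - \<sigma> b)\<close>.
  Associativity makes \<open>u\<close> multiplicative, which forces \<open>k = 0\<close> or \<open>k = -1\<close>, that is \<open>u = 1\<close> or
  \<open>u = \<sigma>\<close>. What remains is a cocycle with values in \<open>Z\<^sub>p\<close> on a group of order prime to \<open>p\<close>; it is a
  coboundary, and the corresponding automorphism of \<open>A\<close> brings \<open>\<circ>\<close> into the form above.
\<close>

section \<open>Regular subgroups of the holomorph and skew braces\<close>

text \<open>The hypothesis on groups of order \<open>n p\<close> enters twice, for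
  \<open>E \<rtimes> \<langle>\<phi>\<rangle>\<close> and for \<open>(A, \<circ>)\<close>. If
  \<open>x\<close> lies in a subgroup of order \<open>p\<close> of \<open>(A, \<circ>)\<close>, then
  \<open>lam x\<close> has trivial \<open>p\<close>-th power: its part on \<open>E\<close> is
  trivial, and by Fermat its scalar on \<open>Z_p\<close> is 1. The second components of the
  \<open>\<circ>\<close>-powers of \<open>x\<close> are then powers in \<open>E\<close>, which puts
  \<open>x\<close> into \<open>Z_p\<close>.

  The values 0 and -1 of \<open>k\<close> come from a single \<open>c\<close> with
  \<open>\<sigma> c \<noteq> 1\<close>: comparing \<open>u\<close> at the
  \<open>\<circ>\<close>-square of \<open>c\<close> with the square of \<open>u c\<close> leaves
  \<open>k (k + 1) = 0\<close> after division by the square of \<open>1 - \<sigma> c\<close>. For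
  trivial \<open>\<sigma>\<close> there is no such \<open>c\<close>; the parameters concerned are
  then invisible and are set to 0.

  The obstacle in (4) is identification. The quotient is isomorphic to \<open>B\<close> through some
  \<open>\<psi>\<close>, so the characters obtained live on \<open>E\<close> with the induced
  multiplication and must be carried along \<open>\<psi>\<close>. The second one is recognised
  intrinsically, as conjugation on \<open>Z_p\<close> in the multiplicative group; this is how an
  isomorphism with \<open>Z_p \<rtimes> F\<close> detects \<open>\<tau>\<close>.\<close>

lemma auto_closed: "f \<in> auto G \<Longrightarrow> x \<in> carrier G \<Longrightarrow> f x \<in> carrier G"
  by (auto simp: auto_def hom_def)

lemma auto_mult:
  "f \<in> auto G \<Longrightarrow> x \<in> carrier G \<Longrightarrow> y \<in> carrier G \<Longrightarrow> f (x \<otimes>\<^bsub>G\<^esub> y) = f x \<otimes>\<^bsub>G\<^esub> f y"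
  by (auto simp: auto_def hom_def)

lemma auto_bij: "f \<in> auto G \<Longrightarrow> bij_betw f (carrier G) (carrier G)"
  by (auto simp: auto_def Bij_def)

lemma auto_extensional: "f \<in> auto G \<Longrightarrow> f \<in> extensional (carrier G)"
  by (auto simp: auto_def Bij_def)

lemma auto_iso: "f \<in> auto G \<Longrightarrow> f \<in> iso G G"
  by (auto simp: auto_def Bij_def iso_def)

text \<open>\<open>auto\<close> consists of extensional maps, so an automorphism given by an
  arbitrary function enters the holomorph only after restriction.\<close>

lemma iso_restrict_auto:
  assumes "group G" "f \<in> iso G G"
  shows "restrict f (carrier G) \<in> auto G"
proof -
  interpret group G by fact
  show ?thesis
    using assms(2) by (auto simp: auto_def Bij_def iso_def hom_def bij_betw_def inj_on_def Pi_def)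
qed

lemma carrier_AutoGroup [simp]: "carrier (AutoGroup G) = auto G"
  by (simp add: AutoGroup_def)

lemma one_AutoGroup [simp]: "\<one>\<^bsub>AutoGroup G\<^esub> = (\<lambda>x\<in>carrier G. x)"
  by (simp add: AutoGroup_def BijGroup_def)

lemma mult_AutoGroup:
  "f \<in> auto G \<Longrightarrow> g \<in> auto G \<Longrightarrow> f \<otimes>\<^bsub>AutoGroup G\<^esub> g = compose (carrier G) f g"
  by (simp add: AutoGroup_def BijGroup_def auto_def)

lemma mult_AutoGroup_apply:
  "f \<in> auto G \<Longrightarrow> g \<in> auto G \<Longrightarrow> x \<in> carrier G \<Longrightarrow> (f \<otimes>\<^bsub>AutoGroup G\<^esub> g) x = f (g x)"
  by (simp add: mult_AutoGroup compose_eq)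

lemma carrier_holomorph [simp]: "carrier (holomorph G) = carrier G \<times> auto G"
  by (simp add: holomorph_def)

lemma one_holomorph [simp]: "\<one>\<^bsub>holomorph G\<^esub> = (\<one>\<^bsub>G\<^esub>, \<lambda>x\<in>carrier G. x)"
  by (simp add: holomorph_def)

lemma mult_holomorph [simp]:
  "(a, f) \<otimes>\<^bsub>holomorph G\<^esub> (b, g) = (a \<otimes>\<^bsub>G\<^esub> f b, f \<otimes>\<^bsub>AutoGroup G\<^esub> g)"
  by (simp add: holomorph_def)

lemma auto_eqI:
  assumes "f \<in> auto G" "g \<in> auto G" "\<And>x. x \<in> carrier G \<Longrightarrow> f x = g x"
  shows "f = g"
  using assms auto_extensional by (metis extensionalityI)

context group
begin

lemma auto_one: "f \<in> auto G \<Longrightarrow> f \<one> = \<one>"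
  using auto_iso[of f G] by (metis group_hom.hom_one group_hom.intro group_hom_axioms.intro
      group_axioms iso_imp_homomorphism)

lemma auto_inv: "f \<in> auto G \<Longrightarrow> x \<in> carrier G \<Longrightarrow> f (inv x) = inv (f x)"
  using auto_iso[of f G] by (metis group_hom.hom_inv group_hom.intro group_hom_axioms.intro
      group_axioms iso_imp_homomorphism)

lemma auto_inv_apply:
  assumes "f \<in> auto G" "x \<in> carrier G"
  shows "(inv\<^bsub>AutoGroup G\<^esub> f) (f x) = x" "f ((inv\<^bsub>AutoGroup G\<^esub> f) x) = x"
    "inv\<^bsub>AutoGroup G\<^esub> f \<in> auto G"
proof -
  interpret Aut: group "AutoGroup G" by (rule AutoGroup)
  show 1: "inv\<^bsub>AutoGroup G\<^esub> f \<in> auto G"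
    using Aut.inv_closed assms by simp
  have "(inv\<^bsub>AutoGroup G\<^esub> f \<otimes>\<^bsub>AutoGroup G\<^esub> f) x = x" "(f \<otimes>\<^bsub>AutoGroup G\<^esub> inv\<^bsub>AutoGroup G\<^esub> f) x = x"
    using Aut.l_inv[of f] Aut.r_inv[of f] assms by simp_all
  then show "(inv\<^bsub>AutoGroup G\<^esub> f) (f x) = x" "f ((inv\<^bsub>AutoGroup G\<^esub> f) x) = x"
    using 1 assms by (simp_all only: mult_AutoGroup_apply)
qed

lemma group_holomorph: "group (holomorph G)"
proof (rule groupI)
  interpret Aut: group "AutoGroup G" by (rule AutoGroup)
  fix x assume x: "x \<in> carrier (holomorph G)"
  show "\<one>\<^bsub>holomorph G\<^esub> \<otimes>\<^bsub>holomorph G\<^esub> x = x"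
    using x Aut.l_one by (auto simp: auto_closed id_in_auto)
  show "\<exists>y\<in>carrier (holomorph G). y \<otimes>\<^bsub>holomorph G\<^esub> x = \<one>\<^bsub>holomorph G\<^esub>"
  proof -
    obtain a f where af: "x = (a, f)" "a \<in> carrier G" "f \<in> auto G" using x by auto
    let ?g = "inv\<^bsub>AutoGroup G\<^esub> f"
    have g: "?g \<in> auto G" using auto_inv_apply[OF af(3) af(2)] by simp
    show ?thesis
      using af g Aut.l_inv[of f] auto_mult[OF g, of "inv a" a, symmetric] 
      by (intro bexI[of _ "(?g (inv a), ?g)"]) (auto simp: auto_closed auto_one)
  qed
  fix y assume y: "y \<in> carrier (holomorph G)"
  show "x \<otimes>\<^bsub>holomorph G\<^esub> y \<in> carrier (holomorph G)"
    using x y Aut.m_closed by (auto simp: auto_closed)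
  fix z assume z: "z \<in> carrier (holomorph G)"
  show "x \<otimes>\<^bsub>holomorph G\<^esub> y \<otimes>\<^bsub>holomorph G\<^esub> z = x \<otimes>\<^bsub>holomorph G\<^esub> (y \<otimes>\<^bsub>holomorph G\<^esub> z)"
    using x y z Aut.m_assoc by (auto simp: auto_closed mult_AutoGroup_apply auto_mult m_assoc)
qed (auto simp: id_in_auto)

lemma hol_act_closed:
  "g \<in> carrier (holomorph G) \<Longrightarrow> x \<in> carrier G \<Longrightarrow> hol_act G g x \<in> carrier G"
  by (auto simp: hol_act_def auto_closed)

lemma hol_act_mult:
  "g \<in> carrier (holomorph G) \<Longrightarrow> h \<in> carrier (holomorph G) \<Longrightarrow> x \<in> carrier G \<Longrightarrow>
    hol_act G (g \<otimes>\<^bsub>holomorph G\<^esub> h) x = hol_act G g (hol_act G h x)"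
  by (auto simp: hol_act_def auto_closed mult_AutoGroup_apply auto_mult m_assoc)

lemma hol_act_one: "x \<in> carrier G \<Longrightarrow> hol_act G \<one>\<^bsub>holomorph G\<^esub> x = x"
  by (simp add: hol_act_def)

lemma hol_act_inv:
  assumes "g \<in> carrier (holomorph G)" "x \<in> carrier G"
  shows "hol_act G (inv\<^bsub>holomorph G\<^esub> g) (hol_act G g x) = x"
    "hol_act G g (hol_act G (inv\<^bsub>holomorph G\<^esub> g) x) = x"
proof -
  interpret Hol: group "holomorph G" by (rule group_holomorph)
  show "hol_act G (inv\<^bsub>holomorph G\<^esub> g) (hol_act G g x) = x"
    "hol_act G g (hol_act G (inv\<^bsub>holomorph G\<^esub> g) x) = x"
    using assms by (simp_all flip: hol_act_mult del: one_holomorph carrier_holomorph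
        add: hol_act_one Hol.inv_closed)
qed

text \<open>Automorphisms fix the identity, so the orbit map at \<open>\<one>\<close> is the first
  projection; a regular subgroup therefore has exactly one element over each first
  component.\<close>

lemma hol_act_on_one: "(a, f) \<in> carrier (holomorph G) \<Longrightarrow> hol_act G (a, f) \<one> = a"
  by (simp add: hol_act_def auto_one)

end

section \<open>From skew braces to regular subgroups\<close>

lemma skew_brace_group: "skew_brace C \<Longrightarrow> group C"
  and skew_brace_circ_group: "skew_brace C \<Longrightarrow> group (circ_group C)"
  by (auto simp: skew_brace_def)

lemma circ_group_simps [simp]: "carrier (circ_group C) = carrier C" "monoid.mult (circ_group C) = circ C"
  "\<one>\<^bsub>circ_group C\<^esub> = \<one>\<^bsub>C\<^esub>"
  by (simp_all add: circ_group_def)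

context
  fixes C :: "'a skew_brace"
  assumes C: "skew_brace C"
begin

interpretation group C by (rule skew_brace_group[OF C])
interpretation circ: group "circ_group C" by (rule skew_brace_circ_group[OF C])

lemma circ_closed: "a \<in> carrier C \<Longrightarrow> b \<in> carrier C \<Longrightarrow> circ C a b \<in> carrier C"
  using circ.m_closed by simp

lemma circ_assoc: "a \<in> carrier C \<Longrightarrow> b \<in> carrier C \<Longrightarrow> c \<in> carrier C \<Longrightarrow>
    circ C (circ C a b) c = circ C a (circ C b c)"
  using circ.m_assoc by simp

lemma circ_one: "a \<in> carrier C \<Longrightarrow> circ C a \<one>\<^bsub>C\<^esub> = a" "a \<in> carrier C \<Longrightarrow> circ C \<one>\<^bsub>C\<^esub> a = a"
  using circ.r_one circ.l_one by simp_all

lemma circ_cancel: "a \<in> carrier C \<Longrightarrow> b \<in> carrier C \<Longrightarrow> c \<in> carrier C \<Longrightarrow>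
    circ C a b = circ C a c \<longleftrightarrow> b = c"
  using circ.Units_l_cancel[of a b c] circ.Units_eq by simp

lemma circ_mult: "a \<in> carrier C \<Longrightarrow> b \<in> carrier C \<Longrightarrow> c \<in> carrier C \<Longrightarrow>
    circ C a (b \<otimes>\<^bsub>C\<^esub> c) = circ C a b \<otimes>\<^bsub>C\<^esub> inv\<^bsub>C\<^esub> a \<otimes>\<^bsub>C\<^esub> circ C a c"
  using C by (simp add: skew_brace_def)

lemma circ_eq_lam: "a \<in> carrier C \<Longrightarrow> b \<in> carrier C \<Longrightarrow> circ C a b = a \<otimes>\<^bsub>C\<^esub> lam C a b"
  by (simp add: lam_def circ_closed flip: m_assoc)

lemma lam_auto:
  assumes a: "a \<in> carrier C"
  shows "lam C a \<in> auto C"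
proof -
  have "lam C a \<in> hom C C"
    using a by (auto simp: hom_def lam_def circ_closed circ_mult m_assoc)
  moreover have "inj_on (lam C a) (carrier C)"
    using a by (auto simp: inj_on_def lam_def circ_closed circ_cancel)
  \<comment> \<open>The preimage of \<open>y\<close> solves \<open>a \<circ> x = a y\<close>: it is
    the \<open>\<circ>\<close>-inverse of \<open>a\<close>, multiplied by \<open>a y\<close> in the
    multiplicative group.\<close>
  moreover have "y \<in> lam C a ` carrier C" if y: "y \<in> carrier C" for y
  proof (rule image_eqI)
    show "inv\<^bsub>circ_group C\<^esub> a \<otimes>\<^bsub>circ_group C\<^esub> (a \<otimes>\<^bsub>C\<^esub> y) \<in> carrier C"
      using circ.m_closed[of "inv\<^bsub>circ_group C\<^esub> a" "a \<otimes>\<^bsub>C\<^esub> y"] circ.inv_closed[of a] a y by simp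
    then show "y = lam C a (inv\<^bsub>circ_group C\<^esub> a \<otimes>\<^bsub>circ_group C\<^esub> (a \<otimes>\<^bsub>C\<^esub> y))"
      using circ.m_assoc[of a "inv\<^bsub>circ_group C\<^esub> a" "a \<otimes>\<^bsub>C\<^esub> y"] circ.r_inv[of a] circ.inv_closed[of a]
        a y
      by (simp add: lam_def circ_one flip: m_assoc)
  qed
  moreover have "lam C a \<in> extensional (carrier C)" by (simp add: lam_def)
  ultimately show ?thesis
    by (auto simp: auto_def Bij_def bij_betw_def hom_def)
qed

text \<open>Expand \<open>a \<circ> (b \<circ> x)\<close> in two ways, with \<open>\<circ>\<close>
  turned into \<open>lam\<close>, and cancel \<open>a \<circ> b\<close> on the left. This
  homomorphism property is what closes \<open>regular_of_brace\<close> under the product of the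
  holomorph.\<close>

lemma lam_circ:
  assumes "a \<in> carrier C" "b \<in> carrier C"
  shows "lam C (circ C a b) = lam C a \<otimes>\<^bsub>AutoGroup C\<^esub> lam C b"
proof (rule auto_eqI)
  interpret Aut: group "AutoGroup C" by (rule AutoGroup)
  show "lam C a \<otimes>\<^bsub>AutoGroup C\<^esub> lam C b \<in> auto C"
    using Aut.m_closed lam_auto assms by simp
  fix x assume x: "x \<in> carrier C"
  have "circ C a b \<otimes>\<^bsub>C\<^esub> lam C (circ C a b) x = circ C a (circ C b x)"
    using assms x by (simp add: circ_closed circ_assoc flip: circ_eq_lam)
  also have "\<dots> = circ C a (b \<otimes>\<^bsub>C\<^esub> lam C b x)"
    using assms x by (simp add: circ_eq_lam)
  also have "\<dots> = circ C a b \<otimes>\<^bsub>C\<^esub> lam C a (lam C b x)"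
    using assms x lam_auto by (simp add: circ_eq_lam auto_closed auto_mult m_assoc)
  finally show "lam C (circ C a b) x = (lam C a \<otimes>\<^bsub>AutoGroup C\<^esub> lam C b) x"
    using assms x by (simp add: mult_AutoGroup_apply lam_auto auto_closed circ_closed)
qed (simp add: lam_auto circ_closed assms)

lemma lam_one: "lam C \<one>\<^bsub>C\<^esub> = (\<lambda>x\<in>carrier C. x)"
  by (rule auto_eqI[of _ C]) (auto simp: lam_auto id_in_auto, simp add: lam_def circ_one)

lemma regular_of_brace_subset: "regular_of_brace C \<subseteq> carrier (holomorph C)"
  by (auto simp: regular_of_brace_def lam_auto)

lemma mult_regular_of_brace:
  "a \<in> carrier C \<Longrightarrow> b \<in> carrier C \<Longrightarrow>
    (a, lam C a) \<otimes>\<^bsub>holomorph C\<^esub> (b, lam C b) = (circ C a b, lam C (circ C a b))"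
  by (simp add: circ_eq_lam flip: lam_circ)

lemma subgroup_regular_of_brace: "subgroup (regular_of_brace C) (holomorph C)"
proof -
  interpret Hol: group "holomorph C" by (rule group_holomorph)
  show ?thesis
  proof (rule Hol.subgroupI)
    show "regular_of_brace C \<subseteq> carrier (holomorph C)" by (rule regular_of_brace_subset)
    show "regular_of_brace C \<noteq> {}" by (auto simp: regular_of_brace_def)
  next
    fix x assume "x \<in> regular_of_brace C"
    then obtain a where a: "a \<in> carrier C" "x = (a, lam C a)" by (auto simp: regular_of_brace_def)
    let ?b = "inv\<^bsub>circ_group C\<^esub> a"
    have b: "?b \<in> carrier C" "circ C ?b a = \<one>\<^bsub>C\<^esub>"
      using circ.inv_closed[of a] circ.l_inv[of a] a by simp_all
    have "inv\<^bsub>holomorph C\<^esub> x = (?b, lam C ?b)"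
    proof (rule Hol.inv_equality)
      show "(?b, lam C ?b) \<otimes>\<^bsub>holomorph C\<^esub> x = \<one>\<^bsub>holomorph C\<^esub>"
        unfolding a mult_regular_of_brace[OF b(1) a(1)] b(2) by (simp add: lam_one)
    qed (use a b in \<open>auto simp: lam_auto\<close>)
    then show "inv\<^bsub>holomorph C\<^esub> x \<in> regular_of_brace C"
      using b by (auto simp: regular_of_brace_def)
  next
    fix x y assume "x \<in> regular_of_brace C" "y \<in> regular_of_brace C"
    then obtain a b where a: "a \<in> carrier C" "x = (a, lam C a)" and b: "b \<in> carrier C" "y = (b, lam C b)"
      by (auto simp: regular_of_brace_def)
    show "x \<otimes>\<^bsub>holomorph C\<^esub> y \<in> regular_of_brace C"
      unfolding a b mult_regular_of_brace[OF a(1) b(1)]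
      using a b by (auto simp: regular_of_brace_def circ_closed)
  qed
qed

lemma regular_of_brace_regular: "regular_subgroup C (regular_of_brace C)"
  unfolding regular_subgroup_def
proof (intro conjI ballI subgroup_regular_of_brace)
  fix x y assume x: "x \<in> carrier C" and y: "y \<in> carrier C"
  \<comment> \<open>The element over \<open>a\<close> acts as left multiplication by
    \<open>a\<close> in the multiplicative group, whose regular representation is simply
    transitive.\<close>
  have act: "hol_act C (a, lam C a) x = circ C a x" if "a \<in> carrier C" for a
    using that x by (simp add: hol_act_def circ_eq_lam)
  let ?a = "y \<otimes>\<^bsub>circ_group C\<^esub> inv\<^bsub>circ_group C\<^esub> x"
  have a: "?a \<in> carrier C" "circ C ?a x = y"
    using x y circ.inv_closed[of x] circ.m_closed[of y "inv\<^bsub>circ_group C\<^esub> x"] circ.l_inv[of x]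
      circ.m_assoc[of y "inv\<^bsub>circ_group C\<^esub> x" x] by (simp_all add: circ_one)
  show "\<exists>!g. g \<in> regular_of_brace C \<and> hol_act C g x = y"
  proof (rule ex1I[of _ "(?a, lam C ?a)"])
    show "(?a, lam C ?a) \<in> regular_of_brace C \<and> hol_act C (?a, lam C ?a) x = y"
      unfolding act[OF a(1)] a(2) using a(1) by (auto simp: regular_of_brace_def)
  next
    fix g assume g: "g \<in> regular_of_brace C \<and> hol_act C g x = y"
    then obtain b where b: "b \<in> carrier C" "g = (b, lam C b)" by (auto simp: regular_of_brace_def)
    then have "circ C b x = circ C ?a x" using g act a by auto
    then have "b = ?a" using circ.right_cancel[of x b ?a] b a x by simp
    then show "g = (?a, lam C ?a)" using b by simp
  qed
qed

text \<open>The product of the elements over \<open>a\<close> and \<open>b\<close> lies over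
  \<open>a \<circ> b\<close>. Questions about a regular subgroup as an abstract group thus become
  questions about the multiplicative group.\<close>

lemma fst_iso_circ_group:
  "fst \<in> iso ((holomorph C)\<lparr>carrier := regular_of_brace C\<rparr>) (circ_group C)"
proof -
  have "bij_betw fst (regular_of_brace C) (carrier C)"
    by (auto simp: bij_betw_def inj_on_def regular_of_brace_def image_iff)
  moreover have "fst (x \<otimes>\<^bsub>holomorph C\<^esub> y) = circ C (fst x) (fst y)"
    if xy: "x \<in> regular_of_brace C" "y \<in> regular_of_brace C" for x y
  proof -
    obtain a b where a: "a \<in> carrier C" "x = (a, lam C a)" and b: "b \<in> carrier C" "y = (b, lam C b)"
      using xy by (auto simp: regular_of_brace_def)
    show ?thesis unfolding a b mult_regular_of_brace[OF a(1) b(1)] by simp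
  qed
  ultimately show ?thesis
    by (auto simp: iso_def hom_def bij_betw_def)
qed

end

text \<open>\<open>C\<close> and \<open>A\<close> may have different record types, so that equality is not available.\<close>

definition additive_group_is :: "'a skew_brace \<Rightarrow> ('a, 'm) monoid_scheme \<Rightarrow> bool" where
  "additive_group_is C A \<longleftrightarrow>
     carrier C = carrier A \<and> monoid.mult C = monoid.mult A \<and> \<one>\<^bsub>C\<^esub> = \<one>\<^bsub>A\<^esub>"

context
  fixes C :: "'a skew_brace" and A :: "('a, 'm) monoid_scheme"
  assumes CA: "additive_group_is C A"
begin

lemma auto_additive_group: "auto C = auto A"
  using CA by (simp add: additive_group_is_def auto_def hom_def)

lemma AutoGroup_additive_group: "AutoGroup C = AutoGroup A"
  using CA auto_additive_group by (simp add: additive_group_is_def AutoGroup_def)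

lemma holomorph_additive_group: "holomorph C = holomorph A"
  using CA auto_additive_group AutoGroup_additive_group
  by (simp add: additive_group_is_def holomorph_def)

lemma regular_subgroup_additive_group: "regular_subgroup C = regular_subgroup A"
  using CA holomorph_additive_group
  by (simp add: fun_eq_iff additive_group_is_def regular_subgroup_def hol_act_def)

lemma inv_additive_group: "inv\<^bsub>C\<^esub> x = inv\<^bsub>A\<^esub> x"
  using CA by (simp add: additive_group_is_def m_inv_def)

lemma group_additive_group: "group C \<longleftrightarrow> group A"
  using CA unfolding additive_group_is_def group_def group_axioms_def monoid_def Units_def
  by (elim conjE) (simp only:)

text \<open>Half of the correspondence. It is confined to the carrier: outside it no element of the
  subgroup lies over \<open>a\<close>, and the definite description is unspecified.\<close>

lemma circ_brace_of_regular_of_brace: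
  assumes C: "skew_brace C" and ab: "a \<in> carrier A" "b \<in> carrier A"
  shows "circ (brace_of_regular A (regular_of_brace C)) a b = circ C a b"
proof -
  have "(THE f. (a, f) \<in> regular_of_brace C) = lam C a"
    using CA ab by (auto simp: regular_of_brace_def additive_group_is_def)
  then show ?thesis
    using CA ab circ_eq_lam[OF C, of a b] by (simp add: brace_of_regular_def additive_group_is_def)
qed

end

lemma additive_brace_of_regular: "additive_group_is (brace_of_regular A R) A"
  by (simp add: additive_group_is_def brace_of_regular_def)

section \<open>From regular subgroups to skew braces\<close>

context
  fixes A :: "('a, 'm) monoid_scheme" and R
  assumes A: "group A" and R: "regular_subgroup A R"
begin

interpretation group A by (rule A)
interpretation Hol: group "holomorph A" by (rule group_holomorph)

lemma regular_subset: "R \<subseteq> carrier (holomorph A)"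
  using R subgroup.subset[of R "holomorph A"] by (simp add: regular_subgroup_def)

lemma regular_ex1:
  assumes "a \<in> carrier A"
  shows "\<exists>!f. (a, f) \<in> R"
proof -
  have "\<exists>!g. g \<in> R \<and> hol_act A g \<one>\<^bsub>A\<^esub> = a"
    using R assms by (simp add: regular_subgroup_def)
  then obtain g where g: "g \<in> R" "hol_act A g \<one>\<^bsub>A\<^esub> = a"
    and uniq: "\<And>h. h \<in> R \<Longrightarrow> hol_act A h \<one>\<^bsub>A\<^esub> = a \<Longrightarrow> h = g" by blast
  have act: "hol_act A g \<one>\<^bsub>A\<^esub> = fst g" if "g \<in> R" for g
    using hol_act_on_one[of "fst g" "snd g"] regular_subset that by auto
  show ?thesis
  proof (rule ex1I[of _ "snd g"])
    show "(a, snd g) \<in> R" using g act[of g] by auto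
    show "f = snd g" if "(a, f) \<in> R" for f using uniq[of "(a, f)"] act[of "(a, f)"] that by auto
  qed
qed

text \<open>The other half, with \<open>f a\<close> the automorphism over \<open>a\<close>. The
  brace identity needs only that \<open>f a\<close> is an automorphism; associativity is the closure
  of \<open>R\<close> under products, and inverses come from inverses in \<open>R\<close>.\<close>

lemma brace_of_regular:
  "skew_brace (brace_of_regular A R) \<and> regular_of_brace (brace_of_regular A R) = R"
proof -
  let ?C = "brace_of_regular A R"
  define f where "f = (\<lambda>a. THE f. (a, f) \<in> R)"
  have f: "(a, f a) \<in> R" if "a \<in> carrier A" for a
    unfolding f_def using regular_ex1[OF that] by (rule theI')
  have f_eq: "g = f a" if "(a, g) \<in> R" for a g
    using regular_ex1[of a] f[of a] that regular_subset by auto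
  have f_auto: "f a \<in> auto A" if "a \<in> carrier A" for a
    using f[OF that] regular_subset by auto
  have circ: "circ ?C a b = a \<otimes>\<^bsub>A\<^esub> f a b" for a b
    by (simp add: brace_of_regular_def f_def)
  have [simp]: "carrier ?C = carrier A" "monoid.mult ?C = monoid.mult A" "\<one>\<^bsub>?C\<^esub> = \<one>\<^bsub>A\<^esub>"
    by (simp_all add: brace_of_regular_def)
  have [simp]: "inv\<^bsub>?C\<^esub> x = inv\<^bsub>A\<^esub> x" for x
    by (rule inv_additive_group[OF additive_brace_of_regular])
  \<comment> \<open>The product of the elements over \<open>a\<close> and \<open>b\<close> lies in
    \<open>R\<close>, over \<open>a\<close> times \<open>f a b\<close>; uniqueness of the element
    there compares the second components.\<close>
  have f_circ: "f (a \<otimes>\<^bsub>A\<^esub> f a b) = f a \<otimes>\<^bsub>AutoGroup A\<^esub> f b" if "a \<in> carrier A" "b \<in> carrier A" for a b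
  proof -
    have "(a, f a) \<otimes>\<^bsub>holomorph A\<^esub> (b, f b) \<in> R"
      using R f that subgroup.m_closed[of R "holomorph A" "(a, f a)" "(b, f b)"]
      by (simp add: regular_subgroup_def)
    then show ?thesis using f_eq by simp
  qed
  have group_circ: "group (circ_group ?C)"
  proof (rule groupI, simp_all add: circ)
    fix x y assume x: "x \<in> carrier A" and y: "y \<in> carrier A"
    show "x \<otimes>\<^bsub>A\<^esub> f x y \<in> carrier A"
      using x y by (simp add: f_auto auto_closed)
    fix z assume z: "z \<in> carrier A"
    show "x \<otimes>\<^bsub>A\<^esub> f x y \<otimes>\<^bsub>A\<^esub> f (x \<otimes>\<^bsub>A\<^esub> f x y) z = x \<otimes>\<^bsub>A\<^esub> f x (y \<otimes>\<^bsub>A\<^esub> f y z)"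
      unfolding f_circ[OF x y]
      using x y z by (simp add: f_auto mult_AutoGroup_apply auto_closed auto_mult m_assoc)
  next
    fix x assume x: "x \<in> carrier A"
    have "\<one>\<^bsub>holomorph A\<^esub> \<in> R"
      using R subgroup.one_closed[of R "holomorph A"] by (simp add: regular_subgroup_def)
    then have "f \<one>\<^bsub>A\<^esub> = (\<lambda>x\<in>carrier A. x)" using f_eq by simp
    then show "\<one>\<^bsub>A\<^esub> \<otimes>\<^bsub>A\<^esub> f \<one>\<^bsub>A\<^esub> x = x" using x by simp
    have i: "inv\<^bsub>holomorph A\<^esub> (x, f x) \<in> R"
      using R f[OF x] subgroup.m_inv_closed[of R "holomorph A"] by (simp add: regular_subgroup_def)
    obtain y g where yg: "inv\<^bsub>holomorph A\<^esub> (x, f x) = (y, g)" by fastforce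
    have "y \<in> carrier A" "g = f y" using i yg f_eq regular_subset by auto
    moreover have "(y, g) \<otimes>\<^bsub>holomorph A\<^esub> (x, f x) = \<one>\<^bsub>holomorph A\<^esub>"
      using Hol.l_inv[of "(x, f x)"] x f_auto yg by simp
    ultimately show "\<exists>y\<in>carrier A. y \<otimes>\<^bsub>A\<^esub> f y x = \<one>\<^bsub>A\<^esub>" by auto
  qed
  have cancel: "inv\<^bsub>A\<^esub> x \<otimes>\<^bsub>A\<^esub> (x \<otimes>\<^bsub>A\<^esub> y) = y" if "x \<in> carrier A" "y \<in> carrier A" for x y
    using that by (simp flip: m_assoc)
  have "group ?C" using group_additive_group[OF additive_brace_of_regular] A by blast
  then have C: "skew_brace ?C"
    unfolding skew_brace_def using group_circ
    by (simp add: circ f_auto auto_closed auto_mult m_assoc cancel)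
  have "lam ?C a = f a" if a: "a \<in> carrier A" for a
  proof (rule extensionalityI)
    show "lam ?C a \<in> extensional (carrier A)" by (simp add: lam_def)
    show "f a \<in> extensional (carrier A)" using f_auto[OF a] by (rule auto_extensional)
    show "lam ?C a x = f a x" if "x \<in> carrier A" for x
      using a that by (simp add: lam_def circ cancel f_auto auto_closed)
  qed
  then have "regular_of_brace ?C = {(a, f a) |a. a \<in> carrier A}"
    by (auto simp: regular_of_brace_def)
  also have "\<dots> = R"
    using f f_eq regular_subset by auto
  finally show ?thesis using C by simp
qed

end

section \<open>Conjugacy in the holomorph and isomorphism of skew braces\<close>

lemma conjugate_in_iff:
  "conjugate_in H X Y \<longleftrightarrow>
    (\<exists>h\<in>carrier H. Y = (\<lambda>x. h \<otimes>\<^bsub>H\<^esub> x \<otimes>\<^bsub>H\<^esub> inv\<^bsub>H\<^esub> h) ` X)"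
proof -
  have "h <#\<^bsub>H\<^esub> X #>\<^bsub>H\<^esub> k = (\<lambda>x. h \<otimes>\<^bsub>H\<^esub> x \<otimes>\<^bsub>H\<^esub> k) ` X" for h k
    unfolding l_coset_def r_coset_def by blast
  then show ?thesis unfolding conjugate_in_def by simp
qed

lemma brace_isoI:
  assumes "bij_betw f (carrier C) (carrier D)"
    and "\<And>x y. x \<in> carrier C \<Longrightarrow> y \<in> carrier C \<Longrightarrow> f (x \<otimes>\<^bsub>C\<^esub> y) = f x \<otimes>\<^bsub>D\<^esub> f y"
    and "\<And>x y. x \<in> carrier C \<Longrightarrow> y \<in> carrier C \<Longrightarrow> f (circ C x y) = circ D (f x) (f y)"
  shows "f \<in> brace_iso C D"
  using assms by (auto simp: brace_iso_def iso_def hom_def bij_betw_def)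

lemma brace_isoD:
  assumes "f \<in> brace_iso C D"
  shows "bij_betw f (carrier C) (carrier D)"
    "x \<in> carrier C \<Longrightarrow> f x \<in> carrier D"
    "x \<in> carrier C \<Longrightarrow> y \<in> carrier C \<Longrightarrow> f (x \<otimes>\<^bsub>C\<^esub> y) = f x \<otimes>\<^bsub>D\<^esub> f y"
    "x \<in> carrier C \<Longrightarrow> y \<in> carrier C \<Longrightarrow> f (circ C x y) = circ D (f x) (f y)"
  using assms by (auto simp: brace_iso_def iso_def hom_def)

text \<open>Applying \<open>f\<close> to \<open>a \<circ> x\<close>, written as \<open>a\<close>
  times \<open>lam C a x\<close>, gives \<open>f (lam C a x) = lam D (f a) (f x)\<close>:
  \<open>f\<close> conjugates the automorphism over \<open>a\<close> to the one over
  \<open>f a\<close>.\<close>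

lemma conjugate_lam:
  assumes C: "skew_brace C" and D: "skew_brace D" and DC: "additive_group_is D C"
    and f: "f \<in> auto C" "f \<in> brace_iso C D" and a: "a \<in> carrier C"
  shows "(\<one>\<^bsub>C\<^esub>, f) \<otimes>\<^bsub>holomorph C\<^esub> (a, lam C a) \<otimes>\<^bsub>holomorph C\<^esub> inv\<^bsub>holomorph C\<^esub> (\<one>\<^bsub>C\<^esub>, f)
    = (f a, lam D (f a))"
proof -
  interpret group C by (rule skew_brace_group[OF C])
  interpret Hol: group "holomorph C" by (rule group_holomorph)
  interpret Aut: group "AutoGroup C" by (rule AutoGroup)
  note add = DC[unfolded additive_group_is_def]
  have fa: "f a \<in> carrier C" using f a by (simp add: auto_closed)
  have lamD: "lam D (f a) \<in> auto C"
    using lam_auto[OF D, of "f a"] fa add auto_additive_group[OF DC] by simp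
  have lamC: "lam C a \<in> auto C" by (rule lam_auto[OF C a])
  have "f \<otimes>\<^bsub>AutoGroup C\<^esub> lam C a = lam D (f a) \<otimes>\<^bsub>AutoGroup C\<^esub> f"
  proof (rule auto_eqI)
    show "f \<otimes>\<^bsub>AutoGroup C\<^esub> lam C a \<in> auto C" "lam D (f a) \<otimes>\<^bsub>AutoGroup C\<^esub> f \<in> auto C"
      using Aut.m_closed f lamC lamD by simp_all
    fix x assume x: "x \<in> carrier C"
    have "f a \<otimes>\<^bsub>C\<^esub> f (lam C a x) = f (circ C a x)"
      using f a x lamC by (simp add: circ_eq_lam[OF C] auto_mult auto_closed)
    also have "\<dots> = f a \<otimes>\<^bsub>C\<^esub> lam D (f a) (f x)"
      using brace_isoD(4)[OF f(2) a x] circ_eq_lam[OF D, of "f a" "f x"] fa f x add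
      by (simp add: auto_closed)
    finally show "(f \<otimes>\<^bsub>AutoGroup C\<^esub> lam C a) x = (lam D (f a) \<otimes>\<^bsub>AutoGroup C\<^esub> f) x"
      using f(1) fa x lamC lamD by (simp add: mult_AutoGroup_apply auto_closed)
  qed
  then have "(\<one>\<^bsub>C\<^esub>, f) \<otimes>\<^bsub>holomorph C\<^esub> (a, lam C a) = (f a, lam D (f a)) \<otimes>\<^bsub>holomorph C\<^esub> (\<one>\<^bsub>C\<^esub>, f)"
    using fa lamD by (simp add: auto_one)
  then show ?thesis
    using fa lamD lamC f a Hol.m_assoc[of "(f a, lam D (f a))" "(\<one>\<^bsub>C\<^esub>, f)" "inv\<^bsub>holomorph C\<^esub> (\<one>\<^bsub>C\<^esub>, f)"]
      Hol.inv_closed[of "(\<one>\<^bsub>C\<^esub>, f)"] Hol.r_inv[of "(\<one>\<^bsub>C\<^esub>, f)"] Hol.r_one[of "(f a, lam D (f a))"]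
    by (simp del: mult_holomorph one_holomorph)
qed

lemma conjugate_regular_of_brace:
  assumes "skew_brace C" "skew_brace D" "additive_group_is D C" "f \<in> auto C" "f \<in> brace_iso C D"
  shows "(\<lambda>g. (\<one>\<^bsub>C\<^esub>, f) \<otimes>\<^bsub>holomorph C\<^esub> g \<otimes>\<^bsub>holomorph C\<^esub> inv\<^bsub>holomorph C\<^esub> (\<one>\<^bsub>C\<^esub>, f)) ` regular_of_brace C
    = regular_of_brace D"
proof -
  have "f ` carrier C = carrier D" using brace_isoD(1)[OF assms(5)] by (auto simp: bij_betw_def)
  have "regular_of_brace D = (\<lambda>a. (f a, lam D (f a))) ` carrier C"
    unfolding regular_of_brace_def \<open>f ` carrier C = carrier D\<close>[symmetric] by blast
  also have "\<dots> = (\<lambda>g. (\<one>\<^bsub>C\<^esub>, f) \<otimes>\<^bsub>holomorph C\<^esub> g \<otimes>\<^bsub>holomorph C\<^esub> inv\<^bsub>holomorph C\<^esub> (\<one>\<^bsub>C\<^esub>, f)) `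
      (\<lambda>a. (a, lam C a)) ` carrier C"
    unfolding image_image using conjugate_lam[OF assms] by (intro image_cong) simp_all
  also have "(\<lambda>a. (a, lam C a)) ` carrier C = regular_of_brace C"
    unfolding regular_of_brace_def by blast
  finally show ?thesis by simp
qed

lemma brace_iso_imp_conjugate:
  assumes C: "skew_brace C" and D: "skew_brace D" and DC: "additive_group_is D C"
    and f: "f \<in> brace_iso C D"
  shows "conjugate_in (holomorph C) (regular_of_brace C) (regular_of_brace D)"
proof -
  interpret group C by (rule skew_brace_group[OF C])
  interpret circ: group "circ_group C" by (rule skew_brace_circ_group[OF C])
  let ?f = "restrict f (carrier C)"
  have "f \<in> iso C C"
    using f DC by (auto simp: brace_iso_def iso_def hom_def additive_group_is_def)
  then have af: "?f \<in> auto C" by (rule iso_restrict_auto[OF is_group])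
  have "?f \<in> brace_iso C D"
  proof (rule brace_isoI)
    show "bij_betw ?f (carrier C) (carrier D)" using brace_isoD(1)[OF f] by (simp cong: bij_betw_cong)
  qed (use brace_isoD(3,4)[OF f] in \<open>simp_all add: circ_closed[OF C]\<close>)
  then have "regular_of_brace D = (\<lambda>g. (\<one>\<^bsub>C\<^esub>, ?f) \<otimes>\<^bsub>holomorph C\<^esub> g \<otimes>\<^bsub>holomorph C\<^esub>
      inv\<^bsub>holomorph C\<^esub> (\<one>\<^bsub>C\<^esub>, ?f)) ` regular_of_brace C"
    using conjugate_regular_of_brace[OF C D DC af] by simp
  moreover have "(\<one>\<^bsub>C\<^esub>, ?f) \<in> carrier (holomorph C)" using af by simp
  ultimately show ?thesis unfolding conjugate_in_iff by blast
qed

text \<open>\<open>D\<close> is \<open>C\<close> with the multiplication carried along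
  \<open>f\<close>. Since \<open>f\<close> is an automorphism of the additive group, that group
  stays the same, and \<open>D\<close> gives a regular subgroup of the same holomorph.\<close>

lemma skew_brace_transport:
  assumes C: "skew_brace C" and f: "f \<in> auto C"
  obtains D where "skew_brace D" "additive_group_is D C" "f \<in> brace_iso C D"
proof -
  interpret group C by (rule skew_brace_group[OF C])
  interpret circ: group "circ_group C" by (rule skew_brace_circ_group[OF C])
  define g where "g = inv\<^bsub>AutoGroup C\<^esub> f"
  have g: "g \<in> auto C"
    and gf: "\<And>x. x \<in> carrier C \<Longrightarrow> g (f x) = x"
    and fg: "\<And>x. x \<in> carrier C \<Longrightarrow> f (g x) = x"
    unfolding g_def using auto_inv_apply(1,2)[OF f] auto_inv_apply(3)[OF f one_closed] by auto
  define D where "D = C\<lparr>circ := \<lambda>x y. f (circ C (g x) (g y))\<rparr>"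
  have simps [simp]: "carrier D = carrier C" "monoid.mult D = monoid.mult C" "\<one>\<^bsub>D\<^esub> = \<one>\<^bsub>C\<^esub>"
    "circ D x y = f (circ C (g x) (g y))" for x y
    by (simp_all add: D_def)
  have DC: "additive_group_is D C" by (simp add: additive_group_is_def)
  note closed = auto_closed[OF f] auto_closed[OF g] circ_closed[OF C]
  have "group (circ_group D)"
  proof (rule groupI)
    fix x assume x: "x \<in> carrier (circ_group D)"
    show "\<one>\<^bsub>circ_group D\<^esub> \<otimes>\<^bsub>circ_group D\<^esub> x = x"
      using x g by (simp add: auto_one circ_one[OF C] closed fg)
    have i: "inv\<^bsub>circ_group C\<^esub> (g x) \<in> carrier C" "circ C (inv\<^bsub>circ_group C\<^esub> (g x)) (g x) = \<one>\<^bsub>C\<^esub>"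
      using circ.inv_closed[of "g x"] circ.l_inv[of "g x"] x by (simp_all add: closed)
    show "\<exists>y\<in>carrier (circ_group D). y \<otimes>\<^bsub>circ_group D\<^esub> x = \<one>\<^bsub>circ_group D\<^esub>"
      using i f by (intro bexI[of _ "f (inv\<^bsub>circ_group C\<^esub> (g x))"]) (simp_all add: gf auto_one closed)
  qed (simp_all add: closed gf circ_assoc[OF C])
  moreover have "group D" using group_additive_group[OF DC] by simp
  moreover have "inv\<^bsub>D\<^esub> x = inv\<^bsub>C\<^esub> x" for x by (rule inv_additive_group[OF DC])
  ultimately have "skew_brace D"
    using f g unfolding skew_brace_def
    by (auto simp: auto_mult closed circ_mult[OF C] auto_inv fg)
  moreover have "f \<in> brace_iso C D"
    using auto_bij[OF f] f by (intro brace_isoI) (simp_all add: auto_mult gf closed)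
  ultimately show ?thesis using that DC by blast
qed

text \<open>An element of the holomorph is the product of an automorphism and an element of a given
  regular subgroup, so only conjugation by automorphisms matters.\<close>

lemma conjugate_imp_brace_iso:
  assumes C: "skew_brace C" and conj: "conjugate_in (holomorph C) (regular_of_brace C) R"
  obtains D f where "skew_brace D" "additive_group_is D C" "R = regular_of_brace D"
    "f \<in> auto C" "f \<in> brace_iso C D"
proof -
  interpret group C by (rule skew_brace_group[OF C])
  interpret Hol: group "holomorph C" by (rule group_holomorph)
  let ?H = "holomorph C"
  let ?R = "regular_of_brace C"
  obtain h where h: "h \<in> carrier ?H" and R: "R = (\<lambda>x. h \<otimes>\<^bsub>?H\<^esub> x \<otimes>\<^bsub>?H\<^esub> inv\<^bsub>?H\<^esub> h) ` ?R"
    using conj by (auto simp: conjugate_in_iff simp del: carrier_holomorph one_holomorph)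
  \<comment> \<open>\<open>y\<close> is the point that \<open>h\<close> sends to the identity.
    Correcting \<open>h\<close> by the \<open>r\<close> that also sends \<open>y\<close> there gives
    \<open>k = h r^-1\<close>, which fixes the identity, so its first component is trivial.\<close>
  define y where "y = hol_act C (inv\<^bsub>?H\<^esub> h) \<one>\<^bsub>C\<^esub>"
  have y: "y \<in> carrier C" unfolding y_def using h Hol.inv_closed by (intro hol_act_closed) auto
  obtain r where r: "r \<in> ?R" "hol_act C r y = \<one>\<^bsub>C\<^esub>"
    using regular_of_brace_regular[OF C] y unfolding regular_subgroup_def by blast
  have rH: "r \<in> carrier ?H" using r regular_of_brace_subset[OF C] by blast
  define k where "k = h \<otimes>\<^bsub>?H\<^esub> inv\<^bsub>?H\<^esub> r"
  have k: "k \<in> carrier ?H" unfolding k_def using h rH by (simp del: carrier_holomorph one_holomorph)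
  have "hol_act C (inv\<^bsub>?H\<^esub> r) \<one>\<^bsub>C\<^esub> = y"
    using hol_act_inv(1)[OF rH y] r(2) by simp
  then have "hol_act C k \<one>\<^bsub>C\<^esub> = \<one>\<^bsub>C\<^esub>"
    unfolding k_def y_def using hol_act_inv(2)[OF h] hol_act_mult h rH
    by (simp del: carrier_holomorph one_holomorph)
  moreover obtain f where f: "f \<in> auto C" "k = (fst k, f)" using k by (cases k) auto
  ultimately have kf: "k = (\<one>\<^bsub>C\<^esub>, f)" using hol_act_on_one[of "fst k" f] k by auto
  obtain D where D: "skew_brace D" "additive_group_is D C" "f \<in> brace_iso C D"
    by (rule skew_brace_transport[OF C f(1)])
  have hk: "h = k \<otimes>\<^bsub>?H\<^esub> r" unfolding k_def using h rH by (simp add: Hol.m_assoc del: carrier_holomorph one_holomorph)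
  have "R = (\<lambda>x. k \<otimes>\<^bsub>?H\<^esub> x \<otimes>\<^bsub>?H\<^esub> inv\<^bsub>?H\<^esub> k) ` (\<lambda>x. r \<otimes>\<^bsub>?H\<^esub> x \<otimes>\<^bsub>?H\<^esub> inv\<^bsub>?H\<^esub> r) ` ?R"
    unfolding R hk image_image using k rH regular_of_brace_subset[OF C]
    by (intro image_cong) (auto simp: Hol.inv_mult_group Hol.m_assoc subset_iff simp del: carrier_holomorph one_holomorph)
  \<comment> \<open>Conjugation by an element of the subgroup itself changes nothing, so only
    \<open>k\<close> remains.\<close>
  also have "(\<lambda>x. r \<otimes>\<^bsub>?H\<^esub> x \<otimes>\<^bsub>?H\<^esub> inv\<^bsub>?H\<^esub> r) ` ?R = ?R"
  proof (intro subset_antisym subsetI)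
    note sub = subgroup_regular_of_brace[OF C]
    show "x \<in> ?R" if "x \<in> (\<lambda>x. r \<otimes>\<^bsub>?H\<^esub> x \<otimes>\<^bsub>?H\<^esub> inv\<^bsub>?H\<^esub> r) ` ?R" for x
      using that r(1) subgroup.m_closed[OF sub] subgroup.m_inv_closed[OF sub] by blast
    show "x \<in> (\<lambda>x. r \<otimes>\<^bsub>?H\<^esub> x \<otimes>\<^bsub>?H\<^esub> inv\<^bsub>?H\<^esub> r) ` ?R" if x: "x \<in> ?R" for x
    proof (rule image_eqI)
      show "inv\<^bsub>?H\<^esub> r \<otimes>\<^bsub>?H\<^esub> x \<otimes>\<^bsub>?H\<^esub> r \<in> ?R"
        using x r(1) subgroup.m_closed[OF sub] subgroup.m_inv_closed[OF sub] by blast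
      have "x \<in> carrier ?H" using x regular_of_brace_subset[OF C] by blast
      then show "x = r \<otimes>\<^bsub>?H\<^esub> (inv\<^bsub>?H\<^esub> r \<otimes>\<^bsub>?H\<^esub> x \<otimes>\<^bsub>?H\<^esub> r) \<otimes>\<^bsub>?H\<^esub> inv\<^bsub>?H\<^esub> r"
        using rH by (simp add: Hol.m_assoc del: carrier_holomorph one_holomorph) (simp flip: Hol.m_assoc del: carrier_holomorph one_holomorph)
    qed
  qed
  also have "(\<lambda>x. k \<otimes>\<^bsub>?H\<^esub> x \<otimes>\<^bsub>?H\<^esub> inv\<^bsub>?H\<^esub> k) ` ?R = regular_of_brace D"
    unfolding kf by (rule conjugate_regular_of_brace[OF C D(1,2) f(1) D(3)])
  finally show ?thesis using that D f by blast
qed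

section \<open>Residues modulo a prime\<close>

lemma (in group) pow_p_eq_one:
  assumes p: "prime p" and "\<not> p dvd order G" "a \<in> carrier G" "a [^] p = \<one>"
  shows "a = \<one>"
proof -
  have "ord a dvd p" "ord a dvd order G"
    using assms pow_eq_id ord_dvd_group_order by auto
  then have "ord a = 1" using assms by (metis prime_nat_iff)
  then show ?thesis using assms ord_eq_1 by blast
qed

text \<open>Identities in \<open>Zp p\<close> become divisibilities of integer polynomials, which Groebner bases decide
  (HOL-Algebra shadows the unqualified name of the method).\<close>

lemmas mod_unfold = minus_mult_div_eq_mod [symmetric]

context
  fixes p :: nat
  assumes p: "prime p"
begin

lemma p_gt_1: "int p > 1"
  using prime_gt_1_nat[OF p] by simp

interpretation Z: residues_prime p "Zp p"
  using p by unfold_locales simp_all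

lemma Zp_carrier: "carrier (Zp p) = {0..<int p}"
  by (auto simp: Z.res_carrier_eq)

lemma Zp_ops: "\<zero>\<^bsub>Zp p\<^esub> = 0" "\<one>\<^bsub>Zp p\<^esub> = 1" "x \<oplus>\<^bsub>Zp p\<^esub> y = (x + y) mod int p"
  "x \<otimes>\<^bsub>Zp p\<^esub> y = (x * y) mod int p" "\<ominus>\<^bsub>Zp p\<^esub> x = (- x) mod int p"
  "x \<ominus>\<^bsub>Zp p\<^esub> y = (x - y) mod int p"
  by (simp_all add: Z.res_zero_eq Z.res_one_eq Z.res_add_eq Z.res_mult_eq Z.res_neg_eq a_minus_def mod_simps)

lemma Zp_Units: "Units (Zp p) = {0<..<int p}"
  by (auto simp: Z.res_units_eq Z.p_coprime_right_int zdvd_not_zless)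

lemma Zp_inv:
  assumes "0 < x" "x < int p"
  shows "inv\<^bsub>Zp p\<^esub> x \<in> {0<..<int p}" "(x * inv\<^bsub>Zp p\<^esub> x) mod int p = 1"
  using assms Z.Units_inv_Units[of x] Z.Units_r_inv[of x] unfolding Zp_Units by (simp_all add: Zp_ops)

lemma hom_units_iff: "\<rho> \<in> hom H (units_of (Zp p)) \<longleftrightarrow> (\<forall>a\<in>carrier H. 0 < \<rho> a \<and> \<rho> a < int p) \<and>
    (\<forall>a\<in>carrier H. \<forall>b\<in>carrier H. \<rho> (a \<otimes>\<^bsub>H\<^esub> b) = (\<rho> a * \<rho> b) mod int p)"
  by (auto simp: hom_def units_of_carrier units_of_mult Zp_Units Zp_ops Pi_def)

lemma hom_units_one:
  assumes "group H" "\<rho> \<in> hom H (units_of (Zp p))"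
  shows "\<rho> \<one>\<^bsub>H\<^esub> = 1"
  using hom_one[OF assms(2,1) Z.units_group] by (simp add: units_of_one Zp_ops)

lemma not_dvd_residue: "0 < x \<Longrightarrow> x < int p \<Longrightarrow> \<not> int p dvd x"
  by (simp add: zdvd_not_zless)

lemma residue_inverse_ex:
  assumes "\<not> int p dvd x"
  obtains y where "0 < y" "y < int p" "(x * y) mod int p = 1"
proof -
  have x: "x mod int p \<noteq> 0" using assms by (simp add: dvd_eq_mod_eq_0)
  then have "0 < x mod int p" "x mod int p < int p"
    using p_gt_1 pos_mod_sign[of "int p" x] pos_mod_bound[of "int p" x] by linarith+
  from Zp_inv[OF this] show ?thesis
    using that[of "inv\<^bsub>Zp p\<^esub> (x mod int p)"] by (auto simp: mod_simps)
qed

text \<open>Induction from \<open>q 0 \<equiv> 0\<close>. The values of \<open>q\<close> need not be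
  reduced: besides maps into \<open>Z_p\<close> it is applied to matrix entries chosen as arbitrary
  integers, hence a conclusion modulo \<open>p\<close>.\<close>

lemma additive_residue:
  assumes add: "\<And>x y. 0 \<le> x \<Longrightarrow> x < int p \<Longrightarrow> 0 \<le> y \<Longrightarrow> y < int p \<Longrightarrow>
      q ((x + y) mod int p) mod int p = (q x + q y) mod int p"
    and x: "0 \<le> x" "x < int p"
  shows "q x mod int p = (x * q 1) mod int p"
proof -
  have "q (int k) mod int p = (int k * q 1) mod int p" if "k < p" for k
    using that
  proof (induction k)
    case 0
    have "q 0 mod int p = (q 0 + q 0) mod int p" using add[of 0 0] p_gt_1 by simp
    then have "int p dvd q 0" by (simp add: mod_eq_dvd_iff)
    then show ?case by simp
  next
    case (Suc k)
    have "q (int (Suc k)) mod int p = (q (int k) + q 1) mod int p"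
      using add[of "int k" 1] Suc.prems p_gt_1 by (simp add: add.commute)
    also have "\<dots> = (int (Suc k) * q 1) mod int p"
      using Suc unfolding mod_eq_dvd_iff by (simp add: algebra_simps)
    finally show ?case .
  qed
  from this[of "nat x"] x show ?thesis by simp
qed

text \<open>The first cohomology of a finite group of order prime to \<open>p\<close> vanishes, by averaging.\<close>

lemma cocycle_trivial:
  fixes K :: "('k, 'm) monoid_scheme" and c \<chi> :: "'k \<Rightarrow> int"
  assumes K: "group K" and fin: "finite (carrier K)" and coprime: "\<not> p dvd order K"
    and cocycle: "\<And>a b. a \<in> carrier K \<Longrightarrow> b \<in> carrier K \<Longrightarrow>
      c (a \<otimes>\<^bsub>K\<^esub> b) mod int p = (c a + \<chi> a * c b) mod int p"
  obtains i where "0 \<le> i" "i < int p"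
    "\<And>a. a \<in> carrier K \<Longrightarrow> c a mod int p = (i - \<chi> a * i) mod int p"
proof -
  interpret group K by fact
  define S where "S = (\<Sum>b\<in>carrier K. c b)"
  \<comment> \<open>Sum the cocycle identity over \<open>b\<close>; left translation by
    \<open>a\<close> permutes the group.\<close>
  have S: "S mod int p = (int (order K) * c a + \<chi> a * S) mod int p" if a: "a \<in> carrier K" for a
  proof -
    have "bij_betw (\<lambda>b. a \<otimes>\<^bsub>K\<^esub> b) (carrier K) (carrier K)"
      using a by (intro bij_betw_byWitness[where f' = "\<lambda>b. inv\<^bsub>K\<^esub> a \<otimes>\<^bsub>K\<^esub> b"]) (auto simp flip: m_assoc)
    then have "S = (\<Sum>b\<in>carrier K. c (a \<otimes>\<^bsub>K\<^esub> b))"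
      unfolding S_def by (rule sum.reindex_bij_betw[symmetric])
    also have "\<dots> mod int p = (\<Sum>b\<in>carrier K. c a + \<chi> a * c b) mod int p"
      using a cocycle by (subst (1 2) mod_sum_eq[symmetric]) simp
    also have "(\<Sum>b\<in>carrier K. c a + \<chi> a * c b) = int (order K) * c a + \<chi> a * S"
      by (simp add: S_def sum.distrib sum_distrib_left order_def)
    finally show ?thesis .
  qed
  have "\<not> int p dvd int (order K)" using coprime by simp
  then obtain m where m: "(int (order K) * m) mod int p = 1" by (rule residue_inverse_ex)
  then have m: "(int (order K) * m) mod int p = 1 mod int p" using p_gt_1 by simp
  show ?thesis
  \<comment> \<open>The witness is \<open>S\<close> divided by the group order: solve
    \<open>S = |K| c a + \<chi> a S\<close> for \<open>c a\<close>.\<close>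
  proof (rule that[of "(m * S) mod int p"])
    show "c a mod int p = (m * S mod int p - \<chi> a * (m * S mod int p)) mod int p"
      if a: "a \<in> carrier K" for a
      using S[OF a] m unfolding mod_eq_dvd_iff unfolding mod_unfold by Groebner_Basis.algebra
  qed (use p_gt_1 in simp_all)
qed

section \<open>The group \<open>Z\<^sub>p \<rtimes> E\<close> and its automorphisms\<close>

lemma Zp_semidirect_simps:
  "carrier (Zp_semidirect p \<sigma> E) = {0..<int p} \<times> carrier E"
  "(m, a) \<otimes>\<^bsub>Zp_semidirect p \<sigma> E\<^esub> (m', b) = ((m + \<sigma> a * m') mod int p, a \<otimes>\<^bsub>E\<^esub> b)"
  "\<one>\<^bsub>Zp_semidirect p \<sigma> E\<^esub> = (0, \<one>\<^bsub>E\<^esub>)"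
  by (simp_all add: Zp_semidirect_def Zp_carrier Zp_ops mod_simps)

lemma snd_mult_Zp_semidirect: "snd (x \<otimes>\<^bsub>Zp_semidirect p \<sigma> E\<^esub> y) = snd x \<otimes>\<^bsub>E\<^esub> snd y"
  by (cases x; cases y) (simp add: Zp_semidirect_simps)

context
  fixes E :: "('a, 'm) monoid_scheme" and \<sigma> :: "'a \<Rightarrow> int"
  assumes E: "group E" and \<sigma>: "\<sigma> \<in> hom E (units_of (Zp p))"
begin

interpretation E: group E by (rule E)

lemma char_inv:
  assumes a: "a \<in> carrier E"
  shows "(\<sigma> a * \<sigma> (inv\<^bsub>E\<^esub> a)) mod int p = 1"
  using \<sigma> a E.inv_closed[OF a] hom_units_one[OF E \<sigma>] unfolding hom_units_iff
  by (metis E.r_inv)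

lemma group_Zp_semidirect: "group (Zp_semidirect p \<sigma> E)"
proof (rule groupI)
  fix x assume x: "x \<in> carrier (Zp_semidirect p \<sigma> E)"
  show "\<one>\<^bsub>Zp_semidirect p \<sigma> E\<^esub> \<otimes>\<^bsub>Zp_semidirect p \<sigma> E\<^esub> x = x"
    using x by (auto simp: Zp_semidirect_simps hom_units_one[OF E \<sigma>])
  obtain m a where ma: "x = (m, a)" "a \<in> carrier E" using x by (auto simp: Zp_semidirect_simps)
  show "\<exists>y\<in>carrier (Zp_semidirect p \<sigma> E). y \<otimes>\<^bsub>Zp_semidirect p \<sigma> E\<^esub> x = \<one>\<^bsub>Zp_semidirect p \<sigma> E\<^esub>"
    using ma p_gt_1 by (intro bexI[of _ "((- (\<sigma> (inv\<^bsub>E\<^esub> a) * m)) mod int p, inv\<^bsub>E\<^esub> a)"])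
      (auto simp: Zp_semidirect_simps mod_simps)
next
  fix x y z
  assume xyz: "x \<in> carrier (Zp_semidirect p \<sigma> E)" "y \<in> carrier (Zp_semidirect p \<sigma> E)"
    "z \<in> carrier (Zp_semidirect p \<sigma> E)"
  obtain k a l b m c where x: "x = (k, a)" and y: "y = (l, b)" and z: "z = (m, c)"
    by (cases x; cases y; cases z)
  have "\<sigma> (a \<otimes>\<^bsub>E\<^esub> b) mod int p = \<sigma> a * \<sigma> b mod int p"
    using xyz \<sigma> unfolding x y z by (simp add: Zp_semidirect_simps hom_units_iff)
  then have "((k + \<sigma> a * l) mod int p + \<sigma> (a \<otimes>\<^bsub>E\<^esub> b) * m) mod int p =
      (k + \<sigma> a * ((l + \<sigma> b * m) mod int p)) mod int p"
    unfolding mod_eq_dvd_iff unfolding mod_unfold by Groebner_Basis.algebra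
  then show "x \<otimes>\<^bsub>Zp_semidirect p \<sigma> E\<^esub> y \<otimes>\<^bsub>Zp_semidirect p \<sigma> E\<^esub> z =
      x \<otimes>\<^bsub>Zp_semidirect p \<sigma> E\<^esub> (y \<otimes>\<^bsub>Zp_semidirect p \<sigma> E\<^esub> z)"
    using xyz unfolding x y z by (simp add: Zp_semidirect_simps E.m_assoc)
qed (use p_gt_1 in \<open>auto simp: Zp_semidirect_simps\<close>)

interpretation A: group "Zp_semidirect p \<sigma> E" by (rule group_Zp_semidirect)

lemma inv_Zp_semidirect:
  assumes "0 \<le> m" "m < int p" "a \<in> carrier E"
  shows "inv\<^bsub>Zp_semidirect p \<sigma> E\<^esub> (m, a) = ((- (\<sigma> (inv\<^bsub>E\<^esub> a) * m)) mod int p, inv\<^bsub>E\<^esub> a)"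
  using assms p_gt_1 by (intro A.inv_equality) (auto simp: Zp_semidirect_simps mod_simps)

lemma pow_Zp_part:
  "(m, \<one>\<^bsub>E\<^esub>) [^]\<^bsub>Zp_semidirect p \<sigma> E\<^esub> (k :: nat) = ((int k * m) mod int p, \<one>\<^bsub>E\<^esub>)"
  if "0 \<le> m" "m < int p"
  using that
  by (induction k) (simp_all add: Zp_semidirect_simps hom_units_one[OF E \<sigma>] mod_simps algebra_simps)

lemma snd_pow_Zp_semidirect:
  "snd (x [^]\<^bsub>Zp_semidirect p \<sigma> E\<^esub> (k :: nat)) = snd x [^]\<^bsub>E\<^esub> k"
  by (induction k) (simp_all add: snd_mult_Zp_semidirect, simp add: Zp_semidirect_simps)

text \<open>An automorphism preserves \<open>Z_p\<close>: the images of its elements have trivial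
  \<open>p\<close>-th power, and in \<open>E\<close> only the identity has that. On
  \<open>Z_p\<close> it is a scalar \<open>\<alpha>\<close>; its first component on the complement
  \<open>{0} \<times> E\<close> is a cocycle, hence a coboundary
  \<open>i (1 - \<sigma> a)\<close>.\<close>

lemma auto_Zp_semidirect:
  assumes fin: "finite (carrier E)" and coprime: "\<not> p dvd order E"
    and f: "f \<in> auto (Zp_semidirect p \<sigma> E)"
  obtains \<alpha> i \<mu> where "0 < \<alpha>" "\<alpha> < int p" "0 \<le> i" "i < int p" "\<mu> \<in> auto E"
    "\<And>a. a \<in> carrier E \<Longrightarrow> \<sigma> (\<mu> a) = \<sigma> a"
    "\<And>m a. 0 \<le> m \<Longrightarrow> m < int p \<Longrightarrow> a \<in> carrier E \<Longrightarrow>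
      f (m, a) = ((\<alpha> * m + i * (1 - \<sigma> a)) mod int p, \<mu> a)"
proof -
  let ?A = "Zp_semidirect p \<sigma> E"
  have A: "x \<in> carrier ?A \<longleftrightarrow> 0 \<le> fst x \<and> fst x < int p \<and> snd x \<in> carrier E" for x
    by (cases x) (simp add: Zp_semidirect_simps)
  have fA: "0 \<le> fst (f x) \<and> fst (f x) < int p \<and> snd (f x) \<in> carrier E" if "x \<in> carrier ?A" for x
    using auto_closed[OF f that] unfolding A .
  have char: "0 < \<sigma> a" "\<sigma> a < int p" "\<sigma> (a \<otimes>\<^bsub>E\<^esub> b) = (\<sigma> a * \<sigma> b) mod int p"
    if "a \<in> carrier E" "b \<in> carrier E" for a b
    using \<sigma> that unfolding hom_units_iff by blast+
  have one: "\<sigma> \<one>\<^bsub>E\<^esub> = 1" by (rule hom_units_one[OF E \<sigma>])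
  have snd_f: "snd (f (m, \<one>\<^bsub>E\<^esub>)) = \<one>\<^bsub>E\<^esub>" if m: "0 \<le> m" "m < int p" for m
  proof (rule E.pow_p_eq_one[OF p coprime])
    have x: "(m, \<one>\<^bsub>E\<^esub>) \<in> carrier ?A" using m by (simp add: A)
    show "snd (f (m, \<one>\<^bsub>E\<^esub>)) \<in> carrier E" using fA[OF x] by simp
    interpret f: group_hom ?A ?A f
      using f by unfold_locales (simp add: auto_def)
    have "f (m, \<one>\<^bsub>E\<^esub>) [^]\<^bsub>?A\<^esub> p = f ((m, \<one>\<^bsub>E\<^esub>) [^]\<^bsub>?A\<^esub> p)"
      using x by (simp add: f.hom_nat_pow)
    also have "\<dots> = \<one>\<^bsub>?A\<^esub>"
      using m A.auto_one[OF f] by (simp add: pow_Zp_part Zp_semidirect_simps)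
    finally show "snd (f (m, \<one>\<^bsub>E\<^esub>)) [^]\<^bsub>E\<^esub> p = \<one>\<^bsub>E\<^esub>"
      unfolding snd_pow_Zp_semidirect[symmetric] by (simp add: Zp_semidirect_simps)
  qed
  define q where "q = (\<lambda>m. fst (f (m, \<one>\<^bsub>E\<^esub>)))"
  define c where "c = (\<lambda>a. fst (f (0, a)))"
  define \<mu> where "\<mu> = (\<lambda>a\<in>carrier E. snd (f (0, a)))"
  have q: "f (m, \<one>\<^bsub>E\<^esub>) = (q m, \<one>\<^bsub>E\<^esub>)" "0 \<le> q m" "q m < int p" if "0 \<le> m" "m < int p" for m
    using fA[of "(m, \<one>\<^bsub>E\<^esub>)"] snd_f[OF that] that by (simp_all add: q_def A prod_eq_iff)
  have c: "f (0, a) = (c a, \<mu> a)" "\<mu> a \<in> carrier E" "0 \<le> c a" "c a < int p" if "a \<in> carrier E" for a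
    using fA[of "(0, a)"] p_gt_1 that by (simp_all add: c_def \<mu>_def A)
  have f_mult: "f ((m + \<sigma> a * m') mod int p, a \<otimes>\<^bsub>E\<^esub> b) = f (m, a) \<otimes>\<^bsub>?A\<^esub> f (m', b)"
    if "0 \<le> m" "m < int p" "0 \<le> m'" "m' < int p" "a \<in> carrier E" "b \<in> carrier E" for m m' a b
    using auto_mult[OF f, of "(m, a)" "(m', b)"] that by (simp add: A Zp_semidirect_simps)
  have q_lin: "q m = (m * q 1) mod int p" if m: "0 \<le> m" "m < int p" for m
  proof -
    have "q m mod int p = (m * q 1) mod int p"
    proof (rule additive_residue[OF _ m])
      fix x y assume xy: "0 \<le> x" "x < int p" "0 \<le> y" "y < int p"
      have "f ((x + y) mod int p, \<one>\<^bsub>E\<^esub>) = ((q x + q y) mod int p, \<one>\<^bsub>E\<^esub>)"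
        using f_mult[of x y "\<one>\<^bsub>E\<^esub>" "\<one>\<^bsub>E\<^esub>"] xy by (simp add: one q Zp_semidirect_simps)
      then show "q ((x + y) mod int p) mod int p = (q x + q y) mod int p"
        by (simp add: q_def)
    qed
    then show ?thesis using q[OF m] by simp
  qed
  have f_eq: "f (m, a) = ((q m + c a) mod int p, \<mu> a)" if "0 \<le> m" "m < int p" "a \<in> carrier E" for m a
    using f_mult[of m 0 "\<one>\<^bsub>E\<^esub>" a] that p_gt_1 by (simp add: one q c Zp_semidirect_simps)
  have q1: "0 < q 1"
  proof -
    have "f (1, \<one>\<^bsub>E\<^esub>) \<noteq> f (0, \<one>\<^bsub>E\<^esub>)"
      using inj_on_contraD[OF bij_betw_imp_inj_on[OF auto_bij[OF f]],
          of "(1, \<one>\<^bsub>E\<^esub>)" "(0, \<one>\<^bsub>E\<^esub>)"] p_gt_1 by (simp add: A)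
    then show ?thesis using q[of 0] q_lin[of 0] q[of 1] p_gt_1 by simp
  qed
  have c_mult: "c (a \<otimes>\<^bsub>E\<^esub> b) = (c a + \<sigma> (\<mu> a) * c b) mod int p" "\<mu> (a \<otimes>\<^bsub>E\<^esub> b) = \<mu> a \<otimes>\<^bsub>E\<^esub> \<mu> b"
    if "a \<in> carrier E" "b \<in> carrier E" for a b
    using f_mult[of 0 0 a b] that p_gt_1 by (simp_all add: c Zp_semidirect_simps)
  have \<sigma>_\<mu>: "\<sigma> (\<mu> a) = \<sigma> a" if a: "a \<in> carrier E" for a
  proof -
    \<comment> \<open>\<open>(0, a)\<close> times \<open>(1, \<one>)\<close> is
      \<open>(\<sigma> a, a)\<close>. Comparing first components of the images gives
      \<open>\<sigma> a q(1) = \<sigma> (\<mu> a) q(1)\<close>, and \<open>q 1\<close> is a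
      unit.\<close>
    have "f (\<sigma> a, a) = f (0, a) \<otimes>\<^bsub>?A\<^esub> f (1, \<one>\<^bsub>E\<^esub>)"
      using f_mult[of 0 1 a "\<one>\<^bsub>E\<^esub>"] p_gt_1 a char[of a \<open>\<one>\<^bsub>E\<^esub>\<close>] by simp
    then have "(q (\<sigma> a) + c a) mod int p = (c a + \<sigma> (\<mu> a) * q 1) mod int p"
      using f_eq[of "\<sigma> a" a] a q[of 1] char[of a \<open>\<one>\<^bsub>E\<^esub>\<close>] p_gt_1 by (simp add: c Zp_semidirect_simps)
    then have "int p dvd (\<sigma> a - \<sigma> (\<mu> a)) * q 1"
      unfolding q_lin[OF less_imp_le[OF char(1)[OF a E.one_closed]] char(2)[OF a E.one_closed]]
        mod_simps mod_eq_dvd_iff by (simp add: algebra_simps)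
    moreover have "\<not> int p dvd q 1" using q1 q[of 1] p_gt_1 by (simp add: zdvd_not_zless)
    ultimately have "int p dvd \<sigma> a - \<sigma> (\<mu> a)"
      using p by (simp add: prime_dvd_mult_iff)
    then have "\<sigma> a mod int p = \<sigma> (\<mu> a) mod int p" by (simp add: mod_eq_dvd_iff)
    then show ?thesis using char[of a \<open>\<one>\<^bsub>E\<^esub>\<close>] char[of "\<mu> a" \<open>\<one>\<^bsub>E\<^esub>\<close>] c a by simp
  qed
  have "c (a \<otimes>\<^bsub>E\<^esub> b) mod int p = (c a + \<sigma> a * c b) mod int p"
    if "a \<in> carrier E" "b \<in> carrier E" for a b
    using that by (simp add: c_mult \<sigma>_\<mu>)
  then obtain i where i: "0 \<le> i" "i < int p"
    "\<And>a. a \<in> carrier E \<Longrightarrow> c a mod int p = (i - \<sigma> a * i) mod int p"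
    using cocycle_trivial[OF E fin coprime, of c \<sigma>] by blast
  \<comment> \<open>Surjectivity is inherited from \<open>f\<close>; finiteness of \<open>E\<close>
    then supplies injectivity.\<close>
  have "\<mu> ` carrier E = carrier E"
  proof (intro subset_antisym subsetI)
    show "x \<in> carrier E" if "x \<in> \<mu> ` carrier E" for x using that c by auto
    show "b \<in> \<mu> ` carrier E" if b: "b \<in> carrier E" for b
    proof -
      have "(0, b) \<in> f ` carrier ?A"
        using auto_bij[OF f] b p_gt_1 by (simp add: bij_betw_def A)
      then obtain m a where "0 \<le> m" "m < int p" "a \<in> carrier E" "f (m, a) = (0, b)"
        by (auto simp: A image_iff)
      then show ?thesis using f_eq[of m a] by auto
    qed
  qed
  then have "bij_betw \<mu> (carrier E) (carrier E)"
    using fin by (simp add: bij_betw_def eq_card_imp_inj_on)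
  then have "\<mu> \<in> auto E"
    using c c_mult by (auto simp: auto_def Bij_def hom_def) (simp add: \<mu>_def)
  moreover have "f (m, a) = ((q 1 * m + i * (1 - \<sigma> a)) mod int p, \<mu> a)"
    if ma: "0 \<le> m" "m < int p" "a \<in> carrier E" for m a
  proof -
    have "(q m + c a) mod int p = (q 1 * m + i * (1 - \<sigma> a)) mod int p"
      using i(3)[OF ma(3)] unfolding q_lin[OF ma(1,2)] mod_simps mod_eq_dvd_iff
      by Groebner_Basis.algebra
    then show ?thesis using f_eq[OF ma] by simp
  qed
  ultimately show ?thesis using that q1 q[of 1] i \<sigma>_\<mu> p_gt_1 by simp
qed

end

end

text \<open>The isomorphism is kept as an element of \<open>auto A\<close> because the applications
  read off its triangular form.\<close>

lemma conjugate_regular: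
  assumes A: "group A" and C: "skew_brace C" "additive_group_is C A"
    and conj: "conjugate_in (holomorph A) (regular_of_brace C) R"
  shows "regular_subgroup A R" "\<exists>f\<in>auto A. f \<in> brace_iso C (brace_of_regular A R)"
proof -
  have "conjugate_in (holomorph C) (regular_of_brace C) R"
    using conj holomorph_additive_group[OF C(2)] by simp
  then obtain D f where D: "skew_brace D" "additive_group_is D C" "R = regular_of_brace D"
    and f: "f \<in> auto C" "f \<in> brace_iso C D"
    by (rule conjugate_imp_brace_iso[OF C(1)])
  have DA: "additive_group_is D A" using D(2) C(2) by (simp add: additive_group_is_def)
  show R: "regular_subgroup A R"
    using regular_of_brace_regular[OF D(1)] D(3) regular_subgroup_additive_group[OF DA] by simp
  have "f \<in> brace_iso C (brace_of_regular A R)"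
    using brace_isoD[OF f(2)] circ_brace_of_regular_of_brace[OF DA D(1)] DA C(2) D(3)
    by (intro brace_isoI) (simp_all add: brace_of_regular_def additive_group_is_def)
  then show "\<exists>f\<in>auto A. f \<in> brace_iso C (brace_of_regular A R)"
    using f(1) auto_additive_group[OF C(2)] by blast
qed

lemma brace_iso_inv:
  assumes C: "skew_brace C" and f: "f \<in> brace_iso C D"
  shows "inv_into (carrier C) f \<in> brace_iso D C"
  using group.iso_set_sym[OF skew_brace_group[OF C]]
    group.iso_set_sym[OF skew_brace_circ_group[OF C]] f by (auto simp: brace_iso_def)

lemma brace_iso_imp_conjugate_regular:
  assumes A: "group A" and C: "skew_brace C" "additive_group_is C A"
    and R: "regular_subgroup A R" and f: "f \<in> brace_iso (brace_of_regular A R) C"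
  shows "conjugate_in (holomorph A) (regular_of_brace C) R"
proof -
  let ?D = "brace_of_regular A R"
  have D: "skew_brace ?D" "regular_of_brace ?D = R"
    using brace_of_regular[OF A R] by auto
  have "additive_group_is ?D C"
    using additive_brace_of_regular[of A R] C(2) by (simp add: additive_group_is_def)
  from brace_iso_imp_conjugate[OF C(1) D(1) this brace_iso_inv[OF D(1) f]] show ?thesis
    using D(2) holomorph_additive_group[OF C(2)] by simp
qed

section \<open>Extensions of \<open>B\<close> by \<open>Z\<^sub>p\<close>\<close>

text \<open>For \<open>u = 1\<close> and \<open>u = \<sigma>\<close> these are the braces of \<open>G\<close> and \<open>G'\<close>.\<close>

definition ext_brace ::
  "nat \<Rightarrow> ('a \<Rightarrow> int) \<Rightarrow> ('a \<Rightarrow> int) \<Rightarrow> ('a \<Rightarrow> int) \<Rightarrow> 'a skew_brace \<Rightarrow> (int \<times> 'a) skew_brace" where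
  "ext_brace p \<sigma> u t B = \<lparr>carrier = carrier (Zp_semidirect p \<sigma> B),
     monoid.mult = monoid.mult (Zp_semidirect p \<sigma> B), one = \<one>\<^bsub>Zp_semidirect p \<sigma> B\<^esub>,
     circ = (\<lambda>(m, a) (m', b). ((u b * m + u a * t a * m') mod int p, circ B a b))\<rparr>"

lemma additive_ext_brace: "additive_group_is (ext_brace p \<sigma> u t B) (Zp_semidirect p \<sigma> B)"
  by (simp add: additive_group_is_def ext_brace_def)

lemma circ_ext_brace:
  "circ (ext_brace p \<sigma> u t B) (m, a) (m', b) = ((u b * m + u a * t a * m') mod int p, circ B a b)"
  by (simp add: ext_brace_def)

lemma circ_hom_units:
  assumes p: "prime p" and B: "skew_brace B" and t: "t \<in> hom (circ_group B) (units_of (Zp p))"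
  shows "a \<in> carrier B \<Longrightarrow> 0 < t a" "a \<in> carrier B \<Longrightarrow> t a < int p"
    "a \<in> carrier B \<Longrightarrow> b \<in> carrier B \<Longrightarrow> t (circ B a b) mod int p = (t a * t b) mod int p"
    "t \<one>\<^bsub>B\<^esub> = 1"
  using t hom_units_one[OF p skew_brace_circ_group[OF B] t] by (simp_all add: hom_units_iff[OF p])

lemma brace_char:
  assumes p: "prime p" and B: "skew_brace B" and \<chi>: "\<chi> \<in> brace_chars p B"
  shows "a \<in> carrier B \<Longrightarrow> 0 < \<chi> a" "a \<in> carrier B \<Longrightarrow> \<chi> a < int p"
    "a \<in> carrier B \<Longrightarrow> b \<in> carrier B \<Longrightarrow> \<chi> (a \<otimes>\<^bsub>B\<^esub> b) mod int p = (\<chi> a * \<chi> b) mod int p"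
    "a \<in> carrier B \<Longrightarrow> b \<in> carrier B \<Longrightarrow> \<chi> (circ B a b) mod int p = (\<chi> a * \<chi> b) mod int p"
    "\<chi> \<one>\<^bsub>B\<^esub> = 1"
    "a \<in> carrier B \<Longrightarrow> (\<chi> a * \<chi> (inv\<^bsub>B\<^esub> a)) mod int p = 1 mod int p"
proof -
  have \<chi>: "\<chi> \<in> hom B (units_of (Zp p))" "\<chi> \<in> hom (circ_group B) (units_of (Zp p))"
    using \<chi> by (auto simp: brace_chars_def)
  show "a \<in> carrier B \<Longrightarrow> 0 < \<chi> a" "a \<in> carrier B \<Longrightarrow> \<chi> a < int p"
    "a \<in> carrier B \<Longrightarrow> b \<in> carrier B \<Longrightarrow> \<chi> (a \<otimes>\<^bsub>B\<^esub> b) mod int p = (\<chi> a * \<chi> b) mod int p"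
    "a \<in> carrier B \<Longrightarrow> b \<in> carrier B \<Longrightarrow> \<chi> (circ B a b) mod int p = (\<chi> a * \<chi> b) mod int p"
    "\<chi> \<one>\<^bsub>B\<^esub> = 1"
    using \<chi> hom_units_one[OF p skew_brace_group[OF B] \<chi>(1)] by (simp_all add: hom_units_iff[OF p])
  show "a \<in> carrier B \<Longrightarrow> (\<chi> a * \<chi> (inv\<^bsub>B\<^esub> a)) mod int p = 1 mod int p"
    using char_inv[OF p skew_brace_group[OF B] \<chi>(1)] p_gt_1[OF p] by simp
qed

text \<open>In this brace \<open>(m, \<one>) \<circ> (0, a) = (u a m, a)\<close> and
  \<open>(0, a) \<circ> (m, \<one>) = (u a t a m, a)\<close>. So \<open>u\<close> is the scaling of
  \<open>Z_p\<close> by multiplication on the right, and \<open>t\<close> is the action on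
  \<open>Z_p\<close> by conjugation in the multiplicative group.\<close>

locale brace_extension =
  fixes p :: nat and B :: "'a skew_brace" and \<sigma> u t :: "'a \<Rightarrow> int"
  assumes p: "prime p" and B: "skew_brace B" and \<sigma>: "\<sigma> \<in> brace_chars p B"
    and u: "u \<in> brace_chars p B" and t: "t \<in> hom (circ_group B) (units_of (Zp p))"
    and u_cases: "(\<forall>a\<in>carrier B. u a = 1) \<or> (\<forall>a\<in>carrier B. u a = \<sigma> a)"
begin

abbreviation "C \<equiv> ext_brace p \<sigma> u t B"
abbreviation "A \<equiv> Zp_semidirect p \<sigma> B"

lemma group_A: "group A"
  using \<sigma> by (intro group_Zp_semidirect p skew_brace_group B) (simp add: brace_chars_def)

lemmas A_simps = Zp_semidirect_simps[OF p]

lemma C_simps: "carrier C = {0..<int p} \<times> carrier B"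
  "(m, a) \<otimes>\<^bsub>C\<^esub> (m', b) = ((m + \<sigma> a * m') mod int p, a \<otimes>\<^bsub>B\<^esub> b)"
  "\<one>\<^bsub>C\<^esub> = (0, \<one>\<^bsub>B\<^esub>)"
  using A_simps[of \<sigma> B] by (simp_all add: ext_brace_def)

lemma inv_C: "0 \<le> m \<Longrightarrow> m < int p \<Longrightarrow> a \<in> carrier B \<Longrightarrow>
    inv\<^bsub>C\<^esub> (m, a) = ((- (\<sigma> (inv\<^bsub>B\<^esub> a) * m)) mod int p, inv\<^bsub>B\<^esub> a)"
  using inv_Zp_semidirect[OF p skew_brace_group[OF B]] \<sigma>
  by (simp add: inv_additive_group[OF additive_ext_brace] brace_chars_def)

lemmas \<sigma>_char = brace_char[OF p B \<sigma>]
lemmas u_char = brace_char[OF p B u]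
lemmas t_char = circ_hom_units[OF p B t]

interpretation B: group B by (rule skew_brace_group[OF B])
interpretation circB: group "circ_group B" by (rule skew_brace_circ_group[OF B])

lemma group_circ_C: "group (circ_group C)"
proof (rule groupI)
  fix x assume "x \<in> carrier (circ_group C)"
  then obtain m a where x: "x = (m, a)" and ma: "0 \<le> m" "m < int p" "a \<in> carrier B"
    by (auto simp: C_simps)
  show "\<one>\<^bsub>circ_group C\<^esub> \<otimes>\<^bsub>circ_group C\<^esub> x = x"
    using ma by (simp add: x C_simps circ_ext_brace u_char t_char circ_one[OF B])
  let ?b = "inv\<^bsub>circ_group B\<^esub> a"
  have b: "?b \<in> carrier B" "circ B ?b a = \<one>\<^bsub>B\<^esub>"
    using ma circB.inv_closed[of a] circB.l_inv[of a] by simp_all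
  have inv: "(u a * u (inv\<^bsub>B\<^esub> a)) mod int p = 1 mod int p" using ma by (simp only: u_char)
  \<comment> \<open>Solves \<open>u a k + u b t b m = 0\<close> for \<open>k\<close>; the division
    by \<open>u a\<close> goes through the additive inverse of \<open>a\<close>.\<close>
  let ?k = "(- (u (inv\<^bsub>B\<^esub> a) * u ?b * t ?b * m)) mod int p"
  have "(u a * ?k + u ?b * t ?b * m) mod int p = 0 mod int p"
    using inv unfolding mod_eq_dvd_iff unfolding mod_unfold by Groebner_Basis.algebra
  then show "\<exists>y\<in>carrier (circ_group C). y \<otimes>\<^bsub>circ_group C\<^esub> x = \<one>\<^bsub>circ_group C\<^esub>"
    using b p_gt_1[OF p] by (intro bexI[of _ "(?k, ?b)"]) (simp_all add: x C_simps circ_ext_brace)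
next
  fix x y z
  assume "x \<in> carrier (circ_group C)" "y \<in> carrier (circ_group C)" "z \<in> carrier (circ_group C)"
  then obtain k a l b m c where x: "x = (k, a)" and y: "y = (l, b)" and z: "z = (m, c)"
    and abc: "a \<in> carrier B" "b \<in> carrier B" "c \<in> carrier B"
    by (auto simp: C_simps)
  have "(u c * ((u b * k + u a * t a * l) mod int p) + u (circ B a b) * t (circ B a b) * m) mod int p =
      (u (circ B b c) * k + u a * t a * ((u c * l + u b * t b * m) mod int p)) mod int p"
    using u_char(4)[OF abc(1,2)] u_char(4)[OF abc(2,3)] t_char(3)[OF abc(1,2)]
    unfolding mod_eq_dvd_iff unfolding mod_unfold by Groebner_Basis.algebra
  then show "x \<otimes>\<^bsub>circ_group C\<^esub> y \<otimes>\<^bsub>circ_group C\<^esub> z = x \<otimes>\<^bsub>circ_group C\<^esub> (y \<otimes>\<^bsub>circ_group C\<^esub> z)"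
    using abc by (simp add: x y z C_simps circ_ext_brace circ_assoc[OF B])
qed (use p_gt_1[OF p] in \<open>auto simp: C_simps circ_ext_brace circ_closed[OF B]\<close>)

text \<open>The brace identity at \<open>(k, a), (l, b), (m, c)\<close> holds up to the term
  \<open>k (u b - \<sigma> b) (u c - 1)\<close>; this is the condition behind
  \<open>u_cases\<close>.\<close>

lemma u_cocycle:
  assumes "a \<in> carrier B" "b \<in> carrier B"
  shows "int p dvd (u a - \<sigma> a) * (u b - 1)"
  using u_cases assms by auto

lemma skew_brace_C: "skew_brace C"
  unfolding skew_brace_def
proof (intro conjI ballI)
  show "group C" using group_additive_group[OF additive_ext_brace] group_A by blast
  show "group (circ_group C)" by (rule group_circ_C)
  fix x y z
  assume "x \<in> carrier C" "y \<in> carrier C" "z \<in> carrier C"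
  then obtain k a l b m c where x: "x = (k, a)" and y: "y = (l, b)" and z: "z = (m, c)"
    and abc: "a \<in> carrier B" "b \<in> carrier B" "c \<in> carrier B" and k: "0 \<le> k" "k < int p"
    by (auto simp: C_simps)
  let ?ai = "inv\<^bsub>B\<^esub> a"
  have ai: "?ai \<in> carrier B" "circ B a b \<in> carrier B" using abc circ_closed[OF B] by auto
  have "(u (b \<otimes>\<^bsub>B\<^esub> c) * k + u a * t a * ((l + \<sigma> b * m) mod int p)) mod int p =
    (((u b * k + u a * t a * l) mod int p + \<sigma> (circ B a b) * ((- (\<sigma> ?ai * k)) mod int p)) mod int p
      + \<sigma> (circ B a b \<otimes>\<^bsub>B\<^esub> ?ai) * ((u c * k + u a * t a * m) mod int p)) mod int p"
    using u_char(3)[OF abc(2,3)] \<sigma>_char(4)[OF abc(1,2)] \<sigma>_char(6)[OF abc(1)]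
      \<sigma>_char(3)[OF ai(2,1)] u_cocycle[OF abc(2,3)]
    unfolding mod_eq_dvd_iff unfolding mod_unfold by Groebner_Basis.algebra
  then show "circ C x (y \<otimes>\<^bsub>C\<^esub> z) = circ C x y \<otimes>\<^bsub>C\<^esub> inv\<^bsub>C\<^esub> x \<otimes>\<^bsub>C\<^esub> circ C x z"
    using abc k by (simp add: x y z C_simps circ_ext_brace inv_C circ_mult[OF B] mod_simps)
qed

text \<open>For \<open>u = 1\<close> this is the diagonal matrix with entry
  \<open>t a / \<sigma> a\<close>. For \<open>u = \<sigma>\<close> the scalar is \<open>t a\<close>,
  and the remaining term \<open>\<sigma> (a^-1) m (\<sigma> b - 1)\<close> is
  \<open>\<gamma>_i (b)\<close> with \<open>i = - \<sigma> (a^-1) m\<close>.\<close>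

lemma lam_C:
  assumes "0 \<le> m" "m < int p" "a \<in> carrier B" "0 \<le> m'" "m' < int p" "b \<in> carrier B"
  shows "lam C (m, a) (m', b) =
    ((\<sigma> (inv\<^bsub>B\<^esub> a) * (u a * t a * m' + m * (u b - 1))) mod int p, lam B a b)"
proof -
  have "((- (\<sigma> (inv\<^bsub>B\<^esub> a) * m)) mod int p + \<sigma> (inv\<^bsub>B\<^esub> a) * ((u b * m + u a * t a * m') mod int p)) mod int p
    = (\<sigma> (inv\<^bsub>B\<^esub> a) * (u a * t a * m' + m * (u b - 1))) mod int p"
    unfolding mod_eq_dvd_iff unfolding mod_unfold by Groebner_Basis.algebra
  then show ?thesis
    using assms by (simp add: lam_def C_simps inv_C circ_ext_brace)
qed

lemma lam_C_extensional: "lam C x \<in> extensional ({0..<int p} \<times> carrier B)"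
  unfolding lam_def C_simps by (rule restrict_extensional)

text \<open>Since \<open>(m, a) = (k, \<one>) \<circ> (0, a)\<close> with
  \<open>k = m / u a\<close>, these coordinates split the multiplicative group into
  \<open>Z_p\<close> and a complement acting on it by \<open>t\<close>. As \<open>u\<close> is a
  character of both groups, \<open>1 / u a\<close> can be written with the additive inverse of
  \<open>a\<close>.\<close>

lemma iso_circ_C:
  assumes \<tau>: "\<And>a. a \<in> carrier B \<Longrightarrow> \<tau> (a, lam B a) = t a"
  shows "(\<lambda>(m, a). ((u (inv\<^bsub>B\<^esub> a) * m) mod int p, (a, lam B a)))
    \<in> iso (circ_group C) (Zp_semidirect p \<tau> (regular_group B))"
proof -
  let ?f = "\<lambda>(m, a). ((u (inv\<^bsub>B\<^esub> a) * m) mod int p, (a, lam B a))"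
  let ?g = "\<lambda>(m, (a, f)). ((u a * m) mod int p, a)"
  have reg: "carrier (regular_group B) = regular_of_brace B"
    "monoid.mult (regular_group B) = monoid.mult (holomorph B)"
    by (simp_all add: regular_group_def)
  have "bij_betw ?f (carrier C) ({0..<int p} \<times> regular_of_brace B)"
  proof (rule bij_betw_byWitness[where f' = ?g])
    have id: "(u a * ((u (inv\<^bsub>B\<^esub> a) * m) mod int p)) mod int p = m"
      "(u (inv\<^bsub>B\<^esub> a) * ((u a * m) mod int p)) mod int p = m"
      if "0 \<le> m" "m < int p" "a \<in> carrier B" for m a
    proof -
      have "(u a * ((u (inv\<^bsub>B\<^esub> a) * m) mod int p)) mod int p = m mod int p"
        "(u (inv\<^bsub>B\<^esub> a) * ((u a * m) mod int p)) mod int p = m mod int p"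
        using u_char(6)[OF that(3)] unfolding mod_eq_dvd_iff unfolding mod_unfold
        by Groebner_Basis.algebra+
      then show "(u a * ((u (inv\<^bsub>B\<^esub> a) * m) mod int p)) mod int p = m"
        "(u (inv\<^bsub>B\<^esub> a) * ((u a * m) mod int p)) mod int p = m"
        using that by simp_all
    qed
    show "\<forall>x\<in>carrier C. ?g (?f x) = x" by (auto simp: C_simps id)
    show "\<forall>y\<in>{0..<int p} \<times> regular_of_brace B. ?f (?g y) = y"
      by (auto simp: regular_of_brace_def id)
  qed (use p_gt_1[OF p] in \<open>auto simp: C_simps regular_of_brace_def\<close>)
  then have bij: "bij_betw ?f (carrier (circ_group C)) (carrier (Zp_semidirect p \<tau> (regular_group B)))"
    by (simp add: A_simps reg)
  have mult: "?f (circ C x y) = ?f x \<otimes>\<^bsub>Zp_semidirect p \<tau> (regular_group B)\<^esub> ?f y"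
    if xy: "x \<in> carrier C" "y \<in> carrier C" for x y
  proof -
    obtain k a l b where x: "x = (k, a)" and y: "y = (l, b)" and ab: "a \<in> carrier B" "b \<in> carrier B"
      using xy by (auto simp: C_simps)
    have "(u (inv\<^bsub>B\<^esub> (circ B a b)) * ((u b * k + u a * t a * l) mod int p)) mod int p =
        ((u (inv\<^bsub>B\<^esub> a) * k) mod int p + t a * ((u (inv\<^bsub>B\<^esub> b) * l) mod int p)) mod int p"
      using u_char(4)[OF ab] u_char(6)[OF ab(1)] u_char(6)[OF ab(2)]
        u_char(6)[OF circ_closed[OF B ab]]
      unfolding mod_eq_dvd_iff unfolding mod_unfold by Groebner_Basis.algebra
    then show ?thesis
      using mult_regular_of_brace[OF B ab] ab
      by (simp add: x y circ_ext_brace A_simps reg \<tau> del: mult_holomorph)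
  qed
  show ?thesis
  proof (rule isoI[OF homI bij])
    show "?f x \<in> carrier (Zp_semidirect p \<tau> (regular_group B))" if "x \<in> carrier (circ_group C)" for x
      using bij_betwE[OF bij] that by blast
    show "?f (x \<otimes>\<^bsub>circ_group C\<^esub> y) = ?f x \<otimes>\<^bsub>Zp_semidirect p \<tau> (regular_group B)\<^esub> ?f y"
      if "x \<in> carrier (circ_group C)" "y \<in> carrier (circ_group C)" for x y
      using mult that unfolding circ_group_simps .
  qed
qed

end

section \<open>\<open>G\<close> and \<open>G'\<close> as regular subgroups of extension
  braces\<close>

lemma regular_hom_units:
  assumes B: "skew_brace B" and \<tau>: "\<tau> \<in> hom (regular_group B) (units_of (Zp p))"
  shows "(\<lambda>a. \<tau> (a, lam B a)) \<in> hom (circ_group B) (units_of (Zp p))"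
proof -
  have "\<tau> (circ B a b, lam B (circ B a b)) = \<tau> (a, lam B a) \<otimes>\<^bsub>units_of (Zp p)\<^esub> \<tau> (b, lam B b)"
    if "a \<in> carrier B" "b \<in> carrier B" for a b
    using \<tau> that unfolding mult_regular_of_brace[OF B that, symmetric] hom_def
    by (auto simp: regular_group_def regular_of_brace_def simp del: mult_holomorph)
  then show ?thesis
    using \<tau> by (auto simp: hom_def regular_group_def regular_of_brace_def Pi_def)
qed

lemma brace_chars_one: "prime p \<Longrightarrow> (\<lambda>_. 1) \<in> brace_chars p B"
  using p_gt_1[of p] by (auto simp: brace_chars_def hom_units_iff)

context
  fixes p :: nat and B :: "'a skew_brace" and \<sigma> :: "'a \<Rightarrow> int" and \<tau> :: "'a \<times> ('a \<Rightarrow> 'a) \<Rightarrow> int"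
  assumes p: "prime p" and B: "skew_brace B" and \<sigma>: "\<sigma> \<in> brace_chars p B"
    and \<tau>: "\<tau> \<in> hom (regular_group B) (units_of (Zp p))"
begin

interpretation G: brace_extension p B \<sigma> "\<lambda>_. 1" "\<lambda>a. \<tau> (a, lam B a)"
  using p B \<sigma> brace_chars_one regular_hom_units[OF B \<tau>] by unfold_locales auto

interpretation G': brace_extension p B \<sigma> \<sigma> "\<lambda>a. \<tau> (a, lam B a)"
  using p B \<sigma> regular_hom_units[OF B \<tau>] by unfold_locales auto

lemma G_sub_eq: "G_sub p B \<sigma> \<tau> = regular_of_brace (ext_brace p \<sigma> (\<lambda>_. 1) (\<lambda>a. \<tau> (a, lam B a)) B)"
proof -
  have "tri_map p B (inv\<^bsub>Zp p\<^esub> (\<sigma> a) \<otimes>\<^bsub>Zp p\<^esub> \<tau> (a, lam B a)) (\<lambda>_. \<zero>\<^bsub>Zp p\<^esub>) (lam B a) = lam G.C (m, a)"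
    if ma: "0 \<le> m" "m < int p" "a \<in> carrier B" for m a
  proof (rule extensionalityI)
    show "tri_map p B (inv\<^bsub>Zp p\<^esub> (\<sigma> a) \<otimes>\<^bsub>Zp p\<^esub> \<tau> (a, lam B a)) (\<lambda>_. \<zero>\<^bsub>Zp p\<^esub>) (lam B a)
        \<in> extensional ({0..<int p} \<times> carrier B)"
      unfolding tri_map_def Zp_carrier[OF p] by (rule restrict_extensional)
    show "lam G.C (m, a) \<in> extensional ({0..<int p} \<times> carrier B)"
      by (rule G.lam_C_extensional)
    fix x assume "x \<in> {0..<int p} \<times> carrier B"
    then obtain l b where x: "x = (l, b)" "0 \<le> l" "l < int p" "b \<in> carrier B" by auto
    \<comment> \<open>The matrix uses the inverse of \<open>\<sigma> a\<close> in
      \<open>Z_p\<close>, the brace uses \<open>\<sigma>\<close> at the additive inverse of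
      \<open>a\<close>; both invert \<open>\<sigma> a\<close>.\<close>
    have "(\<sigma> a * inv\<^bsub>Zp p\<^esub> (\<sigma> a)) mod int p = 1 mod int p"
      using Zp_inv[OF p] G.\<sigma>_char ma p_gt_1[OF p] by simp
    then have "((inv\<^bsub>Zp p\<^esub> (\<sigma> a) * \<tau> (a, lam B a)) mod int p * l) mod int p =
      (\<sigma> (inv\<^bsub>B\<^esub> a) * (\<tau> (a, lam B a) * l)) mod int p"
      using G.\<sigma>_char(6)[OF ma(3)] unfolding mod_eq_dvd_iff unfolding mod_unfold
      by Groebner_Basis.algebra
    then show "tri_map p B (inv\<^bsub>Zp p\<^esub> (\<sigma> a) \<otimes>\<^bsub>Zp p\<^esub> \<tau> (a, lam B a)) (\<lambda>_. \<zero>\<^bsub>Zp p\<^esub>) (lam B a) x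
        = lam G.C (m, a) x"
      using x ma by (simp add: G.lam_C tri_map_def Zp_carrier[OF p] Zp_ops[OF p])
  qed
  then have "G_sub p B \<sigma> \<tau> = {((m, a), lam G.C (m, a)) |m a. (m, a) \<in> carrier G.C}"
    unfolding G_sub_def G.C_simps Zp_carrier[OF p] by auto
  then show ?thesis
    by (auto simp: regular_of_brace_def)
qed

lemma G'_sub_eq: "G'_sub p B \<sigma> \<tau> = regular_of_brace (ext_brace p \<sigma> \<sigma> (\<lambda>a. \<tau> (a, lam B a)) B)"
proof -
  have "tri_map p B (\<tau> (a, lam B a)) (gam p \<sigma> (\<ominus>\<^bsub>Zp p\<^esub> (\<sigma> (inv\<^bsub>B\<^esub> a) \<otimes>\<^bsub>Zp p\<^esub> m))) (lam B a)
      = lam G'.C (m, a)"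
    if ma: "0 \<le> m" "m < int p" "a \<in> carrier B" for m a
  proof (rule extensionalityI)
    show "tri_map p B (\<tau> (a, lam B a)) (gam p \<sigma> (\<ominus>\<^bsub>Zp p\<^esub> (\<sigma> (inv\<^bsub>B\<^esub> a) \<otimes>\<^bsub>Zp p\<^esub> m))) (lam B a)
        \<in> extensional ({0..<int p} \<times> carrier B)"
      unfolding tri_map_def Zp_carrier[OF p] by (rule restrict_extensional)
    show "lam G'.C (m, a) \<in> extensional ({0..<int p} \<times> carrier B)"
      by (rule G'.lam_C_extensional)
    fix x assume "x \<in> {0..<int p} \<times> carrier B"
    then obtain l b where x: "x = (l, b)" "0 \<le> l" "l < int p" "b \<in> carrier B" by auto
    let ?j = "(- ((\<sigma> (inv\<^bsub>B\<^esub> a) * m) mod int p)) mod int p"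
    have "((\<tau> (a, lam B a) * l) mod int p + (?j - (\<sigma> b * ?j) mod int p) mod int p) mod int p =
      (\<sigma> (inv\<^bsub>B\<^esub> a) * (\<sigma> a * \<tau> (a, lam B a) * l + m * (\<sigma> b - 1))) mod int p"
      using G.\<sigma>_char(6)[OF ma(3)] unfolding mod_eq_dvd_iff unfolding mod_unfold
      by Groebner_Basis.algebra
    then show "tri_map p B (\<tau> (a, lam B a)) (gam p \<sigma> (\<ominus>\<^bsub>Zp p\<^esub> (\<sigma> (inv\<^bsub>B\<^esub> a) \<otimes>\<^bsub>Zp p\<^esub> m))) (lam B a) x
        = lam G'.C (m, a) x"
      using x ma by (simp add: G'.lam_C tri_map_def gam_def Zp_carrier[OF p] Zp_ops[OF p])
  qed
  then have "G'_sub p B \<sigma> \<tau> = {((m, a), lam G'.C (m, a)) |m a. (m, a) \<in> carrier G'.C}"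
    unfolding G'_sub_def G'.C_simps Zp_carrier[OF p] by auto
  then show ?thesis
    by (auto simp: regular_of_brace_def)
qed

end

context brace_extension
begin

lemma regular_C: "regular_subgroup A (regular_of_brace C)"
  using regular_of_brace_regular[OF skew_brace_C] regular_subgroup_additive_group[OF additive_ext_brace]
  by metis

lemma iso_regular_C:
  assumes "\<And>a. a \<in> carrier B \<Longrightarrow> \<tau> (a, lam B a) = t a"
  shows "(holomorph A)\<lparr>carrier := regular_of_brace C\<rparr> \<cong> Zp_semidirect p \<tau> (regular_group B)"
  using iso_set_trans[OF fst_iso_circ_group[OF skew_brace_C] iso_circ_C[OF assms]]
    holomorph_additive_group[OF additive_ext_brace[of p \<sigma> u t B]]
  by (auto simp: is_iso_def)

end

text \<open>Right multiplication by \<open>(0, b)\<close> keeps the first coordinate of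
  \<open>(1, \<one>)\<close> when \<open>u = 1\<close> and scales it by \<open>\<sigma> b\<close>
  when \<open>u = \<sigma>\<close>. An automorphism of the additive group sends
  \<open>(1, \<one>)\<close> to \<open>(\<alpha>, \<one>)\<close> and preserves
  \<open>\<sigma>\<close>, so an isomorphism of the two braces gives
  \<open>\<alpha> = \<sigma> b \<alpha>\<close>.\<close>

lemma not_conjugate_ext_brace:
  assumes p: "prime p" and B: "skew_brace B" and fin: "finite (carrier B)" and n: "\<not> p dvd order B"
    and \<sigma>: "\<sigma> \<in> brace_chars p B" and t: "t \<in> hom (circ_group B) (units_of (Zp p))"
    and conj: "conjugate_in (holomorph (Zp_semidirect p \<sigma> B))
      (regular_of_brace (ext_brace p \<sigma> (\<lambda>_. 1) t B)) (regular_of_brace (ext_brace p \<sigma> \<sigma> t B))"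
    and b: "b \<in> carrier B"
  shows "\<sigma> b = 1"
proof -
  interpret G: brace_extension p B \<sigma> "\<lambda>_. 1" t
    using p B \<sigma> brace_chars_one t by unfold_locales auto
  interpret G': brace_extension p B \<sigma> \<sigma> t
    using p B \<sigma> t by unfold_locales auto
  interpret B: group B by (rule skew_brace_group[OF B])
  obtain f where f: "f \<in> auto G.A" "f \<in> brace_iso G.C (brace_of_regular G.A (regular_of_brace G'.C))"
    using conjugate_regular(2)[OF G.group_A G.skew_brace_C additive_ext_brace conj] by blast
  have \<sigma>': "\<sigma> \<in> hom B (units_of (Zp p))" using \<sigma> by (simp add: brace_chars_def)
  obtain \<alpha> i \<mu> where \<alpha>: "0 < \<alpha>" "\<alpha> < int p" and i: "0 \<le> i" "i < int p" and \<mu>: "\<mu> \<in> auto B"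
    "\<And>a. a \<in> carrier B \<Longrightarrow> \<sigma> (\<mu> a) = \<sigma> a"
    and f_eq: "\<And>m a. 0 \<le> m \<Longrightarrow> m < int p \<Longrightarrow> a \<in> carrier B \<Longrightarrow>
      f (m, a) = ((\<alpha> * m + i * (1 - \<sigma> a)) mod int p, \<mu> a)"
    using auto_Zp_semidirect[OF p B.is_group \<sigma>' fin n f(1)] by blast
  have \<mu>_one: "\<mu> \<one>\<^bsub>B\<^esub> = \<one>\<^bsub>B\<^esub>" and \<mu>_closed: "\<mu> b \<in> carrier B"
    using \<mu> b by (auto simp: B.auto_one auto_closed)
  have one: "(1, \<one>\<^bsub>B\<^esub>) \<in> carrier G.C" "(0, b) \<in> carrier G.C"
    using p_gt_1[OF p] b by (simp_all add: G.C_simps)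
  have "f (circ G.C (1, \<one>\<^bsub>B\<^esub>) (0, b)) =
      circ (brace_of_regular G.A (regular_of_brace G'.C)) (f (1, \<one>\<^bsub>B\<^esub>)) (f (0, b))"
    by (rule brace_isoD(4)[OF f(2) one])
  also have "\<dots> = circ G'.C (f (1, \<one>\<^bsub>B\<^esub>)) (f (0, b))"
    using one auto_closed[OF f(1)] p_gt_1[OF p] b
    by (intro circ_brace_of_regular_of_brace[OF additive_ext_brace G'.skew_brace_C]) (simp_all add: G.A_simps)
  finally have "(\<alpha> + i * (1 - \<sigma> b)) mod int p = (\<sigma> b * \<alpha> + (i * (1 - \<sigma> b)) mod int p) mod int p"
    using p_gt_1[OF p] b \<alpha> \<mu>_closed
    by (simp add: circ_ext_brace f_eq circ_one[OF B] \<mu> \<mu>_one G.\<sigma>_char G.t_char)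
  then have "int p dvd \<alpha> * (\<sigma> b - 1)"
    unfolding mod_eq_dvd_iff unfolding mod_unfold by Groebner_Basis.algebra
  then have "int p dvd \<sigma> b - 1"
    using p not_dvd_residue[OF p \<alpha>] by (simp add: prime_dvd_mult_iff)
  then have "\<sigma> b mod int p = 1 mod int p" by (simp add: mod_eq_dvd_iff)
  then show ?thesis using G.\<sigma>_char(1,2)[OF b] p_gt_1[OF p] by simp
qed

section \<open>Quotients by \<open>Z\<^sub>p\<close>\<close>

lemma Zp_part_eq: "prime p \<Longrightarrow> Zp_part p B = {0..<int p} \<times> {\<one>\<^bsub>B\<^esub>}"
  by (simp add: Zp_part_def Zp_carrier)

lemma Zp_part_coset:
  fixes B :: "('a, 'm) monoid_scheme"
  assumes p: "prime p" and B: "group B" and \<sigma>: "\<sigma> \<in> hom B (units_of (Zp p))"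
    and m: "m \<in> {0..<int p}" and a: "a \<in> carrier B"
  shows "Zp_part p B #>\<^bsub>Zp_semidirect p \<sigma> B\<^esub> (m, a) = {0..<int p} \<times> {a}"
proof -
  interpret group B by (rule B)
  have "Zp_part p B #>\<^bsub>Zp_semidirect p \<sigma> B\<^esub> (m, a) = (\<lambda>k. ((k + m) mod int p, a)) ` {0..<int p}"
    using a by (auto simp: r_coset_def Zp_part_eq[OF p] Zp_semidirect_simps[OF p] hom_units_one[OF p B \<sigma>])
  also have "\<dots> = {0..<int p} \<times> {a}"
  proof (intro subset_antisym subsetI)
    fix x assume "x \<in> {0..<int p} \<times> {a}"
    then obtain k where x: "x = (k, a)" "0 \<le> k" "k < int p" by auto
    have "x = (((k - m) mod int p + m) mod int p, a)" using x by (simp add: mod_simps)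
    moreover have "(k - m) mod int p \<in> {0..<int p}" using p_gt_1[OF p] by simp
    ultimately show "x \<in> (\<lambda>k. ((k + m) mod int p, a)) ` {0..<int p}" by blast
  qed (use p_gt_1[OF p] in auto)
  finally show ?thesis .
qed

text \<open>Cosets of \<open>Z_p\<close> are the fibers of \<open>snd\<close>, so the quotient is
  the carrier of \<open>B\<close> with the product of \<open>B\<close> and a second operation
  \<open>star\<close>. It is not assumed to be \<open>circ B\<close>: the quotient is compared with
  \<open>B\<close> only through an isomorphism.\<close>

context
  fixes p :: nat and B :: "'a skew_brace" and \<sigma> :: "'a \<Rightarrow> int" and D :: "(int \<times> 'a) skew_brace"
    and star :: "'a \<Rightarrow> 'a \<Rightarrow> 'a"
  assumes p: "prime p" and B: "skew_brace B" and \<sigma>: "\<sigma> \<in> hom B (units_of (Zp p))"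
    and D: "skew_brace D" "additive_group_is D (Zp_semidirect p \<sigma> B)"
    and star: "\<And>x y. x \<in> carrier D \<Longrightarrow> y \<in> carrier D \<Longrightarrow> snd (circ D x y) = star (snd x) (snd y)"
begin

abbreviation (input) "fiber a \<equiv> {0..<int p} \<times> {a}"

lemma carrier_D: "carrier D = {0..<int p} \<times> carrier B"
  using D(2) by (simp add: additive_group_is_def Zp_semidirect_simps[OF p])

lemma star_closed:
  assumes "a \<in> carrier B" "b \<in> carrier B"
  shows "star a b \<in> carrier B"
proof -
  have "(0, a) \<in> carrier D" "(0, b) \<in> carrier D" using assms p_gt_1[OF p] by (simp_all add: carrier_D)
  from circ_closed[OF D(1) this] star[OF this] show ?thesis
    by (cases "circ D (0, a) (0, b)") (simp add: carrier_D)
qed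

lemma carrier_brace_quotient: "carrier (brace_quotient D (Zp_part p B)) = (\<lambda>a. fiber a) ` carrier B"
proof -
  have "carrier (brace_quotient D (Zp_part p B)) =
      (\<Union>x\<in>carrier D. {Zp_part p B #>\<^bsub>Zp_semidirect p \<sigma> B\<^esub> x})"
    using D(2) by (simp add: brace_quotient_def RCOSETS_def r_coset_def additive_group_is_def)
  also have "\<dots> = (\<lambda>x. fiber (snd x)) ` carrier D"
  proof -
    have "Zp_part p B #>\<^bsub>Zp_semidirect p \<sigma> B\<^esub> x = fiber (snd x)" if "x \<in> carrier D" for x
      using Zp_part_coset[OF p skew_brace_group[OF B] \<sigma>, of "fst x" "snd x"] that
      by (cases x) (simp add: carrier_D)
    then show ?thesis by blast
  qed
  also have "\<dots> = (\<lambda>a. fiber a) ` snd ` carrier D" by (simp add: image_image)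
  also have "snd ` carrier D = carrier B"
    using p_gt_1[OF p] by (simp add: carrier_D)
  finally show ?thesis .
qed

lemma mult_brace_quotient:
  assumes a: "a \<in> carrier B" and b: "b \<in> carrier B"
  shows "fiber a \<otimes>\<^bsub>brace_quotient D (Zp_part p B)\<^esub> fiber b = fiber (a \<otimes>\<^bsub>B\<^esub> b)"
    "circ (brace_quotient D (Zp_part p B)) (fiber a) (fiber b) = fiber (star a b)"
proof -
  have mult: "x \<otimes>\<^bsub>D\<^esub> y = x \<otimes>\<^bsub>Zp_semidirect p \<sigma> B\<^esub> y" for x y
    using D(2) by (simp add: additive_group_is_def)
  have "(\<Union>x\<in>fiber a. \<Union>y\<in>fiber b. {x \<otimes>\<^bsub>D\<^esub> y}) = fiber (a \<otimes>\<^bsub>B\<^esub> b)"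
  proof (intro subset_antisym subsetI)
    fix z assume "z \<in> fiber (a \<otimes>\<^bsub>B\<^esub> b)"
    then have "z = (fst z, a) \<otimes>\<^bsub>D\<^esub> (0, b)" "(fst z, a) \<in> fiber a" "(0, b) \<in> fiber b"
      using p_gt_1[OF p] by (auto simp: mult Zp_semidirect_simps[OF p])
    then show "z \<in> (\<Union>x\<in>fiber a. \<Union>y\<in>fiber b. {x \<otimes>\<^bsub>D\<^esub> y})" by blast
  qed (use p_gt_1[OF p] in \<open>auto simp: mult Zp_semidirect_simps[OF p]\<close>)
  then show "fiber a \<otimes>\<^bsub>brace_quotient D (Zp_part p B)\<^esub> fiber b = fiber (a \<otimes>\<^bsub>B\<^esub> b)"
    by (simp add: brace_quotient_def set_mult_def)
  have circ: "circ D x y \<in> fiber (star a b)" if "x \<in> fiber a" "y \<in> fiber b" for x y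
  proof -
    have xy: "x \<in> carrier D" "y \<in> carrier D" using that a b by (auto simp: carrier_D)
    then show ?thesis using circ_closed[OF D(1) xy] star[OF xy] that
      by (cases "circ D x y") (auto simp: carrier_D)
  qed
  have "(\<Union>x\<in>fiber a. \<Union>y\<in>fiber b. {circ D x y}) = fiber (star a b)"
  proof (intro subset_antisym subsetI)
    show "z \<in> fiber (star a b)" if "z \<in> (\<Union>x\<in>fiber a. \<Union>y\<in>fiber b. {circ D x y})" for z
      using that circ by auto
    have 0: "(0, a) \<in> fiber a" "(0, a) \<in> carrier D" using p_gt_1[OF p] a by (simp_all add: carrier_D)
    \<comment> \<open>A single left translation already fills the target fiber: it is injective, and
      both fibers have \<open>p\<close> elements.\<close>
    have "inj_on (circ D (0, a)) (fiber b)"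
      using circ_cancel[OF D(1) 0(2)] b by (auto simp: inj_on_def carrier_D)
    moreover have "circ D (0, a) ` fiber b \<subseteq> fiber (star a b)"
      using circ[OF 0(1)] by blast
    ultimately have "circ D (0, a) ` fiber b = fiber (star a b)"
      by (intro card_subset_eq) (simp_all add: card_image card_cartesian_product)
    then show "z \<in> (\<Union>x\<in>fiber a. \<Union>y\<in>fiber b. {circ D x y})" if "z \<in> fiber (star a b)" for z
    proof -
      have "z \<in> circ D (0, a) ` fiber b" using that \<open>circ D (0, a) ` fiber b = fiber (star a b)\<close> by simp
      then obtain y where "y \<in> fiber b" "z = circ D (0, a) y" by (rule imageE)
      then show ?thesis by (intro UN_I[OF 0(1)] UN_I[of y]) simp_all
    qed
  qed
  then show "circ (brace_quotient D (Zp_part p B)) (fiber a) (fiber b) = fiber (star a b)"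
    by (simp add: brace_quotient_def set_mult_def)
qed

lemma brace_quotient_isoI:
  assumes \<psi>: "bij_betw \<psi> (carrier B) (carrier B)"
    "\<And>a b. a \<in> carrier B \<Longrightarrow> b \<in> carrier B \<Longrightarrow> \<psi> (a \<otimes>\<^bsub>B\<^esub> b) = \<psi> a \<otimes>\<^bsub>B\<^esub> \<psi> b"
    "\<And>a b. a \<in> carrier B \<Longrightarrow> b \<in> carrier B \<Longrightarrow> \<psi> (star a b) = circ B (\<psi> a) (\<psi> b)"
  shows "\<exists>\<Psi>\<in>brace_iso (brace_quotient D (Zp_part p B)) B. \<forall>a. \<Psi> (fiber a) = \<psi> a"
proof -
  \<comment> \<open>A coset is a bare set; \<open>SOME\<close> picks a representative, and only its
    second component, the same for all of them, is used.\<close>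
  define \<Psi> where "\<Psi> = (\<lambda>X :: (int \<times> 'a) set. \<psi> (snd (SOME x. x \<in> X)))"
  have fiber: "\<Psi> (fiber a) = \<psi> a" for a
  proof -
    have "(0, a) \<in> fiber a" using p_gt_1[OF p] by simp
    then have "(SOME x. x \<in> fiber a) \<in> fiber a" by (rule someI)
    then show ?thesis by (auto simp: \<Psi>_def)
  qed
  have "\<Psi> \<in> brace_iso (brace_quotient D (Zp_part p B)) B"
  proof (rule brace_isoI)
    have "inj_on (\<lambda>a. fiber a) (carrier B)" using p_gt_1[OF p] by (auto simp: inj_on_def times_eq_iff)
    then have "bij_betw (\<lambda>a. fiber a) (carrier B) (carrier (brace_quotient D (Zp_part p B)))"
      by (simp add: bij_betw_def carrier_brace_quotient)
    moreover have "bij_betw (\<Psi> \<circ> (\<lambda>a. fiber a)) (carrier B) (carrier B)"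
      using \<psi>(1) by (simp add: comp_def fiber)
    ultimately show "bij_betw \<Psi> (carrier (brace_quotient D (Zp_part p B))) (carrier B)"
      using bij_betw_comp_iff by blast
  qed (auto simp: carrier_brace_quotient mult_brace_quotient fiber \<psi>)
  then show ?thesis using fiber by blast
qed

lemma brace_quotient_isoD:
  assumes \<psi>: "\<psi> \<in> brace_iso (brace_quotient D (Zp_part p B)) B"
  shows "bij_betw (\<lambda>a. \<psi> (fiber a)) (carrier B) (carrier B)"
    "\<And>a b. a \<in> carrier B \<Longrightarrow> b \<in> carrier B \<Longrightarrow>
      \<psi> (fiber (a \<otimes>\<^bsub>B\<^esub> b)) = \<psi> (fiber a) \<otimes>\<^bsub>B\<^esub> \<psi> (fiber b)"
    "\<And>a b. a \<in> carrier B \<Longrightarrow> b \<in> carrier B \<Longrightarrow>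
      \<psi> (fiber (star a b)) = circ B (\<psi> (fiber a)) (\<psi> (fiber b))"
proof -
  have "inj_on (\<lambda>a. fiber a) (carrier B)" using p_gt_1[OF p] by (auto simp: inj_on_def times_eq_iff)
  then have "bij_betw (\<lambda>a. fiber a) (carrier B) (carrier (brace_quotient D (Zp_part p B)))"
    by (simp add: bij_betw_def carrier_brace_quotient)
  from bij_betw_trans[OF this brace_isoD(1)[OF \<psi>]]
  show "bij_betw (\<lambda>a. \<psi> (fiber a)) (carrier B) (carrier B)" by (simp add: comp_def)
  fix a b assume ab: "a \<in> carrier B" "b \<in> carrier B"
  then have "fiber a \<in> carrier (brace_quotient D (Zp_part p B))"
    "fiber b \<in> carrier (brace_quotient D (Zp_part p B))" by (auto simp: carrier_brace_quotient)
  from brace_isoD(3,4)[OF \<psi> this]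
  show "\<psi> (fiber (a \<otimes>\<^bsub>B\<^esub> b)) = \<psi> (fiber a) \<otimes>\<^bsub>B\<^esub> \<psi> (fiber b)"
    "\<psi> (fiber (star a b)) = circ B (\<psi> (fiber a)) (\<psi> (fiber b))"
    using ab by (simp_all add: mult_brace_quotient)
qed

end

text \<open>The conjugation gives an automorphism \<open>f\<close> of \<open>A\<close>, with
  diagonal part \<open>\<mu>\<close> on \<open>E\<close>. The required \<open>\<psi>\<close> is
  induced by \<open>\<nu> = \<mu>^-1\<close>, which preserves \<open>\<sigma>\<close>;
  \<open>\<Theta>\<close> is \<open>f^-1\<close> followed by the map of \<open>iso_circ_C\<close>.
  Both act on second components by \<open>\<nu>\<close>, which is their compatibility.\<close>

lemma conjugate_imp_in_class:
  assumes p: "prime p" and B: "skew_brace B" and fin: "finite (carrier B)" and n: "\<not> p dvd order B"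
    and ext: "brace_extension p B \<sigma> u (\<lambda>a. \<tau> (a, lam B a))"
    and conj: "conjugate_in (holomorph (Zp_semidirect p \<sigma> B))
      (regular_of_brace (ext_brace p \<sigma> u (\<lambda>a. \<tau> (a, lam B a)) B)) R"
  shows "regular_subgroup (Zp_semidirect p \<sigma> B) R" "in_class p B \<sigma> \<tau> R"
proof -
  interpret brace_extension p B \<sigma> u "\<lambda>a. \<tau> (a, lam B a)" by (rule ext)
  interpret B: group B by (rule skew_brace_group[OF B])
  show R: "regular_subgroup A R"
    by (rule conjugate_regular(1)[OF group_A skew_brace_C additive_ext_brace conj])
  let ?D = "brace_of_regular A R"
  obtain f where f: "f \<in> auto A" "f \<in> brace_iso C ?D"
    using conjugate_regular(2)[OF group_A skew_brace_C additive_ext_brace conj] by blast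
  have D: "skew_brace ?D" "regular_of_brace ?D = R" "additive_group_is ?D A"
    using brace_of_regular[OF group_A R] additive_brace_of_regular by auto
  have \<sigma>': "\<sigma> \<in> hom B (units_of (Zp p))" using \<sigma> by (simp add: brace_chars_def)
  obtain \<alpha> i \<mu> where \<alpha>: "0 < \<alpha>" "\<alpha> < int p" and i: "0 \<le> i" "i < int p" and \<mu>: "\<mu> \<in> auto B"
    "\<And>a. a \<in> carrier B \<Longrightarrow> \<sigma> (\<mu> a) = \<sigma> a"
    and f_eq: "\<And>m a. 0 \<le> m \<Longrightarrow> m < int p \<Longrightarrow> a \<in> carrier B \<Longrightarrow>
      f (m, a) = ((\<alpha> * m + i * (1 - \<sigma> a)) mod int p, \<mu> a)"
    using auto_Zp_semidirect[OF p B.is_group \<sigma>' fin n f(1)] by blast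
  define \<nu> where "\<nu> = inv\<^bsub>AutoGroup B\<^esub> \<mu>"
  have \<nu>: "\<nu> \<in> auto B" and \<nu>\<mu>: "\<And>a. a \<in> carrier B \<Longrightarrow> \<nu> (\<mu> a) = a"
    and \<mu>\<nu>: "\<And>a. a \<in> carrier B \<Longrightarrow> \<mu> (\<nu> a) = a"
    unfolding \<nu>_def using B.auto_inv_apply[OF \<mu>(1)] B.one_closed by blast+
  have \<nu>_closed: "\<nu> a \<in> carrier B" if "a \<in> carrier B" for a using \<nu> that by (rule auto_closed)
  let ?g = "inv_into (carrier C) f"
  have carrier: "carrier C = carrier A" "carrier ?D = carrier A" "carrier A = {0..<int p} \<times> carrier B"
    by (simp_all add: C_simps A_simps brace_of_regular_def)
  have bij: "bij_betw f (carrier C) (carrier C)" using auto_bij[OF f(1)] carrier by simp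
  have g: "?g x \<in> carrier C" "f (?g x) = x" if "x \<in> carrier C" for x
    using bij that inv_into_into[of x f "carrier C"] by (auto simp: bij_betw_def f_inv_into_f)
  have snd_f: "snd (f x) = \<mu> (snd x)" if "x \<in> carrier C" for x
    using that f_eq[of "fst x" "snd x"] by (cases x) (auto simp: C_simps)
  have snd_g: "snd (?g x) = \<nu> (snd x)" if "x \<in> carrier C" for x
    using snd_f[OF g(1)[OF that]] g[OF that] \<nu>\<mu>[of "snd (?g x)"] by (auto simp: C_simps)
  have snd_circ: "snd (circ C x y) = circ B (snd x) (snd y)" for x y
    by (cases x; cases y) (simp add: circ_ext_brace)
  \<comment> \<open>The multiplication that the conjugated brace induces on \<open>E\<close>: that
    of \<open>B\<close>, moved by \<open>\<mu>\<close>.\<close>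
  define star where "star = (\<lambda>a b. \<mu> (circ B (\<nu> a) (\<nu> b)))"
  have star: "snd (circ ?D x y) = star (snd x) (snd y)" if "x \<in> carrier ?D" "y \<in> carrier ?D" for x y
  proof -
    have xy: "x \<in> carrier C" "y \<in> carrier C" using that carrier by auto
    have "circ ?D x y = f (circ C (?g x) (?g y))"
      using brace_isoD(4)[OF f(2) g(1)[OF xy(1)] g(1)[OF xy(2)]] g(2) xy by simp
    then show ?thesis
      using snd_f[OF circ_closed[OF skew_brace_C g(1)[OF xy(1)] g(1)[OF xy(2)]]] xy
      by (simp add: snd_circ snd_g star_def)
  qed
  have \<nu>_star: "\<nu> (star a b) = circ B (\<nu> a) (\<nu> b)" if "a \<in> carrier B" "b \<in> carrier B" for a b
    using that \<nu>\<mu> \<nu>_closed circ_closed[OF B] by (simp add: star_def)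
  have "\<exists>\<Psi>\<in>brace_iso (brace_quotient ?D (Zp_part p B)) B. \<forall>a. \<Psi> ({0..<int p} \<times> {a}) = \<nu> a"
    by (rule brace_quotient_isoI[OF p B \<sigma>' D(1,3) star auto_bij[OF \<nu>] auto_mult[OF \<nu>] \<nu>_star])
  then obtain \<Psi> where \<Psi>: "\<Psi> \<in> brace_iso (brace_quotient ?D (Zp_part p B)) B"
    "\<And>a. \<Psi> ({0..<int p} \<times> {a}) = \<nu> a" by blast
  let ?\<Theta> = "(\<lambda>(m, a). ((u (inv\<^bsub>B\<^esub> a) * m) mod int p, (a, lam B a))) \<circ> (?g \<circ> fst)"
  have fst: "fst \<in> iso ((holomorph A)\<lparr>carrier := R\<rparr>) (circ_group ?D)"
    using fst_iso_circ_group[OF D(1)] D(2) holomorph_additive_group[OF D(3)] by simp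
  have g_iso: "?g \<in> iso (circ_group ?D) (circ_group C)"
    using brace_iso_inv[OF skew_brace_C f(2)] by (simp add: brace_iso_def)
  have \<Theta>: "?\<Theta> \<in> iso ((holomorph A)\<lparr>carrier := R\<rparr>) (Zp_semidirect p \<tau> (regular_group B))"
    by (rule iso_set_trans[OF iso_set_trans[OF fst g_iso] iso_circ_C]) (rule refl)
  have coset: "\<Psi> (Zp_part p B #>\<^bsub>A\<^esub> x) = \<nu> (snd x)" if "x \<in> carrier C" for x
    using Zp_part_coset[OF p B.is_group \<sigma>', of "fst x" "snd x"] that \<Psi>(2) by (cases x) (auto simp: C_simps)
  show "in_class p B \<sigma> \<tau> R"
    unfolding in_class_def
  proof (intro bexI[OF _ \<Theta>] bexI[of _ \<Psi>] conjI ballI allI impI)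
    show "\<Psi> \<in> brace_iso (quotient_of_regular p B \<sigma> R) B"
      using \<Psi>(1) by (simp add: quotient_of_regular_def)
    show "\<sigma> (\<Psi> (Zp_part p B #>\<^bsub>A\<^esub> (m, a))) = \<sigma> a"
      if "m \<in> carrier (Zp p)" "a \<in> carrier B" for m a
      using coset[of "(m, a)"] that \<mu>(2)[of "\<nu> a"] \<mu>\<nu> \<nu>_closed by (simp add: C_simps Zp_carrier[OF p])
    fix x h assume "(x, h) \<in> R"
    then have "x \<in> carrier C" using regular_subset[OF group_A R] carrier by auto
    then show "let b = \<Psi> (Zp_part p B #>\<^bsub>A\<^esub> x) in snd (?\<Theta> (x, h)) = (b, lam B b)"
      using snd_g[of x] coset[of x] by (auto simp: Let_def split: prod.split)
  qed
qed

section \<open>Automorphisms of order \<open>p\<close>\<close>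

text \<open>The hypothesis on groups of a given order is quantified over groups on
  \<open>nat\<close>. A finite group on any type is copied there along an enumeration, and the
  normal subgroup is carried back.\<close>

lemma normal_subgroup_transfer:
  fixes K :: "('k, 'm) monoid_scheme"
  assumes nat: "\<And>H :: nat monoid. group H \<Longrightarrow> order H = k \<Longrightarrow> \<exists>N. N \<lhd> H \<and> card N = p"
    and K: "group K" "finite (carrier K)" "order K = k"
  obtains N where "N \<lhd> K" "card N = p"
proof -
  interpret group K by fact
  obtain h where h: "bij_betw h (carrier K) {0..<card (carrier K)}"
    using ex_bij_betw_finite_nat[OF K(2)] by blast
  define g where "g = inv_into (carrier K) h"
  have gh: "g (h x) = x" if "x \<in> carrier K" for x
    using h that by (simp add: g_def bij_betw_def)
  \<comment> \<open>\<open>H\<close> is only a frame for \<open>hom_imp_img_group\<close>: the group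
    is the image \<open>?H\<close> of \<open>K\<close>, whose identity replaces the placeholder
    \<open>0\<close>.\<close>
  define H :: "nat monoid" where "H = \<lparr>carrier = UNIV, monoid.mult = \<lambda>x y. h (g x \<otimes>\<^bsub>K\<^esub> g y), one = 0\<rparr>"
  let ?H = "H\<lparr>carrier := h ` carrier K, one := h \<one>\<^bsub>K\<^esub>\<rparr>"
  have "h \<in> hom K H" by (simp add: hom_def H_def gh)
  then have H: "group ?H" by (rule hom_imp_img_group)
  have iso: "h \<in> iso K ?H"
    using h by (auto simp: iso_def hom_def bij_betw_def gh H_def)
  have "order ?H = k"
    using K(3) h by (simp add: order_def bij_betw_def card_image)
  then obtain N where N: "N \<lhd> ?H" "card N = p" using nat[OF H] by blast
  have iso': "inv_into (carrier K) h \<in> iso ?H K" by (rule iso_set_sym[OF iso])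
  have "inv_into (carrier K) h ` N \<lhd> K"
    by (rule iso_normal_subgroup[OF iso' H K(1) N(1)])
  moreover have "N \<subseteq> carrier ?H"
    by (rule subgroup.subset[OF normal_imp_subgroup[OF N(1)]])
  then have "inj_on (inv_into (carrier K) h) N"
    using h by (intro inj_on_inv_into) auto
  ultimately show ?thesis using that N(2) by (simp add: card_image)
qed

text \<open>If \<open>\<phi>\<close> were an automorphism of order \<open>p\<close>, a normal subgroup of order \<open>p\<close> of \<open>E \<rtimes> \<langle>\<phi>\<rangle>\<close> would
  centralize \<open>E\<close>, so some non-trivial power of \<open>\<phi>\<close> would be inner and have order dividing \<open>|E|\<close>.\<close>

lemma no_automorphism_of_order_p:
  fixes E :: "('a, 'm) monoid_scheme"
  assumes p: "prime p" and E: "group E" and fin: "finite (carrier E)" and n: "\<not> p dvd order E"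
    and nat: "\<And>H :: nat monoid. group H \<Longrightarrow> order H = order E * p \<Longrightarrow> \<exists>N. N \<lhd> H \<and> card N = p"
    and \<phi>: "\<phi> \<in> auto E" "\<phi> [^]\<^bsub>AutoGroup E\<^esub> p = \<one>\<^bsub>AutoGroup E\<^esub>"
  shows "\<phi> = \<one>\<^bsub>AutoGroup E\<^esub>"
proof (rule ccontr)
  assume \<phi>_ne: "\<phi> \<noteq> \<one>\<^bsub>AutoGroup E\<^esub>"
  interpret E: group E by fact
  interpret Aut: group "AutoGroup E" by (rule E.AutoGroup)
  interpret Hol: group "holomorph E" by (rule E.group_holomorph)
  note [simp del] = one_AutoGroup
  have one_Hol: "\<one>\<^bsub>holomorph E\<^esub> = (\<one>\<^bsub>E\<^esub>, \<one>\<^bsub>AutoGroup E\<^esub>)" by (simp add: one_AutoGroup)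
  have \<phi>': "\<phi> \<in> carrier (AutoGroup E)" using \<phi> by simp
  have ord: "Aut.ord \<phi> = p"
    using Aut.pow_eq_id[OF \<phi>', of p] Aut.ord_eq_1[OF \<phi>'] \<phi>(2) \<phi>_ne p by (metis prime_nat_iff)
  \<comment> \<open>\<open>carrier E \<times> P\<close> inside the holomorph is
    \<open>E \<rtimes> \<langle>\<phi>\<rangle>\<close>, of order \<open>|E| p\<close>.\<close>
  define P where "P = generate (AutoGroup E) {\<phi>}"
  have P: "subgroup P (AutoGroup E)" unfolding P_def using \<phi>' by (intro Aut.generate_is_subgroup) simp
  have card_P: "card P = p" unfolding P_def using Aut.generate_pow_card[OF \<phi>'] ord by simp
  have P_auto: "f \<in> auto E" if "f \<in> P" for f using subgroup.subset[OF P] that by auto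
  have P_pow: "f [^]\<^bsub>AutoGroup E\<^esub> p = \<one>\<^bsub>AutoGroup E\<^esub>" if f: "f \<in> P" for f
  proof -
    obtain k :: nat where "f = \<phi> [^]\<^bsub>AutoGroup E\<^esub> k"
      using f Aut.generate_pow_nat[OF \<phi>'] ord p unfolding P_def by auto
    then show ?thesis using \<phi> \<phi>' Aut.nat_pow_pow[OF \<phi>'] by (metis Aut.nat_pow_one mult.commute)
  qed
  have H: "subgroup (carrier E \<times> P) (holomorph E)"
  proof (rule Hol.subgroupI)
    show "carrier E \<times> P \<noteq> {}" using subgroup.one_closed[OF P] by auto
    fix x y assume x: "x \<in> carrier E \<times> P" and y: "y \<in> carrier E \<times> P"
    show "x \<otimes>\<^bsub>holomorph E\<^esub> y \<in> carrier E \<times> P"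
      using x y P_auto subgroup.m_closed[OF P] by (auto simp: auto_closed)
  next
    fix x assume x: "x \<in> carrier E \<times> P"
    then have xH: "x \<in> carrier (holomorph E)" using P_auto by auto
    obtain a f where a: "x = (a, f)" by fastforce
    obtain b g where b: "inv\<^bsub>holomorph E\<^esub> x = (b, g)" by fastforce
    have bg: "b \<in> carrier E" "g \<in> auto E" using Hol.inv_closed[OF xH] b by auto
    have "g \<otimes>\<^bsub>AutoGroup E\<^esub> f = \<one>\<^bsub>AutoGroup E\<^esub>"
      using Hol.l_inv[OF xH] b a by (simp add: one_AutoGroup)
    then have "inv\<^bsub>AutoGroup E\<^esub> f = g"
      using bg x P_auto a by (intro Aut.inv_equality) auto
    then show "inv\<^bsub>holomorph E\<^esub> x \<in> carrier E \<times> P"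
      using b bg subgroup.m_inv_closed[OF P] x a by auto
  qed (use P_auto in auto)
  let ?H = "(holomorph E)\<lparr>carrier := carrier E \<times> P\<rparr>"
  have group_H: "group ?H" by (rule Hol.subgroup_imp_group[OF H])
  have "finite P" using card_P p by (metis card.infinite not_prime_0)
  then obtain N where N: "N \<lhd> ?H" "card N = p"
    using normal_subgroup_transfer[OF nat group_H] fin card_P
    by (auto simp: order_def card_cartesian_product)
  have subN: "subgroup N (holomorph E)"
    using Hol.incl_subgroup[OF H] N(1) by (simp add: normal_def)
  have N_sub: "N \<subseteq> carrier E \<times> P" using N(1) subgroup.subset[of N ?H] by (simp add: normal_def)
  have conj_N: "y \<otimes>\<^bsub>holomorph E\<^esub> x \<otimes>\<^bsub>holomorph E\<^esub> inv\<^bsub>holomorph E\<^esub> y \<in> N"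
    if "x \<in> N" "y \<in> carrier E \<times> P" for x y
    using normal.inv_op_closed2[OF N(1), of y x] that Hol.m_inv_consistent[OF H, of y] by simp
  have pow_fst: "(e, \<one>\<^bsub>AutoGroup E\<^esub>) [^]\<^bsub>holomorph E\<^esub> (k :: nat) = (e [^]\<^bsub>E\<^esub> k, \<one>\<^bsub>AutoGroup E\<^esub>)"
    if "e \<in> carrier E" for e k
  proof (induction k)
    have "\<one>\<^bsub>AutoGroup E\<^esub> e = e" using that by (simp add: one_AutoGroup)
    then show "(e, \<one>\<^bsub>AutoGroup E\<^esub>) [^]\<^bsub>holomorph E\<^esub> Suc k = (e [^]\<^bsub>E\<^esub> Suc k, \<one>\<^bsub>AutoGroup E\<^esub>)"
      if "(e, \<one>\<^bsub>AutoGroup E\<^esub>) [^]\<^bsub>holomorph E\<^esub> k = (e [^]\<^bsub>E\<^esub> k, \<one>\<^bsub>AutoGroup E\<^esub>)" for k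
      using that Aut.r_one[OF Aut.one_closed] by simp
  qed (simp add: one_Hol del: one_holomorph)
  have N_fst: "e = \<one>\<^bsub>E\<^esub>" if e: "(e, \<one>\<^bsub>AutoGroup E\<^esub>) \<in> N" for e
  proof -
    interpret N: group "(holomorph E)\<lparr>carrier := N\<rparr>" by (rule Hol.subgroup_imp_group[OF subN])
    have "finite N" using N(2) p by (metis card.infinite not_prime_0)
    then have "(e, \<one>\<^bsub>AutoGroup E\<^esub>) [^]\<^bsub>(holomorph E)\<lparr>carrier := N\<rparr>\<^esub> p = \<one>\<^bsub>holomorph E\<^esub>"
      using N.pow_order_eq_1[of "(e, \<one>\<^bsub>AutoGroup E\<^esub>)"] e N(2) by (simp add: order_def)
    then have "(e, \<one>\<^bsub>AutoGroup E\<^esub>) [^]\<^bsub>holomorph E\<^esub> p = \<one>\<^bsub>holomorph E\<^esub>"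
      using Hol.nat_pow_consistent by metis
    then have "e [^]\<^bsub>E\<^esub> p = \<one>\<^bsub>E\<^esub>" using pow_fst e N_sub by auto
    then show ?thesis using E.pow_p_eq_one[OF p n] e N_sub by auto
  qed
  have "\<not> N \<subseteq> {\<one>\<^bsub>holomorph E\<^esub>}"
    using card_mono[of "{\<one>\<^bsub>holomorph E\<^esub>}" N] N(2) prime_gt_1_nat[OF p] by auto
  then obtain e f where ef: "(e, f) \<in> N" "f \<noteq> \<one>\<^bsub>AutoGroup E\<^esub>"
    using N_fst one_Hol by fastforce
  have e: "e \<in> carrier E" and f: "f \<in> P" "f \<in> auto E" using ef N_sub P_auto by auto
  \<comment> \<open>The commutator of \<open>(b, 1)\<close> and \<open>(e, f)\<close> lies in
    \<open>N\<close> by normality and has trivial automorphism part, so \<open>N_fst\<close> makes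
    it trivial: \<open>f\<close> is conjugation by \<open>e^-1\<close>.\<close>
  have inner: "e \<otimes>\<^bsub>E\<^esub> f b = b \<otimes>\<^bsub>E\<^esub> e" if b: "b \<in> carrier E" for b
  proof -
    let ?x = "(e, f)" and ?y = "(b, \<one>\<^bsub>AutoGroup E\<^esub>)"
    have y: "?y \<in> carrier (holomorph E)" "?y \<in> carrier E \<times> P"
      using b subgroup.one_closed[OF P] Aut.one_closed by auto
    have x: "?x \<in> carrier (holomorph E)" using e f by simp
    obtain e' f' where x': "?y \<otimes>\<^bsub>holomorph E\<^esub> ?x \<otimes>\<^bsub>holomorph E\<^esub> inv\<^bsub>holomorph E\<^esub> ?y = (e', f')"
      by fastforce
    have x'N: "(e', f') \<in> N" using conj_N[OF ef(1) y(2)] x' by simp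
    then have x'H: "(e', f') \<in> carrier (holomorph E)" using N_sub P_auto by auto
    have "(e', f') \<otimes>\<^bsub>holomorph E\<^esub> ?y = ?y \<otimes>\<^bsub>holomorph E\<^esub> ?x"
      unfolding x'[symmetric] using x y
      by (simp add: Hol.m_assoc del: carrier_holomorph mult_holomorph one_holomorph)
    then have f': "f' = f" and e': "e' \<otimes>\<^bsub>E\<^esub> f b = b \<otimes>\<^bsub>E\<^esub> e"
      using x'H f e by (auto simp: one_AutoGroup[of E] Aut.r_one[unfolded one_AutoGroup] Aut.l_one[unfolded one_AutoGroup])
    obtain c g where z: "(e', f') \<otimes>\<^bsub>holomorph E\<^esub> inv\<^bsub>holomorph E\<^esub> ?x = (c, g)" by fastforce
    have zN: "(c, g) \<in> N"
      using subgroup.m_closed[OF subN x'N subgroup.m_inv_closed[OF subN ef(1)]] z by simp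
    then have cg: "c \<in> carrier E" "g \<in> auto E" using N_sub P_auto by auto
    have "(c, g) \<otimes>\<^bsub>holomorph E\<^esub> ?x = (e', f')"
      unfolding z[symmetric] using x x'H
      by (simp add: Hol.m_assoc del: carrier_holomorph mult_holomorph one_holomorph)
    then have gf: "g \<otimes>\<^bsub>AutoGroup E\<^esub> f = f" and ce: "c \<otimes>\<^bsub>E\<^esub> g e = e'" using f' by auto
    have "g = \<one>\<^bsub>AutoGroup E\<^esub>" using gf cg f Aut.r_cancel_one'[of f g] by simp
    then have "c = \<one>\<^bsub>E\<^esub>" "g e = e" using N_fst zN e by (auto simp: one_AutoGroup)
    then have "e' = e" using ce e by simp
    then show ?thesis using e' by simp
  qed
  have f_pow: "(f [^]\<^bsub>AutoGroup E\<^esub> (k :: nat)) b = inv\<^bsub>E\<^esub> (e [^]\<^bsub>E\<^esub> k) \<otimes>\<^bsub>E\<^esub> b \<otimes>\<^bsub>E\<^esub> e [^]\<^bsub>E\<^esub> k"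
    if "b \<in> carrier E" for b k
    using that
  proof (induction k arbitrary: b)
    case 0
    then show ?case by (simp add: one_AutoGroup)
  next
    case (Suc k)
    have fb: "f b \<in> carrier E" "f b = inv\<^bsub>E\<^esub> e \<otimes>\<^bsub>E\<^esub> (b \<otimes>\<^bsub>E\<^esub> e)"
      using f e Suc.prems inner[OF Suc.prems] by (auto simp: auto_closed E.inv_solve_left)
    have fk: "f [^]\<^bsub>AutoGroup E\<^esub> k \<in> auto E"
      using Aut.nat_pow_closed[of f k] f by simp
    have "(f [^]\<^bsub>AutoGroup E\<^esub> Suc k) b = (f [^]\<^bsub>AutoGroup E\<^esub> k) (f b)"
      using fk f Suc.prems by (simp add: mult_AutoGroup_apply)
    also have "\<dots> = inv\<^bsub>E\<^esub> (e [^]\<^bsub>E\<^esub> k) \<otimes>\<^bsub>E\<^esub> (inv\<^bsub>E\<^esub> e \<otimes>\<^bsub>E\<^esub> (b \<otimes>\<^bsub>E\<^esub> e)) \<otimes>\<^bsub>E\<^esub> e [^]\<^bsub>E\<^esub> k"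
      using Suc.IH[OF fb(1)] fb(2) by simp
    also have "\<dots> = inv\<^bsub>E\<^esub> (e [^]\<^bsub>E\<^esub> Suc k) \<otimes>\<^bsub>E\<^esub> b \<otimes>\<^bsub>E\<^esub> e [^]\<^bsub>E\<^esub> Suc k"
      unfolding E.nat_pow_Suc2[OF e] using e Suc.prems by (simp add: E.inv_mult_group E.m_assoc)
    finally show ?case .
  qed
  \<comment> \<open>The power of \<open>e\<close> with exponent \<open>|E|\<close> is trivial, so
    the order of \<open>f\<close> divides \<open>|E|\<close> as well as \<open>p\<close>.\<close>
  have "f [^]\<^bsub>AutoGroup E\<^esub> order E = \<one>\<^bsub>AutoGroup E\<^esub>"
  proof (rule auto_eqI)
    show "f [^]\<^bsub>AutoGroup E\<^esub> order E \<in> auto E" using Aut.nat_pow_closed[of f "order E"] f by simp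
    show "\<one>\<^bsub>AutoGroup E\<^esub> \<in> auto E" using Aut.one_closed by simp
    show "(f [^]\<^bsub>AutoGroup E\<^esub> order E) x = \<one>\<^bsub>AutoGroup E\<^esub> x" if "x \<in> carrier E" for x
      using f_pow[OF that, of "order E"] E.pow_order_eq_1[of e] e that fin by (simp add: one_AutoGroup)
  qed
  then have "Aut.ord f dvd order E" "Aut.ord f dvd p"
    using Aut.pow_eq_id[of f] P_pow[OF f(1)] f by auto
  then have "Aut.ord f = 1" using n p by (metis prime_nat_iff)
  then show False using Aut.ord_eq_1[of f] f ef(2) by simp
qed

text \<open>By Fermat \<open>a^p = a\<close>: the unit group of \<open>Z_p\<close> has no element of
  order \<open>p\<close>. This handles the scalar by which \<open>lam\<close> acts on
  \<open>Z_p\<close>.\<close>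

lemma fermat_residue:
  assumes p: "prime p" and a: "0 < a" "a < int p" and pow: "(a ^ p) mod int p = 1"
  shows "a = 1"
proof -
  have "\<not> p dvd nat a" using a p by (auto dest!: dvd_imp_le)
  then have "[nat a ^ (p - 1) = 1] (mod p)" by (rule fermat_theorem[OF p])
  then have "[int (nat a ^ (p - 1)) = int 1] (mod int p)" by (simp only: cong_int_iff)
  then have "(a ^ (p - 1)) mod int p = 1" using a p_gt_1[OF p] by (simp add: cong_def)
  moreover have "a ^ p = a * a ^ (p - 1)" using prime_gt_0_nat[OF p] power_Suc[of a "p - 1"] by simp
  ultimately have "(a ^ p) mod int p = a mod int p"
    by (metis mod_mult_right_eq mult.right_neutral)
  then show ?thesis using a pow by simp
qed

section \<open>Braces with additive group \<open>Z\<^sub>p \<rtimes> E\<close>\<close>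

text \<open>\<open>D\<close> is any brace on \<open>Z_p \<rtimes> E\<close>, and no brace structure
  on \<open>E\<close> is given: it is produced as \<open>star\<close> and meets \<open>B\<close>
  only in \<open>iso_ext_brace\<close>. \<open>no_aut\<close> and \<open>normal\<close> are the two
  consequences of the hypothesis on groups of order \<open>n p\<close>.\<close>

locale Zp_brace =
  fixes p :: nat and E :: "('a, 'm) monoid_scheme" and \<sigma> :: "'a \<Rightarrow> int"
    and D :: "(int \<times> 'a) skew_brace"
  assumes p: "prime p" and E: "group E" and fin: "finite (carrier E)" and n: "\<not> p dvd order E"
    and \<sigma>: "\<sigma> \<in> hom E (units_of (Zp p))"
    and D: "skew_brace D" and DA: "additive_group_is D (Zp_semidirect p \<sigma> E)"
    and no_aut: "\<And>\<phi>. \<phi> \<in> auto E \<Longrightarrow> \<phi> [^]\<^bsub>AutoGroup E\<^esub> p = \<one>\<^bsub>AutoGroup E\<^esub> \<Longrightarrow> \<phi> = \<one>\<^bsub>AutoGroup E\<^esub>"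
    and normal: "\<exists>P. P \<lhd> circ_group D \<and> card P = p"
begin

interpretation E: group E by (rule E)
interpretation D: group D by (rule skew_brace_group[OF D])
interpretation circ: group "circ_group D" by (rule skew_brace_circ_group[OF D])

abbreviation "A \<equiv> Zp_semidirect p \<sigma> E"

lemmas A_simps = Zp_semidirect_simps[OF p]

lemma D_simps: "carrier D = {0..<int p} \<times> carrier E"
  "(m, a) \<otimes>\<^bsub>D\<^esub> (m', b) = ((m + \<sigma> a * m') mod int p, a \<otimes>\<^bsub>E\<^esub> b)"
  "\<one>\<^bsub>D\<^esub> = (0, \<one>\<^bsub>E\<^esub>)"
  using DA A_simps[of \<sigma> E] by (simp_all add: additive_group_is_def)

lemma \<sigma>_char: "a \<in> carrier E \<Longrightarrow> 0 < \<sigma> a" "a \<in> carrier E \<Longrightarrow> \<sigma> a < int p"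
  "a \<in> carrier E \<Longrightarrow> b \<in> carrier E \<Longrightarrow> \<sigma> (a \<otimes>\<^bsub>E\<^esub> b) = (\<sigma> a * \<sigma> b) mod int p" "\<sigma> \<one>\<^bsub>E\<^esub> = 1"
  using \<sigma> hom_units_one[OF p E \<sigma>] unfolding hom_units_iff[OF p] by blast+

lemma char_not_one_dvd:
  assumes "c \<in> carrier E" "\<sigma> c \<noteq> 1"
  shows "\<not> int p dvd 1 - \<sigma> c"
proof
  assume "int p dvd 1 - \<sigma> c"
  then have "1 mod int p = \<sigma> c mod int p" by (simp add: mod_eq_dvd_iff)
  then show False using assms \<sigma>_char(1,2)[OF assms(1)] p_gt_1[OF p] by simp
qed

lemma lam_triangular:
  assumes x: "x \<in> carrier D"
  obtains \<alpha> i \<mu> where "0 < \<alpha>" "\<alpha> < int p" "0 \<le> i" "i < int p" "\<mu> \<in> auto E"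
    "\<And>a. a \<in> carrier E \<Longrightarrow> \<sigma> (\<mu> a) = \<sigma> a"
    "\<And>m a. 0 \<le> m \<Longrightarrow> m < int p \<Longrightarrow> a \<in> carrier E \<Longrightarrow>
      lam D x (m, a) = ((\<alpha> * m + i * (1 - \<sigma> a)) mod int p, \<mu> a)"
proof -
  have "lam D x \<in> auto A" using lam_auto[OF D x] auto_additive_group[OF DA] by simp
  then show ?thesis using auto_Zp_semidirect[OF p E \<sigma> fin n] that by blast
qed

lemma lam_circ_pow:
  assumes x: "x \<in> carrier D"
  shows "lam D (x [^]\<^bsub>circ_group D\<^esub> (k :: nat)) = lam D x [^]\<^bsub>AutoGroup D\<^esub> k"
proof (induction k)
  case 0
  then show ?case using lam_one[OF D] by simp
next
  case (Suc k)
  then show ?case using lam_circ[OF D, of "x [^]\<^bsub>circ_group D\<^esub> k" x] x circ.nat_pow_closed[of x k] by simp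
qed

text \<open>As \<open>x\<close> has trivial \<open>p\<close>-th power for \<open>\<circ>\<close>, so
  has \<open>lam D x\<close>. Its part on \<open>E\<close> is trivial by \<open>no_aut\<close>, its
  scalar by \<open>fermat_residue\<close>. Hence \<open>snd\<close> takes
  \<open>\<circ>\<close>-powers of \<open>x\<close> to powers of \<open>snd x\<close> in
  \<open>E\<close>, a group of order prime to \<open>p\<close>.\<close>

lemma normal_subgroup_element:
  assumes P: "P \<lhd> circ_group D" "card P = p" and x: "x \<in> P"
  shows "snd x = \<one>\<^bsub>E\<^esub> \<and> (\<exists>i. \<forall>m b. 0 \<le> m \<longrightarrow> m < int p \<longrightarrow> b \<in> carrier E \<longrightarrow>
    lam D x (m, b) = ((m + i * (1 - \<sigma> b)) mod int p, b))"
proof -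
  interpret Aut: group "AutoGroup D" by (rule D.AutoGroup)
  interpret AutE: group "AutoGroup E" by (rule E.AutoGroup)
  have subP: "subgroup P (circ_group D)" by (rule normal_imp_subgroup[OF P(1)])
  have xD: "x \<in> carrier D" using subgroup.subset[OF subP] x by auto
  have x_pow: "x [^]\<^bsub>circ_group D\<^esub> p = \<one>\<^bsub>D\<^esub>"
  proof -
    interpret P: group "(circ_group D)\<lparr>carrier := P\<rparr>" by (rule circ.subgroup_imp_group[OF subP])
    have "x [^]\<^bsub>(circ_group D)\<lparr>carrier := P\<rparr>\<^esub> p = \<one>\<^bsub>D\<^esub>"
      using P.pow_order_eq_1[of x] x P(2) by (simp add: order_def)
    then show ?thesis using circ.nat_pow_consistent by metis
  qed
  obtain \<alpha> i \<mu> where \<alpha>: "0 < \<alpha>" "\<alpha> < int p" and i: "0 \<le> i" "i < int p" and \<mu>: "\<mu> \<in> auto E"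
    "\<And>a. a \<in> carrier E \<Longrightarrow> \<sigma> (\<mu> a) = \<sigma> a"
    and lam: "\<And>m a. 0 \<le> m \<Longrightarrow> m < int p \<Longrightarrow> a \<in> carrier E \<Longrightarrow>
      lam D x (m, a) = ((\<alpha> * m + i * (1 - \<sigma> a)) mod int p, \<mu> a)"
    using lam_triangular[OF xD] by blast
  have lamD: "lam D x \<in> carrier (AutoGroup D)" using lam_auto[OF D xD] by simp
  have lam_pow: "lam D x [^]\<^bsub>AutoGroup D\<^esub> p = \<one>\<^bsub>AutoGroup D\<^esub>"
    using lam_circ_pow[OF xD, of p] x_pow lam_one[OF D] by simp
  have \<mu>': "\<mu> \<in> carrier (AutoGroup E)" using \<mu> by simp
  have snd_pow: "snd ((lam D x [^]\<^bsub>AutoGroup D\<^esub> k) (0, a)) = (\<mu> [^]\<^bsub>AutoGroup E\<^esub> k) a"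
    if a: "a \<in> carrier E" for a and k :: nat
  proof -
    have "snd ((lam D x [^]\<^bsub>AutoGroup D\<^esub> k) (m, a)) = (\<mu> [^]\<^bsub>AutoGroup E\<^esub> k) a"
      if "0 \<le> m" "m < int p" "a \<in> carrier E" for m a
      using that
    proof (induction k arbitrary: m a)
      case 0
      then show ?case by (simp add: D_simps)
    next
      case (Suc k)
      have closed: "lam D x [^]\<^bsub>AutoGroup D\<^esub> k \<in> auto D" "\<mu> [^]\<^bsub>AutoGroup E\<^esub> k \<in> auto E"
        using Aut.nat_pow_closed[OF lamD, of k] AutE.nat_pow_closed[OF \<mu>', of k] by simp_all
      have "snd ((lam D x [^]\<^bsub>AutoGroup D\<^esub> Suc k) (m, a))
          = snd ((lam D x [^]\<^bsub>AutoGroup D\<^esub> k) ((\<alpha> * m + i * (1 - \<sigma> a)) mod int p, \<mu> a))"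
        using Suc.prems closed lamD by (simp add: mult_AutoGroup_apply D_simps lam)
      also have "\<dots> = (\<mu> [^]\<^bsub>AutoGroup E\<^esub> k) (\<mu> a)"
        using Suc.prems p_gt_1[OF p] by (intro Suc.IH) (simp_all add: auto_closed[OF \<mu>(1)])
      finally show ?case using Suc.prems closed \<mu>(1) by (simp add: mult_AutoGroup_apply)
    qed
    then show ?thesis using a p_gt_1[OF p] by simp
  qed
  have "\<mu> [^]\<^bsub>AutoGroup E\<^esub> p = \<one>\<^bsub>AutoGroup E\<^esub>"
  proof (rule auto_eqI)
    show "\<mu> [^]\<^bsub>AutoGroup E\<^esub> p \<in> auto E" using AutE.nat_pow_closed[OF \<mu>', of p] by simp
    show "\<one>\<^bsub>AutoGroup E\<^esub> \<in> auto E" using AutE.one_closed by simp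
    show "(\<mu> [^]\<^bsub>AutoGroup E\<^esub> p) a = \<one>\<^bsub>AutoGroup E\<^esub> a" if "a \<in> carrier E" for a
      using snd_pow[OF that, of p] lam_pow that p_gt_1[OF p] by (simp add: D_simps)
  qed
  then have \<mu>_id: "\<mu> a = a" if "a \<in> carrier E" for a
    using no_aut[OF \<mu>(1)] that by simp
  have "(lam D x [^]\<^bsub>AutoGroup D\<^esub> k) (m, \<one>\<^bsub>E\<^esub>) = ((\<alpha> ^ k * m) mod int p, \<one>\<^bsub>E\<^esub>)"
    if "0 \<le> m" "m < int p" for m and k :: nat
    using that
  proof (induction k arbitrary: m)
    case 0
    then show ?case by (simp add: D_simps)
  next
    case (Suc k)
    have closed: "lam D x [^]\<^bsub>AutoGroup D\<^esub> k \<in> auto D"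
      using Aut.nat_pow_closed[OF lamD, of k] by simp
    have "(lam D x [^]\<^bsub>AutoGroup D\<^esub> Suc k) (m, \<one>\<^bsub>E\<^esub>)
        = (lam D x [^]\<^bsub>AutoGroup D\<^esub> k) ((\<alpha> * m) mod int p, \<one>\<^bsub>E\<^esub>)"
      using Suc.prems closed lamD by (simp add: mult_AutoGroup_apply D_simps lam \<sigma>_char \<mu>_id)
    also have "\<dots> = ((\<alpha> ^ k * ((\<alpha> * m) mod int p)) mod int p, \<one>\<^bsub>E\<^esub>)"
      using p_gt_1[OF p] by (intro Suc.IH) simp_all
    finally show ?case by (simp add: mod_simps mult_ac)
  qed
  from this[of 1 p] have "(\<alpha> ^ p) mod int p = 1"
    using lam_pow p_gt_1[OF p] by (simp add: D_simps)
  then have "\<alpha> = 1" by (rule fermat_residue[OF p \<alpha>])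
  then have lam': "lam D x (m, b) = ((m + i * (1 - \<sigma> b)) mod int p, b)"
    if "0 \<le> m" "m < int p" "b \<in> carrier E" for m b
    using lam that \<mu>_id by simp
  have "snd (x [^]\<^bsub>circ_group D\<^esub> (k :: nat)) = snd x [^]\<^bsub>E\<^esub> k \<and> x [^]\<^bsub>circ_group D\<^esub> k \<in> carrier D" for k
  proof (induction k)
    case 0
    then show ?case using p_gt_1[OF p] by (simp add: D_simps)
  next
    case (Suc k)
    let ?y = "x [^]\<^bsub>circ_group D\<^esub> k"
    have y: "?y \<in> carrier D" "x [^]\<^bsub>circ_group D\<^esub> Suc k = circ D x ?y"
      using Suc.IH circ.nat_pow_Suc2[of x k] xD by simp_all
    obtain m b where mb: "?y = (m, b)" "0 \<le> m" "m < int p" "b \<in> carrier E"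
      using y(1) by (auto simp: D_simps)
    have "snd (circ D x ?y) = snd x \<otimes>\<^bsub>E\<^esub> snd ?y"
      using circ_eq_lam[OF D xD y(1)] mb lam' by (cases x) (simp add: D_simps)
    then show ?case
      using Suc.IH y xD circ_closed[OF D xD y(1)] E.nat_pow_Suc2[of "snd x" k] by (auto simp: D_simps)
  qed
  from this[of p] have "snd x [^]\<^bsub>E\<^esub> p = \<one>\<^bsub>E\<^esub>" using x_pow by (simp add: D_simps)
  then have "snd x = \<one>\<^bsub>E\<^esub>" using E.pow_p_eq_one[OF p n] xD by (auto simp: D_simps)
  then show ?thesis using lam' by blast
qed

text \<open>The normal subgroup lies in \<open>Z_p\<close> and has \<open>p\<close> elements, so it
  is all of \<open>Z_p\<close>. \<open>i m\<close> is the off-diagonal entry of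
  \<open>lam D (m, \<one>)\<close>.\<close>

lemma circ_Zp_part:
  obtains i where "\<And>m l b. 0 \<le> m \<Longrightarrow> m < int p \<Longrightarrow> 0 \<le> l \<Longrightarrow> l < int p \<Longrightarrow> b \<in> carrier E \<Longrightarrow>
    circ D (m, \<one>\<^bsub>E\<^esub>) (l, b) = ((m + l + i m * (1 - \<sigma> b)) mod int p, b)"
proof -
  obtain P where P: "P \<lhd> circ_group D" "card P = p" using normal by blast
  have "P \<subseteq> carrier D" using subgroup.subset[OF normal_imp_subgroup[OF P(1)]] by simp
  then have "P \<subseteq> {0..<int p} \<times> {\<one>\<^bsub>E\<^esub>}"
    using normal_subgroup_element[OF P] by (force simp: D_simps)
  then have P_eq: "P = {0..<int p} \<times> {\<one>\<^bsub>E\<^esub>}"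
    using P(2) by (intro card_subset_eq) (simp_all add: card_cartesian_product)
  have "\<forall>m\<in>{0..<int p}. \<exists>i. \<forall>l b. 0 \<le> l \<longrightarrow> l < int p \<longrightarrow> b \<in> carrier E \<longrightarrow>
      lam D (m, \<one>\<^bsub>E\<^esub>) (l, b) = ((l + i * (1 - \<sigma> b)) mod int p, b)"
    using normal_subgroup_element[OF P] P_eq by auto
  then obtain i where i: "\<And>m l b. 0 \<le> m \<Longrightarrow> m < int p \<Longrightarrow> 0 \<le> l \<Longrightarrow> l < int p \<Longrightarrow> b \<in> carrier E \<Longrightarrow>
      lam D (m, \<one>\<^bsub>E\<^esub>) (l, b) = ((l + i m * (1 - \<sigma> b)) mod int p, b)"
    by (auto simp: bchoice_iff Ball_def)
  have "circ D (m, \<one>\<^bsub>E\<^esub>) (l, b) = ((m + l + i m * (1 - \<sigma> b)) mod int p, b)"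
    if "0 \<le> m" "m < int p" "0 \<le> l" "l < int p" "b \<in> carrier E" for m l b
    using that circ_eq_lam[OF D, of "(m, \<one>\<^bsub>E\<^esub>)" "(l, b)"] i[OF that]
    by (simp add: D_simps \<sigma>_char mod_simps add_ac)
  then show ?thesis using that by blast
qed

text \<open>Associativity of \<open>(x, \<one>), (y, \<one>), (0, c)\<close> with
  \<open>\<sigma> c \<noteq> 1\<close> makes \<open>i\<close> additive, so \<open>i m = k m\<close>.
  If \<open>\<sigma>\<close> is trivial, \<open>k\<close> is multiplied by zero everywhere and is
  set to \<open>0\<close>.\<close>

lemma circ_Zp_part_linear:
  obtains k where "\<And>m l b. 0 \<le> m \<Longrightarrow> m < int p \<Longrightarrow> 0 \<le> l \<Longrightarrow> l < int p \<Longrightarrow> b \<in> carrier E \<Longrightarrow>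
      circ D (m, \<one>\<^bsub>E\<^esub>) (l, b) = (((1 + k * (1 - \<sigma> b)) * m + l) mod int p, b)"
    "(\<forall>b\<in>carrier E. \<sigma> b = 1) \<Longrightarrow> k = 0"
proof -
  obtain i where i: "\<And>m l b. 0 \<le> m \<Longrightarrow> m < int p \<Longrightarrow> 0 \<le> l \<Longrightarrow> l < int p \<Longrightarrow> b \<in> carrier E \<Longrightarrow>
    circ D (m, \<one>\<^bsub>E\<^esub>) (l, b) = ((m + l + i m * (1 - \<sigma> b)) mod int p, b)"
    using circ_Zp_part by blast
  show ?thesis
  proof (cases "\<forall>b\<in>carrier E. \<sigma> b = 1")
    case True
    then show ?thesis using i by (intro that[of 0]) simp_all
  next
    case False
    then obtain c where c: "c \<in> carrier E" "\<sigma> c \<noteq> 1" by blast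
    obtain w where w: "((1 - \<sigma> c) * w) mod int p = 1"
      by (rule residue_inverse_ex[OF p char_not_one_dvd[OF c]])
    then have w: "((1 - \<sigma> c) * w) mod int p = 1 mod int p" using p_gt_1[OF p] by simp
    have add: "i ((x + y) mod int p) mod int p = (i x + i y) mod int p"
      if xy: "0 \<le> x" "x < int p" "0 \<le> y" "y < int p" for x y
    proof -
      have pos: "0 < int p" using p_gt_1[OF p] by simp
      have "circ D (circ D (x, \<one>\<^bsub>E\<^esub>) (y, \<one>\<^bsub>E\<^esub>)) (0, c) = circ D (x, \<one>\<^bsub>E\<^esub>) (circ D (y, \<one>\<^bsub>E\<^esub>) (0, c))"
        using xy c pos by (intro circ_assoc[OF D]) (simp_all add: D_simps)
      then have "((x + y) mod int p + i ((x + y) mod int p) * (1 - \<sigma> c)) mod int p =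
          (x + (y + i y * (1 - \<sigma> c)) mod int p + i x * (1 - \<sigma> c)) mod int p"
        using xy c pos by (simp add: i \<sigma>_char)
      then show ?thesis using w
        unfolding mod_eq_dvd_iff unfolding mod_unfold by Groebner_Basis.algebra
    qed
    have lin: "i m mod int p = (m * i 1) mod int p" if "0 \<le> m" "m < int p" for m
      by (rule additive_residue[OF p add that])
    have "circ D (m, \<one>\<^bsub>E\<^esub>) (l, b) = (((1 + i 1 * (1 - \<sigma> b)) * m + l) mod int p, b)"
      if ml: "0 \<le> m" "m < int p" "0 \<le> l" "l < int p" "b \<in> carrier E" for m l b
    proof -
      have "(m + l + i m * (1 - \<sigma> b)) mod int p = ((1 + i 1 * (1 - \<sigma> b)) * m + l) mod int p"
        using lin[OF ml(1,2)] unfolding mod_eq_dvd_iff by Groebner_Basis.algebra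
      then show ?thesis using i[OF ml] by simp
    qed
    then show ?thesis using that False by blast
  qed
qed

section \<open>The section \<open>{0} \<times> E\<close> and the multiplication induced on
  \<open>E\<close>\<close>

definition star :: "'a \<Rightarrow> 'a \<Rightarrow> 'a" where
  "star a b = snd (circ D (0, a) (0, b))"

lemma circ_section:
  obtains \<alpha> i :: "'a \<Rightarrow> int" and \<mu> :: "'a \<Rightarrow> 'a \<Rightarrow> 'a"
  where "\<forall>a\<in>carrier E. 0 < \<alpha> a \<and> \<alpha> a < int p \<and> \<mu> a \<in> auto E \<and>
    ((\<forall>b\<in>carrier E. \<sigma> b = 1) \<longrightarrow> i a = 0) \<and> (\<forall>b\<in>carrier E. \<sigma> (\<mu> a b) = \<sigma> b) \<and>
    (\<forall>l b. 0 \<le> l \<longrightarrow> l < int p \<longrightarrow> b \<in> carrier E \<longrightarrow>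
      circ D (0, a) (l, b) = ((\<sigma> a * (\<alpha> a * l + i a * (1 - \<sigma> b))) mod int p, a \<otimes>\<^bsub>E\<^esub> \<mu> a b))"
proof -
  have "\<forall>a\<in>carrier E. \<exists>\<alpha> i \<mu>. 0 < \<alpha> \<and> \<alpha> < int p \<and> \<mu> \<in> auto E \<and>
    ((\<forall>b\<in>carrier E. \<sigma> b = 1) \<longrightarrow> i = 0) \<and> (\<forall>b\<in>carrier E. \<sigma> (\<mu> b) = \<sigma> b) \<and>
    (\<forall>l b. 0 \<le> l \<longrightarrow> l < int p \<longrightarrow> b \<in> carrier E \<longrightarrow>
      circ D (0, a) (l, b) = ((\<sigma> a * (\<alpha> * l + i * (1 - \<sigma> b))) mod int p, a \<otimes>\<^bsub>E\<^esub> \<mu> b))"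
  proof
    fix a assume a: "a \<in> carrier E"
    have a0: "(0, a) \<in> carrier D" using a p_gt_1[OF p] by (simp add: D_simps)
    obtain \<alpha> i \<mu> where \<alpha>: "0 < \<alpha>" "\<alpha> < int p" and i: "0 \<le> i" "i < int p" and \<mu>: "\<mu> \<in> auto E"
      "\<And>a. a \<in> carrier E \<Longrightarrow> \<sigma> (\<mu> a) = \<sigma> a"
      and lam: "\<And>m b. 0 \<le> m \<Longrightarrow> m < int p \<Longrightarrow> b \<in> carrier E \<Longrightarrow>
        lam D (0, a) (m, b) = ((\<alpha> * m + i * (1 - \<sigma> b)) mod int p, \<mu> b)"
      using lam_triangular[OF a0] by blast
    \<comment> \<open>For trivial \<open>\<sigma>\<close> this entry is invisible; the value
      \<open>0\<close> makes the cocycle identity for it hold in that case too.\<close>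
    let ?i = "if \<forall>b\<in>carrier E. \<sigma> b = 1 then 0 else i"
    have "circ D (0, a) (l, b) = ((\<sigma> a * (\<alpha> * l + ?i * (1 - \<sigma> b))) mod int p, a \<otimes>\<^bsub>E\<^esub> \<mu> b)"
      if "0 \<le> l" "l < int p" "b \<in> carrier E" for l b
      using circ_eq_lam[OF D a0, of "(l, b)"] lam[OF that] that by (simp add: D_simps mod_simps)
    then show "\<exists>\<alpha> i \<mu>. 0 < \<alpha> \<and> \<alpha> < int p \<and> \<mu> \<in> auto E \<and>
      ((\<forall>b\<in>carrier E. \<sigma> b = 1) \<longrightarrow> i = 0) \<and> (\<forall>b\<in>carrier E. \<sigma> (\<mu> b) = \<sigma> b) \<and>
      (\<forall>l b. 0 \<le> l \<longrightarrow> l < int p \<longrightarrow> b \<in> carrier E \<longrightarrow>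
        circ D (0, a) (l, b) = ((\<sigma> a * (\<alpha> * l + i * (1 - \<sigma> b))) mod int p, a \<otimes>\<^bsub>E\<^esub> \<mu> b))"
      using \<alpha> \<mu> by (intro exI[of _ \<alpha>] exI[of _ ?i] exI[of _ \<mu>]) simp
  qed
  then show ?thesis using that unfolding bchoice_iff by blast
qed

lemma star_closed: "a \<in> carrier E \<Longrightarrow> b \<in> carrier E \<Longrightarrow> star a b \<in> carrier E"
  using circ_closed[OF D, of "(0, a)" "(0, b)"] p_gt_1[OF p] by (auto simp: D_simps star_def)

text \<open>\<open>star a b\<close> is \<open>a\<close> times the image of \<open>b\<close> under an
  automorphism preserving \<open>\<sigma>\<close>. So \<open>\<sigma>\<close> is a character of both
  operations on \<open>E\<close>.\<close>

lemma char_star: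
  assumes "a \<in> carrier E" "b \<in> carrier E"
  shows "\<sigma> (star a b) = (\<sigma> a * \<sigma> b) mod int p"
proof -
  obtain \<alpha> i \<mu> where "\<forall>a\<in>carrier E. 0 < \<alpha> a \<and> \<alpha> a < int p \<and> \<mu> a \<in> auto E \<and>
    ((\<forall>b\<in>carrier E. \<sigma> b = 1) \<longrightarrow> i a = 0) \<and> (\<forall>b\<in>carrier E. \<sigma> (\<mu> a b) = \<sigma> b) \<and>
    (\<forall>l b. 0 \<le> l \<longrightarrow> l < int p \<longrightarrow> b \<in> carrier E \<longrightarrow>
      circ D (0, a) (l, b) = ((\<sigma> a * (\<alpha> a * l + i a * (1 - \<sigma> b))) mod int p, a \<otimes>\<^bsub>E\<^esub> \<mu> a b))"
    by (rule circ_section)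
  then have \<mu>: "\<mu> a b \<in> carrier E" "\<sigma> (\<mu> a b) = \<sigma> b" "star a b = a \<otimes>\<^bsub>E\<^esub> \<mu> a b"
    using assms p_gt_1[OF p] by (auto simp: star_def auto_closed)
  then show ?thesis using assms by (simp add: \<sigma>_char)
qed

lemma star_one: "a \<in> carrier E \<Longrightarrow> star a \<one>\<^bsub>E\<^esub> = a"
  using circ_one(1)[OF D, of "(0, a)"] p_gt_1[OF p] by (simp add: star_def D_simps)

text \<open>Every \<open>(m, a)\<close> is \<open>(m / w a, \<one>) \<circ> (0, a)\<close>, so the
  products with a left factor in \<open>Z_p\<close> or in the section determine
  \<open>\<circ>\<close>; associativity then restricts the scaling \<open>w\<close>.\<close>

lemma circ_formula:
  obtains u \<alpha> i :: "'a \<Rightarrow> int"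
  where "u = (\<lambda>_. 1) \<or> u = \<sigma>" "\<And>a. a \<in> carrier E \<Longrightarrow> 0 < \<alpha> a \<and> \<alpha> a < int p"
    "\<And>a. a \<in> carrier E \<Longrightarrow> \<forall>b\<in>carrier E. \<sigma> b = 1 \<Longrightarrow> i a = 0"
    "\<And>m a l b. 0 \<le> m \<Longrightarrow> m < int p \<Longrightarrow> a \<in> carrier E \<Longrightarrow> 0 \<le> l \<Longrightarrow> l < int p \<Longrightarrow> b \<in> carrier E \<Longrightarrow>
      circ D (m, a) (l, b) = ((u b * m + \<sigma> a * (\<alpha> a * l + i a * (1 - \<sigma> b))) mod int p, star a b)"
proof -
  have pos: "0 < int p" "1 < int p" using p_gt_1[OF p] by simp_all
  obtain k where c1: "\<And>m l b. 0 \<le> m \<Longrightarrow> m < int p \<Longrightarrow> 0 \<le> l \<Longrightarrow> l < int p \<Longrightarrow> b \<in> carrier E \<Longrightarrow>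
      circ D (m, \<one>\<^bsub>E\<^esub>) (l, b) = (((1 + k * (1 - \<sigma> b)) * m + l) mod int p, b)"
    and k0: "(\<forall>b\<in>carrier E. \<sigma> b = 1) \<Longrightarrow> k = 0"
    using circ_Zp_part_linear by blast
  define w where "w = (\<lambda>b. 1 + k * (1 - \<sigma> b))"
  have c1: "circ D (m, \<one>\<^bsub>E\<^esub>) (l, b) = ((w b * m + l) mod int p, b)"
    if "0 \<le> m" "m < int p" "0 \<le> l" "l < int p" "b \<in> carrier E" for m l b
    using c1[OF that] by (simp add: w_def)
  obtain \<alpha> i \<mu> where sec: "\<forall>a\<in>carrier E. 0 < \<alpha> a \<and> \<alpha> a < int p \<and> \<mu> a \<in> auto E \<and>
    ((\<forall>b\<in>carrier E. \<sigma> b = 1) \<longrightarrow> i a = 0) \<and> (\<forall>b\<in>carrier E. \<sigma> (\<mu> a b) = \<sigma> b) \<and>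
    (\<forall>l b. 0 \<le> l \<longrightarrow> l < int p \<longrightarrow> b \<in> carrier E \<longrightarrow>
      circ D (0, a) (l, b) = ((\<sigma> a * (\<alpha> a * l + i a * (1 - \<sigma> b))) mod int p, a \<otimes>\<^bsub>E\<^esub> \<mu> a b))"
    by (rule circ_section)
  have c2: "circ D (0, a) (l, b) = ((\<sigma> a * (\<alpha> a * l + i a * (1 - \<sigma> b))) mod int p, star a b)"
    if "a \<in> carrier E" "0 \<le> l" "l < int p" "b \<in> carrier E" for a l b
    using sec that pos by (simp add: star_def)
  have \<alpha>: "0 < \<alpha> a \<and> \<alpha> a < int p" "\<forall>b\<in>carrier E. \<sigma> b = 1 \<Longrightarrow> i a = 0" if "a \<in> carrier E" for a
    using sec that by auto
  \<comment> \<open>If \<open>w a\<close> vanished modulo \<open>p\<close>, then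
    \<open>(1, \<one>)\<close> and \<open>(0, \<one>)\<close> would have the same product with
    \<open>(0, a)\<close>.\<close>
  have "\<exists>v. (w a * v) mod int p = 1" if a: "a \<in> carrier E" for a
  proof -
    have "\<not> int p dvd w a"
    proof
      assume "int p dvd w a"
      then have "circ D (1, \<one>\<^bsub>E\<^esub>) (0, a) = circ D (0, \<one>\<^bsub>E\<^esub>) (0, a)"
        using c1 a pos by simp
      then show False
        using circ.right_cancel[of "(0, a)" "(1, \<one>\<^bsub>E\<^esub>)" "(0, \<one>\<^bsub>E\<^esub>)"] a pos by (simp add: D_simps)
    qed
    then show ?thesis using residue_inverse_ex[OF p, of "w a"] by blast
  qed
  then have "\<exists>v. \<forall>a\<in>carrier E. (w a * v a) mod int p = 1"
    by (intro bchoice ballI)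
  then obtain v where v: "\<And>a. a \<in> carrier E \<Longrightarrow> (w a * v a) mod int p = 1 mod int p"
    using pos by auto
  have c3: "circ D (m, a) (l, b) = ((w (star a b) * ((v a * m) mod int p)
      + \<sigma> a * (\<alpha> a * l + i a * (1 - \<sigma> b))) mod int p, star a b)"
    if mlab: "0 \<le> m" "m < int p" "a \<in> carrier E" "0 \<le> l" "l < int p" "b \<in> carrier E" for m a l b
  proof -
    have "(w a * ((v a * m) mod int p)) mod int p = m mod int p"
      using v[OF mlab(3)] unfolding mod_eq_dvd_iff unfolding mod_unfold by Groebner_Basis.algebra
    then have "(m, a) = circ D ((v a * m) mod int p, \<one>\<^bsub>E\<^esub>) (0, a)"
      using c1[of "(v a * m) mod int p" 0 a] mlab pos by simp
    then have "circ D (m, a) (l, b) = circ D ((v a * m) mod int p, \<one>\<^bsub>E\<^esub>) (circ D (0, a) (l, b))"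
      using mlab pos circ_assoc[OF D, of "((v a * m) mod int p, \<one>\<^bsub>E\<^esub>)" "(0, a)" "(l, b)"]
      by (simp add: D_simps)
    then show ?thesis using mlab pos c1 c2 star_closed by (simp add: mod_simps)
  qed
  \<comment> \<open>Associativity of \<open>(0, a), (1, \<one>), (0, b)\<close>; the common factor
    \<open>\<sigma> a \<alpha> a\<close> is a unit.\<close>
  have w_mult: "w (star a b) mod int p = (w a * w b) mod int p" if ab: "a \<in> carrier E" "b \<in> carrier E" for a b
  proof -
    have "circ D (circ D (0, a) (1, \<one>\<^bsub>E\<^esub>)) (0, b) = circ D (0, a) (circ D (1, \<one>\<^bsub>E\<^esub>) (0, b))"
      using ab pos by (intro circ_assoc[OF D]) (simp_all add: D_simps)
    then have eq: "(w (star a b) * ((v a * ((\<sigma> a * \<alpha> a) mod int p)) mod int p) + \<sigma> a * (i a * (1 - \<sigma> b))) mod int p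
      = (\<sigma> a * (\<alpha> a * (w b mod int p) + i a * (1 - \<sigma> b))) mod int p"
      using ab pos c1[of 1 0 b] c2[of a 1 "\<one>\<^bsub>E\<^esub>"] c2[of a "w b mod int p" b]
        c3[of "(\<sigma> a * \<alpha> a) mod int p" a 0 b] by (simp add: \<sigma>_char star_one)
    have "\<not> int p dvd \<sigma> a * \<alpha> a"
      using not_dvd_residue[OF p] \<sigma>_char(1,2) \<alpha>(1) ab p by (simp add: prime_dvd_mult_iff)
    then obtain y where "(\<sigma> a * \<alpha> a * y) mod int p = 1" by (rule residue_inverse_ex[OF p])
    then have "(\<sigma> a * \<alpha> a * y) mod int p = 1 mod int p" using pos by simp
    then show ?thesis
      using eq v[OF ab(1)] unfolding mod_eq_dvd_iff unfolding mod_unfold by Groebner_Basis.algebra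
  qed
  \<comment> \<open>By \<open>w_mult\<close>, \<open>w (star a b) / w a\<close> is
    \<open>w b\<close>, which no longer involves \<open>a\<close>.\<close>
  have c4: "circ D (m, a) (l, b) = ((w b * m + \<sigma> a * (\<alpha> a * l + i a * (1 - \<sigma> b))) mod int p, star a b)"
    if mlab: "0 \<le> m" "m < int p" "a \<in> carrier E" "0 \<le> l" "l < int p" "b \<in> carrier E" for m a l b
  proof -
    have "(w (star a b) * ((v a * m) mod int p) + \<sigma> a * (\<alpha> a * l + i a * (1 - \<sigma> b))) mod int p
      = (w b * m + \<sigma> a * (\<alpha> a * l + i a * (1 - \<sigma> b))) mod int p"
      using v[OF mlab(3)] w_mult[OF mlab(3,6)]
      unfolding mod_eq_dvd_iff unfolding mod_unfold by Groebner_Basis.algebra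
    then show ?thesis using c3[OF mlab] by simp
  qed
  have "\<exists>u. (u = (\<lambda>_. 1) \<or> u = \<sigma>) \<and> (\<forall>b\<in>carrier E. w b mod int p = u b mod int p)"
  proof (cases "\<forall>b\<in>carrier E. \<sigma> b = 1")
    case True
    then show ?thesis using k0 by (intro exI[of _ "\<lambda>_. 1"]) (simp add: w_def)
  next
    case False
    then obtain c where c: "c \<in> carrier E" "\<sigma> c \<noteq> 1" by blast
    \<comment> \<open>Insert \<open>w = 1 + k (1 - \<sigma>)\<close> into
      \<open>w (star c c) = (w c)^2\<close>: up to sign the two sides differ by
      \<open>(1 - \<sigma> c)^2 k (1 + k)\<close>.\<close>
    have "\<sigma> (star c c) mod int p = (\<sigma> c * \<sigma> c) mod int p" using char_star[OF c(1) c(1)] by simp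
    then have "int p dvd (1 - \<sigma> c) * (1 - \<sigma> c) * (k * (1 + k))"
      using w_mult[OF c(1) c(1)] unfolding w_def mod_eq_dvd_iff by Groebner_Basis.algebra
    then consider "int p dvd k" | "int p dvd 1 + k"
      using char_not_one_dvd[OF c] p by (auto simp: prime_dvd_mult_iff)
    then show ?thesis
    proof cases
      case 1
      then have "w b mod int p = 1 mod int p" for b
        by (simp add: w_def mod_eq_dvd_iff)
      then show ?thesis by auto
    next
      case 2
      moreover have "w b - \<sigma> b = (1 + k) * (1 - \<sigma> b)" for b
        by (simp add: w_def algebra_simps)
      ultimately have "w b mod int p = \<sigma> b mod int p" for b
        by (simp add: mod_eq_dvd_iff)
      then show ?thesis by auto
    qed
  qed
  then obtain u where u: "u = (\<lambda>_. 1) \<or> u = \<sigma>" "\<And>b. b \<in> carrier E \<Longrightarrow> w b mod int p = u b mod int p" by blast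
  have c5: "circ D (m, a) (l, b) = ((u b * m + \<sigma> a * (\<alpha> a * l + i a * (1 - \<sigma> b))) mod int p, star a b)"
    if mlab: "0 \<le> m" "m < int p" "a \<in> carrier E" "0 \<le> l" "l < int p" "b \<in> carrier E" for m a l b
  proof -
    have "(w b * m + \<sigma> a * (\<alpha> a * l + i a * (1 - \<sigma> b))) mod int p
      = (u b * m + \<sigma> a * (\<alpha> a * l + i a * (1 - \<sigma> b))) mod int p"
      using u(2)[OF mlab(6)] unfolding mod_eq_dvd_iff by Groebner_Basis.algebra
    then show ?thesis using c4[OF mlab] by simp
  qed
  show ?thesis by (rule that[OF u(1) \<alpha>(1) \<alpha>(2) c5])
qed

text \<open>\<open>\<psi>\<close> is an isomorphism from \<open>E\<close> with its product and
  \<open>star\<close> to \<open>B\<close>. The conjugation formula ties \<open>t\<close> to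
  \<open>D\<close>, so that a group isomorphism can identify it later. The final clause admits any
  \<open>\<sigma>'\<close> and \<open>t'\<close> on \<open>B\<close> corresponding to
  \<open>\<sigma>\<close> and \<open>t\<close>: the given pair when \<open>\<psi>\<close> is
  compatible with it, a transported pair otherwise.\<close>

lemma iso_ext_brace:
  fixes B :: "'b skew_brace" and \<psi> :: "'a \<Rightarrow> 'b"
  assumes B: "skew_brace B" and \<psi>: "bij_betw \<psi> (carrier E) (carrier B)"
    and \<psi>_mult: "\<And>a b. a \<in> carrier E \<Longrightarrow> b \<in> carrier E \<Longrightarrow> \<psi> (a \<otimes>\<^bsub>E\<^esub> b) = \<psi> a \<otimes>\<^bsub>B\<^esub> \<psi> b"
    and \<psi>_star: "\<And>a b. a \<in> carrier E \<Longrightarrow> b \<in> carrier E \<Longrightarrow> \<psi> (star a b) = circ B (\<psi> a) (\<psi> b)"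
  shows "\<exists>t. (\<forall>a\<in>carrier E. 0 < t a \<and> t a < int p) \<and>
    (\<forall>a\<in>carrier E. \<forall>b\<in>carrier E. t (star a b) = (t a * t b) mod int p) \<and>
    (\<forall>a\<in>carrier E. \<forall>m. 0 \<le> m \<longrightarrow> m < int p \<longrightarrow>
      circ D (0, a) (m, \<one>\<^bsub>E\<^esub>) = circ D ((t a * m) mod int p, \<one>\<^bsub>E\<^esub>) (0, a)) \<and>
    (\<forall>\<sigma>' t'. (\<forall>a\<in>carrier E. \<sigma>' (\<psi> a) = \<sigma> a) \<longrightarrow> (\<forall>a\<in>carrier E. t' (\<psi> a) = t a) \<longrightarrow>
      brace_iso D (ext_brace p \<sigma>' (\<lambda>_. 1) t' B) \<noteq> {} \<or> brace_iso D (ext_brace p \<sigma>' \<sigma>' t' B) \<noteq> {})"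
proof -
  have pos: "0 < int p" "1 < int p" using p_gt_1[OF p] by simp_all
  obtain u \<alpha> i where u: "u = (\<lambda>_. 1) \<or> u = \<sigma>" and \<alpha>: "\<And>a. a \<in> carrier E \<Longrightarrow> 0 < \<alpha> a \<and> \<alpha> a < int p"
    and i0: "\<And>a. a \<in> carrier E \<Longrightarrow> \<forall>b\<in>carrier E. \<sigma> b = 1 \<Longrightarrow> i a = 0"
    and circ: "\<And>m a l b. 0 \<le> m \<Longrightarrow> m < int p \<Longrightarrow> a \<in> carrier E \<Longrightarrow> 0 \<le> l \<Longrightarrow> l < int p \<Longrightarrow> b \<in> carrier E \<Longrightarrow>
      circ D (m, a) (l, b) = ((u b * m + \<sigma> a * (\<alpha> a * l + i a * (1 - \<sigma> b))) mod int p, star a b)"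
    using circ_formula by blast
  note one = E.one_closed
  have \<sigma>_star: "\<sigma> (star a b) mod int p = (\<sigma> a * \<sigma> b) mod int p" if "a \<in> carrier E" "b \<in> carrier E" for a b
    using char_star[OF that] by simp
  have u_one: "u \<one>\<^bsub>E\<^esub> = 1" using u \<sigma>_char(4) by auto
  have u_star: "u (star a b) mod int p = (u a * u b) mod int p" if "a \<in> carrier E" "b \<in> carrier E" for a b
    using u \<sigma>_star[OF that] by auto
  have unit: "\<exists>y. (\<sigma> a * y) mod int p = 1 mod int p" if a: "a \<in> carrier E" for a
  proof -
    obtain y where "(\<sigma> a * y) mod int p = 1"
      using residue_inverse_ex[OF p not_dvd_residue[OF p \<sigma>_char(1)[OF a] \<sigma>_char(2)[OF a]]] by blast
    then show ?thesis using pos by auto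
  qed
  have one_star: "star \<one>\<^bsub>E\<^esub> a = a" if a: "a \<in> carrier E" for a
    using circ_one(2)[OF D, of "(0, a)"] circ[of 0 "\<one>\<^bsub>E\<^esub>" 0 a] a pos by (simp add: D_simps)
  have assoc: "circ D (circ D (k, a) (l, b)) (m, c) = circ D (k, a) (circ D (l, b) (m, c))"
    if "0 \<le> k" "k < int p" "a \<in> carrier E" "0 \<le> l" "l < int p" "b \<in> carrier E"
      "0 \<le> m" "m < int p" "c \<in> carrier E" for k a l b m c
    using that by (intro circ_assoc[OF D]) (simp_all add: D_simps)
  \<comment> \<open>Associativity of \<open>(0, a), (0, b), (1, \<one>)\<close>.\<close>
  have \<alpha>_star: "\<alpha> (star a b) mod int p = (\<alpha> a * \<alpha> b) mod int p" if ab: "a \<in> carrier E" "b \<in> carrier E" for a b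
  proof -
    have "((\<sigma> a * (i a * (1 - \<sigma> b))) mod int p + \<sigma> (star a b) * \<alpha> (star a b)) mod int p =
        (\<sigma> a * (\<alpha> a * ((\<sigma> b * \<alpha> b) mod int p) + i a * (1 - \<sigma> b))) mod int p"
      using assoc[of 0 a 0 b 1 "\<one>\<^bsub>E\<^esub>"] ab pos one
        circ[of 0 a 0 b] circ[of "(\<sigma> a * (i a * (1 - \<sigma> b))) mod int p" "star a b" 1 "\<one>\<^bsub>E\<^esub>"]
        circ[of 0 b 1 "\<one>\<^bsub>E\<^esub>"] circ[of 0 a "(\<sigma> b * \<alpha> b) mod int p" b]
      by (simp add: star_closed star_one u_one \<sigma>_char(4))
    moreover obtain y z where "(\<sigma> a * y) mod int p = 1 mod int p" "(\<sigma> b * z) mod int p = 1 mod int p"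
      using unit ab by blast
    ultimately show ?thesis
      using \<sigma>_star[OF ab] unfolding mod_eq_dvd_iff unfolding mod_unfold by Groebner_Basis.algebra
  qed
  \<comment> \<open>Associativity of \<open>(0, a), (0, b), (0, c)\<close> with
    \<open>\<sigma> c \<noteq> 1\<close>, divided by \<open>1 - \<sigma> c\<close>. For
    \<open>u = 1\<close> the cocycle is \<open>i\<close>, for \<open>u = \<sigma>\<close> it is
    \<open>\<sigma> i\<close>; the factor \<open>u\<close> covers both.\<close>
  have i_star: "(u (star a b) * i (star a b)) mod int p = (u a * i a + u a * \<alpha> a * (u b * i b)) mod int p"
    if ab: "a \<in> carrier E" "b \<in> carrier E" for a b
  proof (cases "\<forall>c\<in>carrier E. \<sigma> c = 1")
    case True
    then show ?thesis using i0 ab star_closed by simp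
  next
    case False
    then obtain c where c: "c \<in> carrier E" "\<sigma> c \<noteq> 1" by blast
    obtain x where "((1 - \<sigma> c) * x) mod int p = 1"
      by (rule residue_inverse_ex[OF p char_not_one_dvd[OF c]])
    then have x: "((1 - \<sigma> c) * x) mod int p = 1 mod int p" using pos by simp
    obtain y where y: "(\<sigma> a * y) mod int p = 1 mod int p" using unit ab by blast
    obtain z where z: "(\<sigma> b * z) mod int p = 1 mod int p" using unit ab by blast
    have eq: "(u c * ((\<sigma> a * (i a * (1 - \<sigma> b))) mod int p) + \<sigma> (star a b) * (i (star a b) * (1 - \<sigma> c))) mod int p =
        (\<sigma> a * (\<alpha> a * ((\<sigma> b * (i b * (1 - \<sigma> c))) mod int p) + i a * (1 - \<sigma> (star b c)))) mod int p"
      using assoc[of 0 a 0 b 0 c] ab pos c(1)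
        circ[of 0 a 0 b] circ[of "(\<sigma> a * (i a * (1 - \<sigma> b))) mod int p" "star a b" 0 c]
        circ[of 0 b 0 c] circ[of 0 a "(\<sigma> b * (i b * (1 - \<sigma> c))) mod int p" "star b c"]
      by (simp add: star_closed)
    have reduced: "(i (star a b) * \<sigma> b * (1 - \<sigma> c)) mod int p =
        (\<alpha> a * \<sigma> b * i b * (1 - \<sigma> c) + i a * (1 - \<sigma> b * \<sigma> c) - u c * i a * (1 - \<sigma> b)) mod int p"
      using eq y \<sigma>_star[OF ab] \<sigma>_star[OF ab(2) c(1)]
      unfolding mod_eq_dvd_iff unfolding mod_unfold by Groebner_Basis.algebra
    from u show ?thesis
    proof
      assume u: "u = (\<lambda>_. 1)"
      have "(i (star a b) * \<sigma> b * (1 - \<sigma> c)) mod int p =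
        ((\<alpha> a * i b + i a) * \<sigma> b * (1 - \<sigma> c)) mod int p"
        using reduced by (simp add: u algebra_simps)
      then have "i (star a b) mod int p = (i a + \<alpha> a * i b) mod int p"
        using x z unfolding mod_eq_dvd_iff by Groebner_Basis.algebra
      then show ?thesis by (simp add: u)
    next
      assume u: "u = \<sigma>"
      have "(i (star a b) * \<sigma> b * (1 - \<sigma> c)) mod int p =
        ((\<alpha> a * \<sigma> b * i b + i a) * (1 - \<sigma> c)) mod int p"
        using reduced by (simp add: u algebra_simps)
      then have "(i (star a b) * \<sigma> b) mod int p = (i a + \<alpha> a * \<sigma> b * i b) mod int p"
        using x unfolding mod_eq_dvd_iff by Groebner_Basis.algebra
      then show ?thesis
        unfolding u using \<sigma>_star[OF ab] unfolding mod_eq_dvd_iff by Groebner_Basis.algebra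
    qed
  qed
  \<comment> \<open>Chosen so that \<open>u t = \<sigma> \<alpha>\<close>, the coefficient of the
    second factor's \<open>Z_p\<close> coordinate in \<open>ext_brace\<close>.\<close>
  define t where "t = (\<lambda>a. if u = (\<lambda>_. 1) then (\<sigma> a * \<alpha> a) mod int p else \<alpha> a)"
  have ut: "(u a * t a) mod int p = (\<sigma> a * \<alpha> a) mod int p" for a
    using u by (auto simp: t_def)
  have t: "0 < t a \<and> t a < int p" if a: "a \<in> carrier E" for a
  proof -
    have "\<not> int p dvd \<sigma> a * \<alpha> a"
      using not_dvd_residue[OF p] \<sigma>_char(1,2) \<alpha> a p by (simp add: prime_dvd_mult_iff)
    then have "(\<sigma> a * \<alpha> a) mod int p \<noteq> 0" by (simp add: dvd_eq_mod_eq_0)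
    moreover have "0 \<le> (\<sigma> a * \<alpha> a) mod int p" using pos by simp
    ultimately have "0 < (\<sigma> a * \<alpha> a) mod int p" by linarith
    then show ?thesis using \<alpha>[OF a] pos by (simp add: t_def)
  qed
  have t_star: "t (star a b) = (t a * t b) mod int p" if ab: "a \<in> carrier E" "b \<in> carrier E" for a b
  proof -
    have "((\<sigma> (star a b) * \<alpha> (star a b)) mod int p) mod int p =
        ((\<sigma> a * \<alpha> a) mod int p * ((\<sigma> b * \<alpha> b) mod int p)) mod int p"
      using \<alpha>_star[OF ab] \<sigma>_star[OF ab] unfolding mod_eq_dvd_iff unfolding mod_unfold
      by Groebner_Basis.algebra
    then have "t (star a b) mod int p = (t a * t b) mod int p"
      using \<alpha>_star[OF ab] by (simp add: t_def)
    then show ?thesis using t[OF star_closed[OF ab]] by simp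
  qed
  have t_conj: "circ D (0, a) (m, \<one>\<^bsub>E\<^esub>) = circ D ((t a * m) mod int p, \<one>\<^bsub>E\<^esub>) (0, a)"
    if am: "a \<in> carrier E" "0 \<le> m" "m < int p" for a m
  proof -
    have "circ D (0, \<one>\<^bsub>E\<^esub>) (0, a) = (0, a)"
      using circ_one(2)[OF D, of "(0, a)"] am pos by (simp add: D_simps)
    then have i1: "(i \<one>\<^bsub>E\<^esub> * (1 - \<sigma> a)) mod int p = 0 mod int p"
      using circ[of 0 "\<one>\<^bsub>E\<^esub>" 0 a] am pos by (simp add: \<sigma>_char(4))
    have "(\<sigma> a * (\<alpha> a * m)) mod int p = (u a * ((t a * m) mod int p) + i \<one>\<^bsub>E\<^esub> * (1 - \<sigma> a)) mod int p"
      using ut[of a] i1 unfolding mod_eq_dvd_iff unfolding mod_unfold by Groebner_Basis.algebra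
    then show ?thesis
      using circ[of 0 a m "\<one>\<^bsub>E\<^esub>"] circ[of "(t a * m) mod int p" "\<one>\<^bsub>E\<^esub>" 0 a] am pos
      by (simp add: \<sigma>_char(4) star_one one_star)
  qed
  define \<omega> where "\<omega> = inv_into (carrier E) \<psi>"
  have \<omega>\<psi>: "\<omega> (\<psi> a) = a" if "a \<in> carrier E" for a
    using \<psi> that by (simp add: \<omega>_def bij_betw_def)
  have \<psi>\<omega>: "\<psi> (\<omega> x) = x" "\<omega> x \<in> carrier E" if "x \<in> carrier B" for x
    using \<psi> that by (auto simp: \<omega>_def bij_betw_def f_inv_into_f inv_into_into)
  have \<psi>_closed: "\<psi> a \<in> carrier B" if "a \<in> carrier E" for a
    using \<psi> that by (auto simp: bij_betw_def)
  have \<omega>_circ: "\<omega> (circ B x y) = star (\<omega> x) (\<omega> y)" if "x \<in> carrier B" "y \<in> carrier B" for x y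
    using \<psi>_star[of "\<omega> x" "\<omega> y"] \<psi>\<omega> that \<omega>\<psi>[of "star (\<omega> x) (\<omega> y)"] star_closed by simp
  have card: "finite (carrier (circ_group B))" "\<not> p dvd order (circ_group B)"
    using fin n bij_betw_same_card[OF \<psi>] bij_betw_finite[OF \<psi>] by (simp_all add: order_def)
  \<comment> \<open>\<open>star\<close> is not packaged as a group, so the cocycle is moved to the
    multiplicative group of \<open>B\<close>.\<close>
  have "u (\<omega> (x \<otimes>\<^bsub>circ_group B\<^esub> y)) * i (\<omega> (x \<otimes>\<^bsub>circ_group B\<^esub> y)) mod int p =
      (u (\<omega> x) * i (\<omega> x) + u (\<omega> x) * \<alpha> (\<omega> x) * (u (\<omega> y) * i (\<omega> y))) mod int p"
    if "x \<in> carrier (circ_group B)" "y \<in> carrier (circ_group B)" for x y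
    using that i_star \<psi>\<omega> by (simp add: \<omega>_circ)
  then obtain s where s: "0 \<le> s" "s < int p"
    "\<And>x. x \<in> carrier (circ_group B) \<Longrightarrow> u (\<omega> x) * i (\<omega> x) mod int p =
      (s - u (\<omega> x) * \<alpha> (\<omega> x) * s) mod int p"
    using cocycle_trivial[OF p skew_brace_circ_group[OF B] card,
        of "\<lambda>x. u (\<omega> x) * i (\<omega> x)" "\<lambda>x. u (\<omega> x) * \<alpha> (\<omega> x)"] by blast
  have s_eq: "(u a * i a) mod int p = (s - u a * \<alpha> a * s) mod int p" if "a \<in> carrier E" for a
    using s(3)[of "\<psi> a"] that \<psi>_closed \<omega>\<psi> by simp
  \<comment> \<open>The automorphism with scalar \<open>1\<close> and \<open>\<gamma>\<close> of
    index \<open>-s\<close>, followed by \<open>\<psi>\<close>: it subtracts the coboundary and so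
    removes \<open>i\<close>.\<close>
  let ?f = "\<lambda>(m, a). ((m - s * (1 - \<sigma> a)) mod int p, \<psi> a)"
  have iso: "?f \<in> brace_iso D (ext_brace p \<sigma>' u' t' B)"
    if \<sigma>': "\<And>a. a \<in> carrier E \<Longrightarrow> \<sigma>' (\<psi> a) = \<sigma> a" and t': "\<And>a. a \<in> carrier E \<Longrightarrow> t' (\<psi> a) = t a"
      and u': "\<And>a. a \<in> carrier E \<Longrightarrow> u' (\<psi> a) = u a" for \<sigma>' t' u'
  proof (rule brace_isoI)
    let ?C = "ext_brace p \<sigma>' u' t' B"
    have C: "carrier ?C = {0..<int p} \<times> carrier B"
      "(m, x) \<otimes>\<^bsub>?C\<^esub> (m', y) = ((m + \<sigma>' x * m') mod int p, x \<otimes>\<^bsub>B\<^esub> y)" for m x m' y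
      using Zp_semidirect_simps[OF p, of \<sigma>' B] by (simp_all add: ext_brace_def)
    show "bij_betw ?f (carrier D) (carrier ?C)"
    proof (rule bij_betw_byWitness[where f' = "\<lambda>(m, x). ((m + s * (1 - \<sigma> (\<omega> x))) mod int p, \<omega> x)"])
      show "\<forall>x\<in>carrier D. (case ?f x of (m, x) \<Rightarrow> ((m + s * (1 - \<sigma> (\<omega> x))) mod int p, \<omega> x)) = x"
        by (auto simp: D_simps \<omega>\<psi> mod_simps)
      show "\<forall>y\<in>carrier ?C. ?f (case y of (m, x) \<Rightarrow> ((m + s * (1 - \<sigma> (\<omega> x))) mod int p, \<omega> x)) = y"
        by (auto simp: C \<psi>\<omega> mod_simps)
    qed (use pos \<psi>\<omega> \<psi>_closed in \<open>auto simp: D_simps C\<close>)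
    fix x y assume "x \<in> carrier D" "y \<in> carrier D"
    then obtain m a l b where x: "x = (m, a)" "0 \<le> m" "m < int p" and y: "y = (l, b)" "0 \<le> l" "l < int p"
      and ab: "a \<in> carrier E" "b \<in> carrier E" by (auto simp: D_simps)
    have "\<sigma> (a \<otimes>\<^bsub>E\<^esub> b) mod int p = (\<sigma> a * \<sigma> b) mod int p" using ab by (simp add: \<sigma>_char)
    then have "((m + \<sigma> a * l) mod int p - s * (1 - \<sigma> (a \<otimes>\<^bsub>E\<^esub> b))) mod int p =
        ((m - s * (1 - \<sigma> a)) mod int p + \<sigma> a * ((l - s * (1 - \<sigma> b)) mod int p)) mod int p"
      unfolding mod_eq_dvd_iff unfolding mod_unfold by Groebner_Basis.algebra
    then show "?f (x \<otimes>\<^bsub>D\<^esub> y) = ?f x \<otimes>\<^bsub>?C\<^esub> ?f y"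
      using ab by (simp add: x y D_simps C \<sigma>' \<psi>_mult)
    have "((u b * m + \<sigma> a * (\<alpha> a * l + i a * (1 - \<sigma> b))) mod int p - s * (1 - \<sigma> (star a b))) mod int p =
        (u b * ((m - s * (1 - \<sigma> a)) mod int p) + u a * t a * ((l - s * (1 - \<sigma> b)) mod int p)) mod int p"
      using u
    proof
      assume u: "u = (\<lambda>_. 1)"
      show ?thesis
        using s_eq[OF ab(1)] \<sigma>_star[OF ab] ut[of a] unfolding u mod_eq_dvd_iff unfolding mod_unfold
        by Groebner_Basis.algebra
    next
      assume u: "u = \<sigma>"
      show ?thesis
        using s_eq[OF ab(1)] \<sigma>_star[OF ab] ut[of a] unfolding u mod_eq_dvd_iff unfolding mod_unfold
        by Groebner_Basis.algebra
    qed
    then show "?f (circ D x y) = circ ?C (?f x) (?f y)"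
      using ab x y by (simp add: circ circ_ext_brace t' u' \<psi>_star)
  qed
  have "brace_iso D (ext_brace p \<sigma>' (\<lambda>_. 1) t' B) \<noteq> {} \<or> brace_iso D (ext_brace p \<sigma>' \<sigma>' t' B) \<noteq> {}"
    if "\<forall>a\<in>carrier E. \<sigma>' (\<psi> a) = \<sigma> a" "\<forall>a\<in>carrier E. t' (\<psi> a) = t a" for \<sigma>' t'
    using u iso[of \<sigma>' t' "\<lambda>_. 1"] iso[of \<sigma>' t' \<sigma>'] that by auto
  then show ?thesis using t t_star t_conj by (intro exI[of _ t]) blast
qed

lemma snd_circ:
  assumes "x \<in> carrier D" "y \<in> carrier D"
  shows "snd (circ D x y) = star (snd x) (snd y)"
proof -
  obtain u \<alpha> i where "\<And>m a l b. 0 \<le> m \<Longrightarrow> m < int p \<Longrightarrow> a \<in> carrier E \<Longrightarrow>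
      0 \<le> l \<Longrightarrow> l < int p \<Longrightarrow> b \<in> carrier E \<Longrightarrow>
      circ D (m, a) (l, b) = ((u b * m + \<sigma> a * (\<alpha> a * l + i a * (1 - \<sigma> b))) mod int p, star a b)"
    using circ_formula by metis
  then show ?thesis using assms by (auto simp: D_simps)
qed

lemma circ_Zp_part_add:
  assumes "0 \<le> m" "m < int p" "0 \<le> l" "l < int p"
  shows "circ D (m, \<one>\<^bsub>E\<^esub>) (l, \<one>\<^bsub>E\<^esub>) = ((m + l) mod int p, \<one>\<^bsub>E\<^esub>)"
proof -
  obtain i where "\<And>m l b. 0 \<le> m \<Longrightarrow> m < int p \<Longrightarrow> 0 \<le> l \<Longrightarrow> l < int p \<Longrightarrow> b \<in> carrier E \<Longrightarrow>
    circ D (m, \<one>\<^bsub>E\<^esub>) (l, b) = ((m + l + i m * (1 - \<sigma> b)) mod int p, b)"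
    using circ_Zp_part by blast
  from this[OF assms E.one_closed] show ?thesis by (simp add: \<sigma>_char(4))
qed

end

section \<open>Classification\<close>

lemma brace_iso_trans: "f \<in> brace_iso C D \<Longrightarrow> g \<in> brace_iso D F \<Longrightarrow> g \<circ> f \<in> brace_iso C F"
  by (auto simp: brace_iso_def intro: iso_set_trans)

lemma brace_iso_brace_of_regular:
  assumes C: "skew_brace C" and CA: "additive_group_is C A"
  shows "id \<in> brace_iso C (brace_of_regular A (regular_of_brace C))"
  using circ_brace_of_regular_of_brace[OF CA C] CA
  by (intro brace_isoI) (auto simp: brace_of_regular_def additive_group_is_def)

lemma group_regular_group: "skew_brace B \<Longrightarrow> group (regular_group B)"
  unfolding regular_group_def
  by (intro group.subgroup_imp_group subgroup_regular_of_brace group.group_holomorph skew_brace_group)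

locale classification =
  fixes p :: nat and B :: "'a skew_brace" and \<sigma> :: "'a \<Rightarrow> int" and R
  assumes p: "prime p" and B: "skew_brace B" and fin: "finite (carrier B)" and n: "\<not> p dvd order B"
    and normal: "\<And>H :: nat monoid. group H \<Longrightarrow> order H = order B * p \<Longrightarrow> \<exists>N. N \<lhd> H \<and> card N = p"
    and \<sigma>: "\<sigma> \<in> brace_chars p B" and R: "regular_subgroup (Zp_semidirect p \<sigma> B) R"
begin

abbreviation "A \<equiv> Zp_semidirect p \<sigma> B"
abbreviation "D \<equiv> brace_of_regular A R"

lemma \<sigma>_hom: "\<sigma> \<in> hom B (units_of (Zp p))"
  using \<sigma> by (simp add: brace_chars_def)

lemma group_A: "group A"
  by (rule group_Zp_semidirect[OF p skew_brace_group[OF B] \<sigma>_hom])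

lemma D: "skew_brace D" "regular_of_brace D = R" "additive_group_is D A"
  using brace_of_regular[OF group_A R] additive_brace_of_regular by auto

sublocale ext: Zp_brace p B \<sigma> D
proof (rule Zp_brace.intro)
  show "prime p" "finite (carrier B)" "\<not> p dvd order B" by (rule p fin n)+
  show "group B" by (rule skew_brace_group[OF B])
  show "\<sigma> \<in> hom B (units_of (Zp p))" by (rule \<sigma>_hom)
  show "skew_brace D" "additive_group_is D A" using D by auto
  show "\<phi> = \<one>\<^bsub>AutoGroup B\<^esub>" if "\<phi> \<in> auto B" "\<phi> [^]\<^bsub>AutoGroup B\<^esub> p = \<one>\<^bsub>AutoGroup B\<^esub>" for \<phi>
    by (rule no_automorphism_of_order_p[OF p skew_brace_group[OF B] fin n normal that])
  have "carrier (circ_group D) = {0..<int p} \<times> carrier B"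
    by (simp add: brace_of_regular_def Zp_semidirect_simps[OF p])
  then have "finite (carrier (circ_group D))" "order (circ_group D) = order B * p"
    using fin by (simp_all add: order_def card_cartesian_product)
  then show "\<exists>P. P \<lhd> circ_group D \<and> card P = p"
    using normal_subgroup_transfer[OF normal skew_brace_circ_group[OF D(1)]] by metis
qed

definition quotient_map :: "((int \<times> 'a) set \<Rightarrow> 'a) \<Rightarrow> 'a \<Rightarrow> 'a" where
  "quotient_map \<psi> a = \<psi> ({0..<int p} \<times> {a})"

lemma quotient_map:
  assumes \<psi>: "\<psi> \<in> brace_iso (quotient_of_regular p B \<sigma> R) B"
  shows "bij_betw (quotient_map \<psi>) (carrier B) (carrier B)"
    "\<And>a b. a \<in> carrier B \<Longrightarrow> b \<in> carrier B \<Longrightarrow>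
      quotient_map \<psi> (a \<otimes>\<^bsub>B\<^esub> b) = quotient_map \<psi> a \<otimes>\<^bsub>B\<^esub> quotient_map \<psi> b"
    "\<And>a b. a \<in> carrier B \<Longrightarrow> b \<in> carrier B \<Longrightarrow>
      quotient_map \<psi> (ext.star a b) = circ B (quotient_map \<psi> a) (quotient_map \<psi> b)"
proof -
  have \<psi>: "\<psi> \<in> brace_iso (brace_quotient D (Zp_part p B)) B"
    using \<psi> by (simp add: quotient_of_regular_def)
  have snd_star: "snd (circ D x y) = ext.star (snd x) (snd y)" if "x \<in> carrier D" "y \<in> carrier D" for x y
    by (rule ext.snd_circ[OF that])
  note Q = brace_quotient_isoD[OF p B \<sigma>_hom D(1,3) snd_star \<psi>, folded quotient_map_def]
  show "bij_betw (quotient_map \<psi>) (carrier B) (carrier B)"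
    using Q(1) by (simp add: quotient_map_def[abs_def])
  fix a b assume "a \<in> carrier B" "b \<in> carrier B"
  then show "quotient_map \<psi> (a \<otimes>\<^bsub>B\<^esub> b) = quotient_map \<psi> a \<otimes>\<^bsub>B\<^esub> quotient_map \<psi> b"
    "quotient_map \<psi> (ext.star a b) = circ B (quotient_map \<psi> a) (quotient_map \<psi> b)"
    using Q(2,3) by simp_all
qed

lemma quotient_iso_ext_brace:
  assumes \<psi>: "\<psi> \<in> brace_iso (quotient_of_regular p B \<sigma> R) B"
  shows "\<exists>t. (\<forall>a\<in>carrier B. 0 < t a \<and> t a < int p) \<and>
    (\<forall>a\<in>carrier B. \<forall>b\<in>carrier B. t (ext.star a b) = (t a * t b) mod int p) \<and>
    (\<forall>a\<in>carrier B. \<forall>m. 0 \<le> m \<longrightarrow> m < int p \<longrightarrow>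
      circ D (0, a) (m, \<one>\<^bsub>B\<^esub>) = circ D ((t a * m) mod int p, \<one>\<^bsub>B\<^esub>) (0, a)) \<and>
    (\<forall>\<sigma>' t'. (\<forall>a\<in>carrier B. \<sigma>' (quotient_map \<psi> a) = \<sigma> a) \<longrightarrow>
      (\<forall>a\<in>carrier B. t' (quotient_map \<psi> a) = t a) \<longrightarrow>
      brace_iso D (ext_brace p \<sigma>' (\<lambda>_. 1) t' B) \<noteq> {} \<or> brace_iso D (ext_brace p \<sigma>' \<sigma>' t' B) \<noteq> {})"
  by (rule ext.iso_ext_brace[OF B quotient_map[OF \<psi>]])

lemma iso_circ_group: "fst \<in> iso ((holomorph A)\<lparr>carrier := R\<rparr>) (circ_group D)"
  using fst_iso_circ_group[OF D(1)] D(2) holomorph_additive_group[OF D(3)] by simp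

text \<open>The point is that the \<open>t\<close> of \<open>quotient_iso_ext_brace\<close> is
  \<open>\<tau>\<close> read through \<open>\<psi>\<close>. Both are conjugation on
  \<open>Z_p\<close>, one in the multiplicative group of \<open>D\<close> and one in
  \<open>Z_p \<rtimes> F\<close>, and \<open>\<Theta>\<close> maps one \<open>Z_p\<close> to the
  other because it induces \<open>\<psi>\<close>.\<close>

lemma in_class_imp_conjugate:
  assumes \<tau>: "\<tau> \<in> hom (regular_group B) (units_of (Zp p))" and cls: "in_class p B \<sigma> \<tau> R"
  shows "conjugate_in (holomorph A) (G_sub p B \<sigma> \<tau>) R \<or> conjugate_in (holomorph A) (G'_sub p B \<sigma> \<tau>) R"
proof -
  interpret B: group B by (rule skew_brace_group[OF B])
  have pos: "0 < int p" "1 < int p" using p_gt_1[OF p] by simp_all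
  let ?F = "Zp_semidirect p \<tau> (regular_group B)"
  note F_simps = Zp_semidirect_simps[OF p, of \<tau> "regular_group B"]
  obtain \<Theta> \<psi> where \<Theta>: "\<Theta> \<in> iso ((holomorph A)\<lparr>carrier := R\<rparr>) ?F"
    and \<psi>: "\<psi> \<in> brace_iso (quotient_of_regular p B \<sigma> R) B"
    and \<sigma>_\<psi>: "\<forall>m\<in>carrier (Zp p). \<forall>a\<in>carrier B. \<sigma> (\<psi> (Zp_part p B #>\<^bsub>A\<^esub> (m, a))) = \<sigma> a"
    and snd_\<Theta>: "\<forall>x f. (x, f) \<in> R \<longrightarrow> (let b = \<psi> (Zp_part p B #>\<^bsub>A\<^esub> x) in snd (\<Theta> (x, f)) = (b, lam B b))"
    using cls unfolding in_class_def by blast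
  let ?\<psi> = "quotient_map \<psi>"
  have coset: "\<psi> (Zp_part p B #>\<^bsub>A\<^esub> (m, a)) = ?\<psi> a" if "0 \<le> m" "m < int p" "a \<in> carrier B" for m a
    using Zp_part_coset[OF p B.is_group \<sigma>_hom, of m a] that by (simp add: quotient_map_def)
  have \<sigma>_\<psi>: "\<sigma> (?\<psi> a) = \<sigma> a" if "a \<in> carrier B" for a
    using bspec[OF bspec[OF \<sigma>_\<psi>, of 0] that] coset[of 0 a] that pos by (simp add: Zp_carrier[OF p])
  have \<psi>_closed: "?\<psi> a \<in> carrier B" if "a \<in> carrier B" for a
    using quotient_map(1)[OF \<psi>] that by (auto simp: bij_betw_def)
  have \<psi>_one: "?\<psi> \<one>\<^bsub>B\<^esub> = \<one>\<^bsub>B\<^esub>"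
    using quotient_map(2)[OF \<psi>, of "\<one>\<^bsub>B\<^esub>" "\<one>\<^bsub>B\<^esub>"] \<psi>_closed[of "\<one>\<^bsub>B\<^esub>"] by simp
  obtain t where t: "\<forall>a\<in>carrier B. 0 < t a \<and> t a < int p"
    and t_conj: "\<forall>a\<in>carrier B. \<forall>m. 0 \<le> m \<longrightarrow> m < int p \<longrightarrow>
      circ D (0, a) (m, \<one>\<^bsub>B\<^esub>) = circ D ((t a * m) mod int p, \<one>\<^bsub>B\<^esub>) (0, a)"
    and iso: "\<forall>\<sigma>' t'. (\<forall>a\<in>carrier B. \<sigma>' (?\<psi> a) = \<sigma> a) \<longrightarrow> (\<forall>a\<in>carrier B. t' (?\<psi> a) = t a) \<longrightarrow>
      brace_iso D (ext_brace p \<sigma>' (\<lambda>_. 1) t' B) \<noteq> {} \<or> brace_iso D (ext_brace p \<sigma>' \<sigma>' t' B) \<noteq> {}"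
    using quotient_iso_ext_brace[OF \<psi>] by (elim exE conjE) (rule that)
  define h where "h = (\<lambda>x. \<Theta> (x, lam D x))"
  have R_elem: "(x, lam D x) \<in> R" if "x \<in> carrier D" for x
    using that D(2) unfolding regular_of_brace_def by blast
  define q where "q = (\<lambda>x. fst (h x))"
  have snd_h: "snd (h x) = (?\<psi> (snd x), lam B (?\<psi> (snd x)))" if "x \<in> carrier D" for x
    using snd_\<Theta> R_elem[OF that] coset[of "fst x" "snd x"] that
    by (cases x) (auto simp: h_def Let_def ext.D_simps)
  have h_eq: "h x = (q x, (?\<psi> (snd x), lam B (?\<psi> (snd x))))" if "x \<in> carrier D" for x
    using snd_h[OF that] by (cases "h x") (simp add: q_def)
  have \<Theta>_mult: "\<Theta> (x \<otimes>\<^bsub>holomorph A\<^esub> y) = \<Theta> x \<otimes>\<^bsub>?F\<^esub> \<Theta> y" if "x \<in> R" "y \<in> R" for x y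
    using \<Theta> that by (simp add: iso_def hom_def)
  have h_closed: "h x \<in> carrier ?F" if "x \<in> carrier D" for x
    using \<Theta> R_elem[OF that] by (auto simp: iso_def hom_def h_def)
  have q_range: "0 \<le> q x" "q x < int p" if "x \<in> carrier D" for x
    using h_closed[OF that] h_eq[OF that] by (simp_all add: F_simps)
  have h_circ: "h (circ D x y) = h x \<otimes>\<^bsub>?F\<^esub> h y" if "x \<in> carrier D" "y \<in> carrier D" for x y
    using \<Theta>_mult[OF R_elem[OF that(1)] R_elem[OF that(2)]] mult_regular_of_brace[OF D(1) that]
      holomorph_additive_group[OF D(3)] by (simp add: h_def)
  have q_circ: "q (circ D x y) = (q x + \<tau> (?\<psi> (snd x), lam B (?\<psi> (snd x))) * q y) mod int p"
    if "x \<in> carrier D" "y \<in> carrier D" for x y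
  proof -
    have "q (circ D x y) = fst (h x \<otimes>\<^bsub>?F\<^esub> h y)" using h_circ[OF that] by (simp add: q_def)
    then show ?thesis unfolding h_eq[OF that(1)] h_eq[OF that(2)] by (simp add: F_simps)
  qed
  have \<tau>_one: "\<tau> (\<one>\<^bsub>B\<^esub>, lam B \<one>\<^bsub>B\<^esub>) = 1"
    using hom_units_one[OF p group_regular_group[OF B] \<tau>] lam_one[OF B] by (simp add: regular_group_def)
  have \<tau>_range: "0 < \<tau> (a, lam B a)" "\<tau> (a, lam B a) < int p" if "a \<in> carrier B" for a
    using \<tau> that unfolding hom_units_iff[OF p] by (auto simp: regular_group_def regular_of_brace_def)
  let ?r = "\<lambda>m. q (m, \<one>\<^bsub>B\<^esub>)"
  have mem: "(m, a) \<in> carrier D" if "0 \<le> m" "m < int p" "a \<in> carrier B" for m a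
    using that by (simp add: ext.D_simps)
  have r: "?r m mod int p = (m * ?r 1) mod int p" if "0 \<le> m" "m < int p" for m
  proof (rule additive_residue[OF p _ that])
    fix x y assume "0 \<le> x" "x < int p" "0 \<le> y" "y < int p"
    then show "?r ((x + y) mod int p) mod int p = (?r x + ?r y) mod int p"
      using q_circ[of "(x, \<one>\<^bsub>B\<^esub>)" "(y, \<one>\<^bsub>B\<^esub>)"] by (simp add: mem ext.circ_Zp_part_add \<psi>_one \<tau>_one)
  qed
  \<comment> \<open>Injectivity of \<open>\<Theta>\<close> makes the scalar \<open>?r 1\<close>, by
    which it acts on \<open>Z_p\<close>, a unit.\<close>
  have "h (1, \<one>\<^bsub>B\<^esub>) \<noteq> h (0, \<one>\<^bsub>B\<^esub>)"
  proof
    assume eq: "h (1, \<one>\<^bsub>B\<^esub>) = h (0, \<one>\<^bsub>B\<^esub>)"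
    have "inj_on \<Theta> R" using \<Theta> by (simp add: iso_def bij_betw_def)
    from inj_onD[OF this eq[unfolded h_def]] show False
      using R_elem[OF mem[of 1 "\<one>\<^bsub>B\<^esub>"]] R_elem[OF mem[of 0 "\<one>\<^bsub>B\<^esub>"]] pos by simp
  qed
  then have "?r 1 \<noteq> ?r 0"
    using h_eq[OF mem[of 1 "\<one>\<^bsub>B\<^esub>"]] h_eq[OF mem[of 0 "\<one>\<^bsub>B\<^esub>"]] pos by auto
  moreover have "?r 0 = 0"
    using r[of 0] q_range[OF mem[of 0 "\<one>\<^bsub>B\<^esub>"]] pos by simp
  ultimately have r1: "\<not> int p dvd ?r 1"
    using q_range[OF mem[of 1 "\<one>\<^bsub>B\<^esub>"]] pos by (auto simp: zdvd_not_zless order_less_le)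
  have "\<tau> (?\<psi> a, lam B (?\<psi> a)) = t a" if a: "a \<in> carrier B" for a
  proof -
    have ta: "0 \<le> t a" "t a < int p" using t a by auto
    \<comment> \<open>The conjugation formula at \<open>m = 1\<close>; expanding \<open>q\<close> on
      both sides leaves \<open>\<tau>\<close> and \<open>t a\<close> times the same unit
      \<open>?r 1\<close>.\<close>
    have "q (circ D (0, a) (1, \<one>\<^bsub>B\<^esub>)) = q (circ D (t a, \<one>\<^bsub>B\<^esub>) (0, a))"
      using t_conj a pos ta by simp
    then have "(q (0, a) + \<tau> (?\<psi> a, lam B (?\<psi> a)) * ?r 1) mod int p = (?r (t a) + q (0, a)) mod int p"
      using q_circ[OF mem[of 0 a] mem[of 1 "\<one>\<^bsub>B\<^esub>"]] q_circ[OF mem[OF ta B.one_closed] mem[of 0 a]] a pos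
      by (simp add: \<psi>_one \<tau>_one)
    then have "int p dvd (\<tau> (?\<psi> a, lam B (?\<psi> a)) - t a) * ?r 1"
      using r[OF ta] unfolding mod_eq_dvd_iff by Groebner_Basis.algebra
    then have "\<tau> (?\<psi> a, lam B (?\<psi> a)) mod int p = t a mod int p"
      using r1 p by (simp add: prime_dvd_mult_iff mod_eq_dvd_iff)
    then show ?thesis using ta \<tau>_range[OF \<psi>_closed[OF a]] by simp
  qed
  then have iso: "brace_iso D (ext_brace p \<sigma> (\<lambda>_. 1) (\<lambda>a. \<tau> (a, lam B a)) B) \<noteq> {} \<or>
      brace_iso D (ext_brace p \<sigma> \<sigma> (\<lambda>a. \<tau> (a, lam B a)) B) \<noteq> {}"
    using iso[rule_format, of \<sigma> "\<lambda>a. \<tau> (a, lam B a)"] \<sigma>_\<psi> by blast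
  interpret G: brace_extension p B \<sigma> "\<lambda>_. 1" "\<lambda>a. \<tau> (a, lam B a)"
    using p B \<sigma> brace_chars_one regular_hom_units[OF B \<tau>] by unfold_locales auto
  interpret G': brace_extension p B \<sigma> \<sigma> "\<lambda>a. \<tau> (a, lam B a)"
    using p B \<sigma> regular_hom_units[OF B \<tau>] by unfold_locales auto
  show ?thesis
    using iso brace_iso_imp_conjugate_regular[OF group_A G.skew_brace_C additive_ext_brace R]
      brace_iso_imp_conjugate_regular[OF group_A G'.skew_brace_C additive_ext_brace R]
    unfolding G_sub_eq[OF p B \<sigma> \<tau>] G'_sub_eq[OF p B \<sigma> \<tau>] by blast
qed

text \<open>An arbitrary \<open>\<psi>\<close> need not preserve \<open>\<sigma>\<close>, so
  \<open>\<sigma>\<close> and \<open>t\<close> are carried to \<open>B\<close> along its inverse.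
  The new \<open>\<sigma>'\<close> may define a different additive group, which is why the
  conclusion is an isomorphism of braces and not conjugacy in one holomorph.\<close>

lemma brace_iso_some_pair:
  assumes iso_R: "(holomorph A)\<lparr>carrier := R\<rparr> \<cong> K" and quot: "brace_iso (quotient_of_regular p B \<sigma> R) B \<noteq> {}"
  obtains \<sigma>' \<tau>' where "\<sigma>' \<in> brace_chars p B" "\<tau>' \<in> hom (regular_group B) (units_of (Zp p))"
    "Zp_semidirect p \<tau>' (regular_group B) \<cong> K"
    "brace_iso D (brace_of_regular (Zp_semidirect p \<sigma>' B) (G_sub p B \<sigma>' \<tau>')) \<noteq> {} \<or>
      brace_iso D (brace_of_regular (Zp_semidirect p \<sigma>' B) (G'_sub p B \<sigma>' \<tau>')) \<noteq> {}"
proof -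
  interpret B: group B by (rule skew_brace_group[OF B])
  interpret circB: group "circ_group B" by (rule skew_brace_circ_group[OF B])
  obtain \<psi> where \<psi>: "\<psi> \<in> brace_iso (quotient_of_regular p B \<sigma> R) B" using quot by blast
  let ?\<psi> = "quotient_map \<psi>"
  obtain t where t: "\<forall>a\<in>carrier B. 0 < t a \<and> t a < int p"
    and t_star: "\<forall>a\<in>carrier B. \<forall>b\<in>carrier B. t (ext.star a b) = (t a * t b) mod int p"
    and iso: "\<forall>\<sigma>' t'. (\<forall>a\<in>carrier B. \<sigma>' (?\<psi> a) = \<sigma> a) \<longrightarrow> (\<forall>a\<in>carrier B. t' (?\<psi> a) = t a) \<longrightarrow>
      brace_iso D (ext_brace p \<sigma>' (\<lambda>_. 1) t' B) \<noteq> {} \<or> brace_iso D (ext_brace p \<sigma>' \<sigma>' t' B) \<noteq> {}"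
    using quotient_iso_ext_brace[OF \<psi>] by (elim exE conjE) (rule that)
  define \<omega> where "\<omega> = inv_into (carrier B) ?\<psi>"
  note bij = quotient_map(1)[OF \<psi>]
  have \<omega>\<psi>: "\<omega> (?\<psi> a) = a" if "a \<in> carrier B" for a
    using bij that by (simp add: \<omega>_def bij_betw_def)
  have \<psi>\<omega>: "?\<psi> (\<omega> x) = x" "\<omega> x \<in> carrier B" if "x \<in> carrier B" for x
    using bij that by (auto simp: \<omega>_def bij_betw_def f_inv_into_f inv_into_into)
  have \<omega>_mult: "\<omega> (x \<otimes>\<^bsub>B\<^esub> y) = \<omega> x \<otimes>\<^bsub>B\<^esub> \<omega> y" "\<omega> (circ B x y) = ext.star (\<omega> x) (\<omega> y)"
    if "x \<in> carrier B" "y \<in> carrier B" for x y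
    using quotient_map(2,3)[OF \<psi>, of "\<omega> x" "\<omega> y"] \<psi>\<omega> that
      \<omega>\<psi>[of "\<omega> x \<otimes>\<^bsub>B\<^esub> \<omega> y"] \<omega>\<psi>[of "ext.star (\<omega> x) (\<omega> y)"] ext.star_closed by simp_all
  define \<sigma>' where "\<sigma>' = (\<lambda>x. \<sigma> (\<omega> x))"
  define \<tau>' :: "'a \<times> ('a \<Rightarrow> 'a) \<Rightarrow> int" where "\<tau>' = (\<lambda>(x, f). t (\<omega> x))"
  \<comment> \<open>For the multiplication of \<open>B\<close> this is \<open>char_star\<close>,
    since \<open>\<omega>\<close> turns that multiplication into \<open>star\<close>.\<close>
  have \<sigma>': "\<sigma>' \<in> brace_chars p B"
    unfolding brace_chars_def using \<psi>\<omega> ext.\<sigma>_char ext.char_star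
    by (auto simp: hom_units_iff[OF p] \<sigma>'_def \<omega>_mult)
  have \<tau>': "\<tau>' \<in> hom (regular_group B) (units_of (Zp p))"
    unfolding hom_units_iff[OF p] regular_group_def
    using t t_star \<psi>\<omega> \<omega>_mult mult_regular_of_brace[OF B]
    by (auto simp: regular_of_brace_def \<tau>'_def simp del: mult_holomorph)
  have iso': "brace_iso D (ext_brace p \<sigma>' (\<lambda>_. 1) (\<lambda>a. \<tau>' (a, lam B a)) B) \<noteq> {} \<or>
      brace_iso D (ext_brace p \<sigma>' \<sigma>' (\<lambda>a. \<tau>' (a, lam B a)) B) \<noteq> {}"
    using iso[rule_format, of \<sigma>' "\<lambda>a. \<tau>' (a, lam B a)"] \<omega>\<psi> by (simp add: \<sigma>'_def \<tau>'_def)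
  interpret G: brace_extension p B \<sigma>' "\<lambda>_. 1" "\<lambda>a. \<tau>' (a, lam B a)"
    using p B \<sigma>' brace_chars_one regular_hom_units[OF B \<tau>'] by unfold_locales auto
  interpret G': brace_extension p B \<sigma>' \<sigma>' "\<lambda>a. \<tau>' (a, lam B a)"
    using p B \<sigma>' regular_hom_units[OF B \<tau>'] by unfold_locales auto
  have "circ_group D \<cong> Zp_semidirect p \<tau>' (regular_group B)"
    using iso'
  proof
    assume "brace_iso D (ext_brace p \<sigma>' (\<lambda>_. 1) (\<lambda>a. \<tau>' (a, lam B a)) B) \<noteq> {}"
    then obtain f where "f \<in> iso (circ_group D) (circ_group G.C)" by (auto simp: brace_iso_def)
    from iso_set_trans[OF this G.iso_circ_C] show ?thesis by (auto simp: is_iso_def)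
  next
    assume "brace_iso D (ext_brace p \<sigma>' \<sigma>' (\<lambda>a. \<tau>' (a, lam B a)) B) \<noteq> {}"
    then obtain f where "f \<in> iso (circ_group D) (circ_group G'.C)" by (auto simp: brace_iso_def)
    from iso_set_trans[OF this G'.iso_circ_C] show ?thesis by (auto simp: is_iso_def)
  qed
  then have "Zp_semidirect p \<tau>' (regular_group B) \<cong> circ_group D"
    by (rule group.iso_sym[OF skew_brace_circ_group[OF D(1)]])
  also have "circ_group D \<cong> (holomorph A)\<lparr>carrier := R\<rparr>"
  proof (rule group.iso_sym)
    show "group ((holomorph A)\<lparr>carrier := R\<rparr>)"
      using R group.subgroup_imp_group[OF group.group_holomorph[OF group_A]]
      by (simp add: regular_subgroup_def)
    show "(holomorph A)\<lparr>carrier := R\<rparr> \<cong> circ_group D"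
      using iso_circ_group by (auto simp: is_iso_def)
  qed
  also note iso_R
  finally have K: "Zp_semidirect p \<tau>' (regular_group B) \<cong> K" .
  have "brace_iso D (brace_of_regular (Zp_semidirect p \<sigma>' B) (G_sub p B \<sigma>' \<tau>')) \<noteq> {} \<or>
      brace_iso D (brace_of_regular (Zp_semidirect p \<sigma>' B) (G'_sub p B \<sigma>' \<tau>')) \<noteq> {}"
    using iso' brace_iso_trans[OF _ brace_iso_brace_of_regular[OF G.skew_brace_C additive_ext_brace]]
      brace_iso_trans[OF _ brace_iso_brace_of_regular[OF G'.skew_brace_C additive_ext_brace]]
    unfolding G_sub_eq[OF p B \<sigma>' \<tau>'] G'_sub_eq[OF p B \<sigma>' \<tau>'] by blast
  then show ?thesis by (rule that[OF \<sigma>' \<tau>' K])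
qed

end

theorem theorem2p10:
  fixes p n :: nat
    and B :: "'a skew_brace"
    and \<sigma> :: "'a \<Rightarrow> int"
    and \<tau> :: "'a \<times> ('a \<Rightarrow> 'a) \<Rightarrow> int"
  assumes "prime p" and "odd p" and "n > 0" and "\<not> p dvd n"
    and "\<And>H :: nat monoid. group H \<Longrightarrow> order H = n * p \<Longrightarrow> \<exists>N. N \<lhd> H \<and> card N = p"
    and "\<not> p dvd theta n"
    and "skew_brace B" and "order B = n"
    and "\<sigma> \<in> brace_chars p B"
    and "\<tau> \<in> hom (regular_group B) (units_of (Zp p))"
  shows
    "(\<comment> \<open>(1)\<close>
      regular_subgroup (Zp_semidirect p \<sigma> B) (G_sub p B \<sigma> \<tau>) \<and>
      regular_subgroup (Zp_semidirect p \<sigma> B) (G'_sub p B \<sigma> \<tau>) \<and>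
      (holomorph (Zp_semidirect p \<sigma> B))\<lparr>carrier := G_sub p B \<sigma> \<tau>\<rparr>
        \<cong> Zp_semidirect p \<tau> (regular_group B) \<and>
      (holomorph (Zp_semidirect p \<sigma> B))\<lparr>carrier := G'_sub p B \<sigma> \<tau>\<rparr>
        \<cong> Zp_semidirect p \<tau> (regular_group B))
     \<and>
     (\<comment> \<open>(2)\<close>
      G_sub p B (\<lambda>_. \<one>\<^bsub>Zp p\<^esub>) \<tau> = G'_sub p B (\<lambda>_. \<one>\<^bsub>Zp p\<^esub>) \<tau>)
     \<and>
     (\<comment> \<open>(3)\<close>
      (\<exists>a\<in>carrier B. \<sigma> a \<noteq> \<one>\<^bsub>Zp p\<^esub>) \<longrightarrow>
      \<not> conjugate_in (holomorph (Zp_semidirect p \<sigma> B)) (G_sub p B \<sigma> \<tau>) (G'_sub p B \<sigma> \<tau>))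
     \<and>
     (\<comment> \<open>(4), for a fixed pair of characters\<close>
      \<forall>R. regular_subgroup (Zp_semidirect p \<sigma> B) R \<and> in_class p B \<sigma> \<tau> R \<longleftrightarrow>
          conjugate_in (holomorph (Zp_semidirect p \<sigma> B)) (G_sub p B \<sigma> \<tau>) R \<or>
          conjugate_in (holomorph (Zp_semidirect p \<sigma> B)) (G'_sub p B \<sigma> \<tau>) R)
     \<and>
     (\<comment> \<open>(4), for arbitrary isomorphisms\<close>
      \<forall>R. regular_subgroup (Zp_semidirect p \<sigma> B) R \<and>
          (holomorph (Zp_semidirect p \<sigma> B))\<lparr>carrier := R\<rparr>
            \<cong> Zp_semidirect p \<tau> (regular_group B) \<and>
          brace_iso (quotient_of_regular p B \<sigma> R) B \<noteq> {} \<longrightarrow>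
          (\<exists>\<sigma>' \<tau>'. \<sigma>' \<in> brace_chars p B \<and>
             \<tau>' \<in> hom (regular_group B) (units_of (Zp p)) \<and>
             Zp_semidirect p \<tau>' (regular_group B) \<cong> Zp_semidirect p \<tau> (regular_group B) \<and>
             (brace_iso (brace_of_regular (Zp_semidirect p \<sigma> B) R)
                (brace_of_regular (Zp_semidirect p \<sigma>' B) (G_sub p B \<sigma>' \<tau>')) \<noteq> {} \<or>
              brace_iso (brace_of_regular (Zp_semidirect p \<sigma> B) R)
                (brace_of_regular (Zp_semidirect p \<sigma>' B) (G'_sub p B \<sigma>' \<tau>')) \<noteq> {})))"
proof -
  note p = assms(1) and B = assms(7) and \<sigma> = assms(9) and \<tau> = assms(10)
  \<comment> \<open>The \<open>order\<close> of an infinite carrier is \<open>0\<close>, so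
    \<open>n > 0\<close> excludes it.\<close>
  have fin: "finite (carrier B)"
    using \<open>n > 0\<close> \<open>order B = n\<close> by (metis card.infinite less_irrefl order_def)
  have n: "\<not> p dvd order B" using \<open>\<not> p dvd n\<close> \<open>order B = n\<close> by simp
  have normal: "\<And>H :: nat monoid. group H \<Longrightarrow> order H = order B * p \<Longrightarrow> \<exists>N. N \<lhd> H \<and> card N = p"
    using assms(5) \<open>order B = n\<close> by simp
  let ?A = "Zp_semidirect p \<sigma> B"
  let ?t = "\<lambda>a. \<tau> (a, lam B a)"
  note G_eq = G_sub_eq[OF p B \<sigma> \<tau>] and G'_eq = G'_sub_eq[OF p B \<sigma> \<tau>]
  have G: "brace_extension p B \<sigma> (\<lambda>_. 1) ?t"
    using p B \<sigma> brace_chars_one regular_hom_units[OF B \<tau>] by unfold_locales auto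
  have G': "brace_extension p B \<sigma> \<sigma> ?t"
    using p B \<sigma> regular_hom_units[OF B \<tau>] by unfold_locales auto
  have regular: "regular_subgroup ?A (G_sub p B \<sigma> \<tau>)" "regular_subgroup ?A (G'_sub p B \<sigma> \<tau>)"
    unfolding G_eq G'_eq by (rule brace_extension.regular_C[OF G] brace_extension.regular_C[OF G'])+
  have iso: "(holomorph ?A)\<lparr>carrier := G_sub p B \<sigma> \<tau>\<rparr> \<cong> Zp_semidirect p \<tau> (regular_group B)"
    "(holomorph ?A)\<lparr>carrier := G'_sub p B \<sigma> \<tau>\<rparr> \<cong> Zp_semidirect p \<tau> (regular_group B)"
    unfolding G_eq G'_eq
    by (rule brace_extension.iso_regular_C[OF G] brace_extension.iso_regular_C[OF G'], rule refl)+
  \<comment> \<open>For \<open>\<sigma> = 1\<close> both sets come from the same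
    \<open>ext_brace\<close>, the one with \<open>u = 1\<close>.\<close>
  have trivial: "G_sub p B (\<lambda>_. \<one>\<^bsub>Zp p\<^esub>) \<tau> = G'_sub p B (\<lambda>_. \<one>\<^bsub>Zp p\<^esub>) \<tau>"
    using G_sub_eq[OF p B brace_chars_one[OF p] \<tau>] G'_sub_eq[OF p B brace_chars_one[OF p] \<tau>]
    by (simp add: Zp_ops[OF p])
  have not_conj: "\<not> conjugate_in (holomorph ?A) (G_sub p B \<sigma> \<tau>) (G'_sub p B \<sigma> \<tau>)"
    if "\<exists>a\<in>carrier B. \<sigma> a \<noteq> \<one>\<^bsub>Zp p\<^esub>"
    using not_conjugate_ext_brace[OF p B fin n \<sigma> regular_hom_units[OF B \<tau>]] that
    unfolding G_eq G'_eq by (auto simp: Zp_ops[OF p])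
  have class_iff: "regular_subgroup ?A R \<and> in_class p B \<sigma> \<tau> R \<longleftrightarrow>
    conjugate_in (holomorph ?A) (G_sub p B \<sigma> \<tau>) R \<or> conjugate_in (holomorph ?A) (G'_sub p B \<sigma> \<tau>) R" for R
  proof
    assume cls: "regular_subgroup ?A R \<and> in_class p B \<sigma> \<tau> R"
    then interpret classification p B \<sigma> R
      using p B fin n normal \<sigma> by unfold_locales auto
    show "conjugate_in (holomorph ?A) (G_sub p B \<sigma> \<tau>) R \<or> conjugate_in (holomorph ?A) (G'_sub p B \<sigma> \<tau>) R"
      using in_class_imp_conjugate[OF \<tau>] cls by blast
  next
    assume "conjugate_in (holomorph ?A) (G_sub p B \<sigma> \<tau>) R \<or> conjugate_in (holomorph ?A) (G'_sub p B \<sigma> \<tau>) R"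
    then show "regular_subgroup ?A R \<and> in_class p B \<sigma> \<tau> R"
      using conjugate_imp_in_class[OF p B fin n G] conjugate_imp_in_class[OF p B fin n G']
      unfolding G_eq G'_eq by blast
  qed
  have arbitrary: "\<exists>\<sigma>' \<tau>'. \<sigma>' \<in> brace_chars p B \<and>
             \<tau>' \<in> hom (regular_group B) (units_of (Zp p)) \<and>
             Zp_semidirect p \<tau>' (regular_group B) \<cong> Zp_semidirect p \<tau> (regular_group B) \<and>
             (brace_iso (brace_of_regular ?A R)
                (brace_of_regular (Zp_semidirect p \<sigma>' B) (G_sub p B \<sigma>' \<tau>')) \<noteq> {} \<or>
              brace_iso (brace_of_regular ?A R)
                (brace_of_regular (Zp_semidirect p \<sigma>' B) (G'_sub p B \<sigma>' \<tau>')) \<noteq> {})"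
    if R: "regular_subgroup ?A R"
      and iso_R: "(holomorph ?A)\<lparr>carrier := R\<rparr> \<cong> Zp_semidirect p \<tau> (regular_group B)"
      and quot: "brace_iso (quotient_of_regular p B \<sigma> R) B \<noteq> {}" for R
  proof -
    interpret classification p B \<sigma> R
      using p B fin n normal \<sigma> R by unfold_locales auto
    show ?thesis using brace_iso_some_pair[OF iso_R quot] by metis
  qed
  show ?thesis
    using regular iso trivial not_conj class_iff arbitrary by simp
qed

end
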